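(* Let $\Omega$ be a finite set, $\ell \ge 2$, and $\mathcal{P}$ a probability distribution over $\Omega^\ell$ with all marginals equal to $\pi$, generated by Markov chains. For $n \in \mathbb{N}$ let $\overline{X}_i = (X_i^{(1)},\ldots,X_i^{(\ell)})$, $i \in \{1,\ldots,n\}$, be i.i.d. according to $\mathcal{P}$ and $\underline{X}^{(j)} = (X_1^{(j)},\ldots,X_n^{(j)})$. Then there is a function $c(\alpha, \ell, \mu)$, independent of $n$ and positive whenever $\alpha > 0$ (and $\mu > 0$), such that for every $n$ and every $f: \Omega^n \to [0,1]$ with $\mathbb{E}[f(\underline{X}^{(1)})] = \mu > 0$, \[ \mathbb{E}\Big[\prod_{j=1}^\ell f(\underline{X}^{(j)})\Big] \ge c(\alpha(\mathcal{P}), \ell, \mu). \]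
   Context: $\Omega$ is the support of $\pi$; $\alpha(\mathcal{P}) := \min_{x \in \Omega} \mathcal{P}(x,\ldots,x)$. $\mathcal{P}$ is generated by Markov chains if, for $\overline{X} = (X^{(1)},\ldots,X^{(\ell)}) \sim \mathcal{P}$, for every $j \in \{2,\ldots,\ell\}$ and $x^{(1)},\ldots,x^{(j)} \in \Omega$: $\Pr[X^{(j)} = x^{(j)} \mid X^{(1)} = x^{(1)}, \ldots, X^{(j-1)} = x^{(j-1)}] = \Pr[X^{(j)} = x^{(j)} \mid X^{(j-1)} = x^{(j-1)}]$ (the transition kernels may differ between steps). *)

theory Defs
  imports "HOL-Probability.Probability"
begin

text \<open>
  A distribution over \<open>\<Omega>\<close> to the power \<open>l\<close> is a pmf on functions \<open>nat \<Rightarrow> 'a\<close>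
  whose support lies in \<open>{1..l} \<rightarrow>\<^sub>E \<Omega>\<close>; elements of \<open>\<Omega>\<close> to the power \<open>n\<close> are encoded likewise.
\<close>

definition equal_marginals :: "nat \<Rightarrow> (nat \<Rightarrow> 'a) pmf \<Rightarrow> 'a pmf \<Rightarrow> bool" where
  "equal_marginals l P \<pi> \<longleftrightarrow> (\<forall>j\<in>{1..l}. map_pmf (\<lambda>X. X j) P = \<pi>)"

definition diag_min :: "'a set \<Rightarrow> nat \<Rightarrow> (nat \<Rightarrow> 'a) pmf \<Rightarrow> real" where
  "diag_min \<Omega> l P = Min ((\<lambda>x. pmf P (\<lambda>j\<in>{1..l}. x)) ` \<Omega>)"

text \<open>
  The identity of conditional probabilities is required only for histories of positive
  probability. The guard is necessary: \<^const>\<open>cond_prob\<close> takes the value 0 on null histories.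
\<close>

definition generated_by_Markov_chains :: "'a set \<Rightarrow> nat \<Rightarrow> (nat \<Rightarrow> 'a) pmf \<Rightarrow> bool" where
  "generated_by_Markov_chains \<Omega> l P \<longleftrightarrow>
     (\<forall>j\<in>{2..l}. \<forall>x\<in>{1..j} \<rightarrow>\<^sub>E \<Omega>.
        \<P>(X in measure_pmf P. \<forall>i\<in>{1..<j}. X i = x i) > 0 \<longrightarrow>
        \<P>(X in measure_pmf P. X j = x j \<bar> \<forall>i\<in>{1..<j}. X i = x i) =
        \<P>(X in measure_pmf P. X j = x j \<bar> X (j - 1) = x (j - 1)))"

text \<open>
  The joint law of \<open>n\<close> independent tuples distributed as \<open>P\<close>; in a sample \<open>X\<close>, the value
  \<open>X i j\<close> is the \<open>j\<close>-th entry of the \<open>i\<close>-th tuple.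
\<close>

definition iid_tuples :: "nat \<Rightarrow> (nat \<Rightarrow> 'a) pmf \<Rightarrow> (nat \<Rightarrow> nat \<Rightarrow> 'a) pmf" where
  "iid_tuples n P = Pi_pmf {1..n} undefined (\<lambda>_. P)"

definition step_vec :: "nat \<Rightarrow> (nat \<Rightarrow> nat \<Rightarrow> 'a) \<Rightarrow> nat \<Rightarrow> (nat \<Rightarrow> 'a)" where
  "step_vec n X j = (\<lambda>i\<in>{1..n}. X i j)"

end

theory Submission
  imports Defs
begin

text \<open>
  Long chains reduce to two steps: if \<open>g\<close> is the product of \<open>f\<close> and the conditional expectation of
  \<open>f\<close> one step later, then the correlation of \<open>f\<close> over \<open>m + 1\<close> steps dominates that of \<open>g\<close> over
  \<open>m\<close> steps, and the mean of \<open>g\<close> is a two-step correlation of \<open>f\<close>.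

  A pair law with equal marginals and diagonal at least \<open>\<alpha>\<close> is, after removing some of its diagonal,
  a circulation, hence a mixture of closed walks. Putting the diagonal back, it is a mixture of images
  of one lazy shift of a cyclic group, whose size and spectral gap depend on \<open>\<alpha>\<close> only. It remains to
  bound the correlation of \<open>f\<close> with itself under \<open>n\<close> independent lazy shifts.

  Call the influences of \<open>f\<close> after a slight noise its smoothed influences. If one of them is large,
  fixing this coordinate (to the same value at both times, which costs a constant factor by laziness)
  increases the energy of the smoothed function on average, while it preserves the mean on average; so
  after boundedly many restrictions all smoothed influences are small and the mean is still at least
  half of what it was. By the spectral gap, \<open>f\<close> may then be replaced by its smoothed version \<open>F\<close>, up to
  a small error. Finally \<open>U = (F + \<eta>) powr (1 / k)\<close> satisfies \<open>E[U(X)^k U(Y)^k] \<ge> (E U)^(2 k)\<close>,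
  one coordinate at a time: in each coordinate this is a convexity inequality which holds, for \<open>k\<close> large
  in terms of the gap, near constant functions. The total error is a sum of fourth moments of
  one-coordinate fluctuations, which hypercontractivity makes small when the influences are small.
\<close>


section \<open>Operators acting on single coordinates\<close>

text \<open>The constant must not depend on the state space, yet a pair law with a heavy diagonal
  may have no spectral gap at all: it can even be carried by the diagonal. Mixing cyclic shifts
  supplies a gap anyway. As \<open>\<alpha>\<close> bounds the number of states, all cycle lengths
  divide one factorial, so a single shift serves every component.

  The exponent \<open>k\<close> is set by second order terms: the powers gain almost
  \<open>k (k - 1) / 2\<close> times the two variances, while the covariance can cost
  \<open>k^2 \<rho> / 2\<close> times them, hence the condition \<open>k (1 - \<rho>) > 1\<close>.
  Away from constants the inequality may fail; the shift by \<open>\<eta>\<close> keeps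
  \<open>U\<close> away from 0, so that a failure requires a fluctuation of fixed size. It is
  charged to the fourth moment because the second moments have a bounded sum that need not be small.

  The noise has to be close to the identity for the smoothing error to be small, so
  hypercontractivity at a strong noise does not suffice by itself.\<close>

definition coord :: "nat \<Rightarrow> (('v \<Rightarrow> real) \<Rightarrow> 'v \<Rightarrow> real) \<Rightarrow> ((nat \<Rightarrow> 'v) \<Rightarrow> real) \<Rightarrow> (nat \<Rightarrow> 'v) \<Rightarrow> real" where
  "coord i L f x = L (\<lambda>b. f (x(i := b))) (x i)"

text \<open>Rows are finitely supported, so operators on different coordinates commute by
  interchanging finite sums, although the type of states may be infinite.\<close>

definition kernel_op :: "(('v \<Rightarrow> real) \<Rightarrow> 'v \<Rightarrow> real) \<Rightarrow> bool" where
  "kernel_op L \<longleftrightarrow> (\<exists>S A. (\<forall>a. finite (S a)) \<and> (\<forall>u a. L u a = (\<Sum>b\<in>S a. A a b * u b)))"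

lemma kernel_opE:
  assumes "kernel_op L"
  obtains S A where "\<And>a. finite (S a)" "\<And>u a. L u a = (\<Sum>b\<in>S a. A a b * u b)"
  using assms unfolding kernel_op_def by blast

lemma kernel_opI:
  assumes "\<And>a. finite (S a)" "\<And>u a. L u a = (\<Sum>b\<in>S a. A a b * u b)"
  shows "kernel_op L"
  using assms unfolding kernel_op_def by blast

lemma kernel_op_add: "kernel_op L \<Longrightarrow> L (\<lambda>b. u b + v b) a = L u a + L v a"
  by (elim kernel_opE) (simp add: algebra_simps sum.distrib)

lemma kernel_op_scale: "kernel_op L \<Longrightarrow> L (\<lambda>b. c * u b) a = c * L u a"
  by (elim kernel_opE) (simp add: algebra_simps sum_distrib_left)

lemma kernel_op_id [simp, intro]: "kernel_op (\<lambda>u. u)"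
  by (rule kernel_opI[where S = "\<lambda>a. {a}" and A = "\<lambda>_ _. 1"]) auto

text \<open>Evaluation at \<open>a\<close>: placed at coordinate \<open>i\<close> it fixes that
  coordinate, so restrictions obey the same calculus as averages.\<close>

lemma kernel_op_const: "kernel_op (\<lambda>u _. u a)"
  by (rule kernel_opI[where S = "\<lambda>_. {a}" and A = "\<lambda>_ _. 1"]) auto

lemma kernel_op_lincomb:
  assumes "kernel_op L" "kernel_op M"
  shows "kernel_op (\<lambda>u a. s * L u a + t * M u a)"
proof -
  obtain S A where L: "\<And>a. finite (S a)" "\<And>u a. L u a = (\<Sum>b\<in>S a. A a b * u b)"
    using assms(1) unfolding kernel_op_def by blast
  obtain T B where M: "\<And>a. finite (T a)" "\<And>u a. M u a = (\<Sum>b\<in>T a. B a b * u b)"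
    using assms(2) unfolding kernel_op_def by blast
  show ?thesis
  proof (rule kernel_opI[where S = "\<lambda>a. S a \<union> T a" and
      A = "\<lambda>a b. s * (if b \<in> S a then A a b else 0) + t * (if b \<in> T a then B a b else 0)"])
    fix u a
    have 1: "(\<Sum>b\<in>S a \<union> T a. (if b \<in> S a then A a b else 0) * u b) = L u a"
      unfolding L(2) by (rule sum.mono_neutral_cong_right) (use L M in auto)
    have 2: "(\<Sum>b\<in>S a \<union> T a. (if b \<in> T a then B a b else 0) * u b) = M u a"
      unfolding M(2) by (rule sum.mono_neutral_cong_right) (use L M in auto)
    show "s * L u a + t * M u a = (\<Sum>b\<in>S a \<union> T a. (s * (if b \<in> S a then A a b else 0) +
        t * (if b \<in> T a then B a b else 0)) * u b)"
      unfolding 1[symmetric] 2[symmetric] by (simp only: sum_distrib_left sum.distrib ring_distribs mult.assoc)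
  qed (use L M in auto)
qed

lemma kernel_op_comp:
  assumes "kernel_op L" "kernel_op M"
  shows "kernel_op (\<lambda>u. L (M u))"
proof -
  obtain S A where L: "\<And>a. finite (S a)" "\<And>u a. L u a = (\<Sum>b\<in>S a. A a b * u b)"
    using assms(1) unfolding kernel_op_def by blast
  obtain T B where M: "\<And>a. finite (T a)" "\<And>u a. M u a = (\<Sum>b\<in>T a. B a b * u b)"
    using assms(2) unfolding kernel_op_def by blast
  show ?thesis
  proof (rule kernel_opI[where S = "\<lambda>a. \<Union>c\<in>S a. T c" and
      A = "\<lambda>a b. \<Sum>c\<in>S a. A a c * (if b \<in> T c then B c b else 0)"])
    fix u a
    have "M u c = (\<Sum>b\<in>(\<Union>c\<in>S a. T c). (if b \<in> T c then B c b else 0) * u b)" if "c \<in> S a" for c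
      unfolding M(2) by (rule sum.mono_neutral_cong_left) (use L M that in auto)
    then have "L (M u) a = (\<Sum>c\<in>S a. A a c * (\<Sum>b\<in>(\<Union>c\<in>S a. T c). (if b \<in> T c then B c b else 0) * u b))"
      by (simp add: L(2))
    also have "\<dots> = (\<Sum>c\<in>S a. \<Sum>b\<in>(\<Union>c\<in>S a. T c). A a c * (if b \<in> T c then B c b else 0) * u b)"
      by (simp only: sum_distrib_left mult.assoc)
    also have "\<dots> = (\<Sum>b\<in>(\<Union>c\<in>S a. T c). \<Sum>c\<in>S a. A a c * (if b \<in> T c then B c b else 0) * u b)"
      by (rule sum.swap)
    finally show "L (M u) a = (\<Sum>b\<in>(\<Union>c\<in>S a. T c). (\<Sum>c\<in>S a. A a c * (if b \<in> T c then B c b else 0)) * u b)"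
      by (simp only: sum_distrib_right)
  qed (use L M in auto)
qed

lemma coord_id [simp]: "coord i (\<lambda>u. u) f = f"
  by (auto simp: coord_def)

lemma coord_at: "coord i L (coord i M f) = coord i (\<lambda>u. L (M u)) f"
  by (auto simp: coord_def)

lemma coord_const: "coord i (\<lambda>u _. u a) f = (\<lambda>x. f (x(i := a)))"
  by (auto simp: coord_def)

lemma coord_commute:
  assumes "kernel_op L" "kernel_op M" "i \<noteq> j"
  shows "coord i L (coord j M f) = coord j M (coord i L f)"
proof -
  obtain S A where L: "\<And>a. finite (S a)" "\<And>u a. L u a = (\<Sum>b\<in>S a. A a b * u b)"
    using assms(1) unfolding kernel_op_def by blast
  obtain T B where M: "\<And>a. finite (T a)" "\<And>u a. M u a = (\<Sum>b\<in>T a. B a b * u b)"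
    using assms(2) unfolding kernel_op_def by blast
  show ?thesis
  proof
    fix x
    have "coord i L (coord j M f) x = (\<Sum>b\<in>S (x i). \<Sum>c\<in>T (x j). A (x i) b * (B (x j) c * f (x(i := b, j := c))))"
      using \<open>i \<noteq> j\<close> by (simp add: coord_def L M sum_distrib_left)
    also have "\<dots> = (\<Sum>c\<in>T (x j). \<Sum>b\<in>S (x i). B (x j) c * (A (x i) b * f (x(j := c, i := b))))"
      by (subst sum.swap) (simp add: fun_upd_twist[OF \<open>i \<noteq> j\<close>] mult.left_commute)
    also have "\<dots> = coord j M (coord i L f) x"
      using \<open>i \<noteq> j\<close> by (simp add: coord_def L M sum_distrib_left)
    finally show "coord i L (coord j M f) x = coord j M (coord i L f) x" .
  qed
qed

section \<open>Products of one-coordinate operators\<close>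

primrec tens :: "(nat \<Rightarrow> ('v \<Rightarrow> real) \<Rightarrow> 'v \<Rightarrow> real) \<Rightarrow> nat \<Rightarrow> ((nat \<Rightarrow> 'v) \<Rightarrow> real) \<Rightarrow> (nat \<Rightarrow> 'v) \<Rightarrow> real" where
  "tens L 0 f = f"
| "tens L (Suc n) f = tens L n (coord (Suc n) (L (Suc n)) f)"

lemma tens_cong: "(\<And>i. i \<in> {1..n} \<Longrightarrow> L i = M i) \<Longrightarrow> tens L n f = tens M n f"
  by (induction n arbitrary: f) auto

lemma coord_tens_commute:
  assumes "kernel_op L" "\<And>j. kernel_op (M j)" "i \<notin> {1..n}"
  shows "coord i L (tens M n f) = tens M n (coord i L f)"
  using assms(3)
proof (induction n arbitrary: f)
  case (Suc n)
  then have "i \<notin> {1..n}"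
    by auto
  then have "coord i L (tens M (Suc n) f) = tens M n (coord i L (coord (Suc n) (M (Suc n)) f))"
    using Suc.IH by simp
  also have "coord i L (coord (Suc n) (M (Suc n)) f) = coord (Suc n) (M (Suc n)) (coord i L f)"
    using Suc.prems assms by (intro coord_commute) auto
  finally show ?case by simp
qed simp

text \<open>Distinct coordinates commute, so the last one can be peeled off outside instead of
  inside. The definition suits inductions that change \<open>f\<close>; this form exposes the value
  at the last coordinate.\<close>

lemma tens_Suc':
  assumes "\<And>j. kernel_op (L j)"
  shows "tens L (Suc n) f = coord (Suc n) (L (Suc n)) (tens L n f)"
  using coord_tens_commute[of "L (Suc n)" L "Suc n" n f] assms by simp

text \<open>Commuting lines up the two operators at each coordinate. Identities for noise and
  transitions in \<open>n\<close> coordinates thereby reduce to one coordinate.\<close>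

lemma tens_tens:
  assumes "\<And>j. kernel_op (L j)" "\<And>j. kernel_op (M j)"
  shows "tens L n (tens M n f) = tens (\<lambda>i u. L i (M i u)) n f"
proof (induction n arbitrary: f)
  case (Suc n)
  have "tens L (Suc n) (tens M (Suc n) f) =
      tens L n (coord (Suc n) (L (Suc n)) (coord (Suc n) (M (Suc n)) (tens M n f)))"
    by (simp only: tens_Suc'[OF assms(2)]) simp
  also have "\<dots> = tens L n (tens M n (coord (Suc n) (\<lambda>u. L (Suc n) (M (Suc n) u)) f))"
    using assms by (simp add: coord_at coord_tens_commute kernel_op_comp)
  finally show ?case using Suc by simp
qed simp

lemma tens_id: "(\<And>i. i \<in> {1..n} \<Longrightarrow> L i = (\<lambda>u. u)) \<Longrightarrow> tens L n f = f"
  by (induction n arbitrary: f) auto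

lemma coord_eq_tens: "i \<in> {1..n} \<Longrightarrow> coord i L f = tens ((\<lambda>_ u. u)(i := L)) n f"
proof (induction n arbitrary: f)
  case (Suc n)
  show ?case
  proof (cases "i = Suc n")
    case True
    have "tens ((\<lambda>_ u. u)(i := L)) n g = g" for g
      using True by (intro tens_id) auto
    then show ?thesis using True by (simp add: fun_upd_same del: fun_upd_apply)
  next
    case False
    then show ?thesis using Suc by auto
  qed
qed simp

lemma coord_tens:
  assumes "kernel_op L" "\<And>j. kernel_op (M j)" "i \<in> {1..n}"
  shows "coord i L (tens M n f) = tens (M(i := (\<lambda>u. L (M i u)))) n f"
  unfolding coord_eq_tens[OF assms(3)]
  by (subst tens_tens) (use assms in \<open>auto intro: tens_cong\<close>)

lemma tens_coord:
  assumes "kernel_op L" "\<And>j. kernel_op (M j)" "i \<in> {1..n}"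
  shows "tens M n (coord i L f) = tens (M(i := (\<lambda>u. M i (L u)))) n f"
  unfolding coord_eq_tens[OF assms(3)]
  by (subst tens_tens) (use assms in \<open>auto intro: tens_cong\<close>)

lemma coord_add: "kernel_op L \<Longrightarrow> coord i L (\<lambda>x. f x + g x) = (\<lambda>x. coord i L f x + coord i L g x)"
  unfolding coord_def by (rule ext) (rule kernel_op_add)

lemma coord_scale: "kernel_op L \<Longrightarrow> coord i L (\<lambda>x. c * f x) = (\<lambda>x. c * coord i L f x)"
  unfolding coord_def by (rule ext) (rule kernel_op_scale)

lemma tens_add:
  assumes "\<And>j. kernel_op (L j)"
  shows "tens L n (\<lambda>x. f x + g x) = (\<lambda>x. tens L n f x + tens L n g x)"
  by (induction n arbitrary: f g) (simp_all add: coord_add assms)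

lemma tens_scale:
  assumes "\<And>j. kernel_op (L j)"
  shows "tens L n (\<lambda>x. c * f x) = (\<lambda>x. c * tens L n f x)"
  by (induction n arbitrary: f) (simp_all add: coord_scale assms)

lemma tens_diff:
  assumes "\<And>j. kernel_op (L j)"
  shows "tens L n (\<lambda>x. f x - g x) = (\<lambda>x. tens L n f x - tens L n g x)"
  using tens_add[of L n f "\<lambda>x. - 1 * g x"] tens_scale[of L n "-1" g] assms by simp

lemma tens_sum:
  assumes "\<And>j. kernel_op (L j)" "finite I"
  shows "tens L n (\<lambda>x. \<Sum>k\<in>I. f k x) = (\<lambda>x. \<Sum>k\<in>I. tens L n (f k) x)"
  using assms(2)
proof (induction I rule: finite_induct)
  case empty
  then show ?case using tens_scale[of L n 0 "\<lambda>_. 0"] assms by simp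
next
  case (insert k I)
  then show ?case by (simp add: tens_add assms)
qed

lemma tens_upd:
  fixes f :: "(nat \<Rightarrow> 'v) \<Rightarrow> real"
  assumes "\<And>j. kernel_op (L j)" "i \<notin> {1..n}"
  shows "(tens L n f) (x(i := a)) = tens L n (\<lambda>y. f (y(i := a))) x"
  using coord_tens_commute[of "\<lambda>u _. u a" L i n f, OF kernel_op_const assms] by (simp add: coord_const fun_eq_iff)

text \<open>A quadratic in \<open>t\<close> without negative values has nonpositive discriminant;
  once \<open>c\<close> is known to be positive, its minimiser \<open>b / c\<close> gives the
  bound.\<close>

lemma cauchy_schwarz_discriminant:
  fixes a b c :: real
  assumes "\<And>t. 0 \<le> a - 2 * t * b + t\<^sup>2 * c"
  shows "b\<^sup>2 \<le> a * c"
proof (cases "c = 0")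
  case True
  have "b = 0"
  proof (rule ccontr)
    assume "b \<noteq> 0"
    then show False using assms[of "(a + 1) / (2 * b)"] True by (simp add: field_simps)
  qed
  then show ?thesis using True by simp
next
  case False
  moreover have "c \<ge> 0"
  proof (rule ccontr)
    assume "\<not> c \<ge> 0"
    \<comment> \<open>For negative \<open>c\<close> this \<open>t\<close> is so large that the
      quadratic term outweighs both lower ones.\<close>
    define t where "t = max 1 ((\<bar>a\<bar> + 2 * \<bar>b\<bar> + 1) / (-c))"
    have t: "t \<ge> 1" by (simp add: t_def)
    have "t * (-c) \<ge> \<bar>a\<bar> + 2 * \<bar>b\<bar> + 1"
      using \<open>\<not> c \<ge> 0\<close> by (simp add: t_def field_simps max_def)
    then have "t * (t * (-c)) \<ge> t * (\<bar>a\<bar> + 2 * \<bar>b\<bar> + 1)"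
      using t by (intro mult_left_mono) auto
    moreover have "t * (\<bar>a\<bar> + 2 * \<bar>b\<bar> + 1) \<ge> 1 * \<bar>a\<bar> + 2 * t * \<bar>b\<bar> + 1"
      using t mult_right_mono[of 1 t "\<bar>a\<bar>"] by (simp add: algebra_simps)
    moreover have "2 * t * b \<ge> - (2 * t * \<bar>b\<bar>)" using t
      mult_left_mono[of "-b" "\<bar>b\<bar>" "2 * t"] by linarith
    ultimately have "a - 2 * t * b + t\<^sup>2 * c < 0"
      by (simp add: power2_eq_square algebra_simps)
    then show False using assms[of t] by simp
  qed
  ultimately have "c > 0" by simp
  then show ?thesis using assms[of "b / c"] by (simp add: field_simps power2_eq_square)
qed

section \<open>A finite chain with a spectral gap\<close>

text \<open>\<open>p\<close> bounds both the atoms of \<open>\<pi>\<close> and the holding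
  probabilities. The gap is stated as a contraction of mean-zero functions because a lazy cyclic
  shift is in general not reversible. Rows sum to 1 also outside \<open>V\<close>, so that the
  transition fixes constants at every point.\<close>

locale contractive_kernel =
  fixes V :: "'v set" and \<pi> :: "'v \<Rightarrow> real" and K :: "'v \<Rightarrow> 'v \<Rightarrow> real" and p \<rho> :: real
  assumes finite_V: "finite V"
    and p_pos: "p > 0"
    and pi_ge: "\<And>b. b \<in> V \<Longrightarrow> \<pi> b \<ge> p"
    and sum_pi: "(\<Sum>b\<in>V. \<pi> b) = 1"
    and K_nonneg: "\<And>a b. K a b \<ge> 0"
    and K_sum: "\<And>a. (\<Sum>b\<in>V. K a b) = 1"
    and K_diag: "\<And>a. a \<in> V \<Longrightarrow> K a a \<ge> p"
    and stationary: "\<And>b. b \<in> V \<Longrightarrow> (\<Sum>a\<in>V. \<pi> a * K a b) = \<pi> b"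
    and rho: "0 < \<rho>" "\<rho> < 1"
    and contractive: "\<And>u. (\<Sum>b\<in>V. \<pi> b * u b) = 0 \<Longrightarrow>
      (\<Sum>a\<in>V. \<pi> a * (\<Sum>b\<in>V. K a b * u b)\<^sup>2) \<le> \<rho>\<^sup>2 * (\<Sum>b\<in>V. \<pi> b * (u b)\<^sup>2)"
begin

text \<open>\<open>Rv t\<close> is the noise that keeps a state with probability \<open>t\<close>
  and resamples it from \<open>\<pi>\<close> otherwise; \<open>Dv\<close> projects onto mean-zero
  functions, and its square mean at a coordinate is the influence.\<close>

definition av :: "('v \<Rightarrow> real) \<Rightarrow> real" where "av u = (\<Sum>b\<in>V. \<pi> b * u b)"
definition Av :: "('v \<Rightarrow> real) \<Rightarrow> 'v \<Rightarrow> real" where "Av u a = av u"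
definition Rv :: "real \<Rightarrow> ('v \<Rightarrow> real) \<Rightarrow> 'v \<Rightarrow> real" where "Rv t u a = t * u a + (1 - t) * av u"
definition Dv :: "('v \<Rightarrow> real) \<Rightarrow> 'v \<Rightarrow> real" where "Dv u a = u a - av u"
definition Kv :: "('v \<Rightarrow> real) \<Rightarrow> 'v \<Rightarrow> real" where "Kv u a = (\<Sum>b\<in>V. K a b * u b)"

text \<open>
  Expectation, noise and \<open>n\<close> steps of the chain act on the coordinates \<open>1..n\<close> only, so that
  \<open>EE n f\<close> is still a function of the remaining ones.
\<close>

abbreviation "EE \<equiv> tens (\<lambda>_. Av)"
abbreviation "RR t \<equiv> tens (\<lambda>_. Rv t)"
abbreviation "Kn \<equiv> tens (\<lambda>_. Kv)"
abbreviation "D i \<equiv> coord i Dv"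

section \<open>Identities in a single coordinate\<close>

lemma pi_nonneg: "b \<in> V \<Longrightarrow> \<pi> b \<ge> 0"
  using pi_ge[of b] p_pos by simp

lemma av_add: "av (\<lambda>a. u a + v a) = av u + av v"
  by (simp add: av_def algebra_simps sum.distrib)

lemma av_scale: "av (\<lambda>a. c * u a) = c * av u"
  by (simp add: av_def algebra_simps sum_distrib_left)

lemma av_const [simp]: "av (\<lambda>a. c) = c"
  using sum_pi by (simp add: av_def flip: sum_distrib_right)

lemma av_diff: "av (\<lambda>a. u a - v a) = av u - av v"
  by (simp add: av_def algebra_simps sum_subtractf)

lemma av_mono: "(\<And>a. a \<in> V \<Longrightarrow> u a \<le> v a) \<Longrightarrow> av u \<le> av v"
  unfolding av_def by (intro sum_mono mult_left_mono pi_nonneg)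

lemma av_cong: "(\<And>a. a \<in> V \<Longrightarrow> u a = v a) \<Longrightarrow> av u = av v"
  unfolding av_def by (intro sum.cong) auto

lemma av_nonneg: "(\<And>a. a \<in> V \<Longrightarrow> 0 \<le> u a) \<Longrightarrow> 0 \<le> av u"
  using av_mono[of "\<lambda>_. 0" u] by simp

lemma av_sum: "finite I \<Longrightarrow> av (\<lambda>a. \<Sum>k\<in>I. u k a) = (\<Sum>k\<in>I. av (u k))"
  by (simp add: av_def sum_distrib_left) (rule sum.swap)

lemma av_ge_single:
  assumes "a \<in> V" "\<And>b. b \<in> V \<Longrightarrow> 0 \<le> u b"
  shows "p * u a \<le> av u"
proof -
  have "p * u a \<le> \<pi> a * u a" using assms pi_ge by (intro mult_right_mono) auto
  also have "\<dots> \<le> av u"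
    unfolding av_def using assms finite_V pi_nonneg by (intro member_le_sum) auto
  finally show ?thesis .
qed

lemma kernel_op_Av [simp, intro]: "kernel_op Av"
  by (rule kernel_opI[where S = "\<lambda>_. V" and A = "\<lambda>_. \<pi>"]) (auto simp: Av_def av_def finite_V)

lemma kernel_op_Kv [simp, intro]: "kernel_op Kv"
  by (rule kernel_opI[where S = "\<lambda>_. V" and A = K]) (auto simp: Kv_def finite_V)

lemma kernel_op_Rv [simp, intro]: "kernel_op (Rv t)"
proof -
  have "Rv t = (\<lambda>u a. t * u a + (1 - t) * Av u a)"
    by (auto simp: Rv_def Av_def fun_eq_iff)
  then show ?thesis
    using kernel_op_lincomb[of "\<lambda>u. u" Av t "1 - t"] by simp
qed

lemma kernel_op_Dv [simp, intro]: "kernel_op Dv"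
proof -
  have "Dv = (\<lambda>u a. 1 * u a + (-1) * Av u a)"
    by (auto simp: Dv_def Av_def fun_eq_iff)
  then show ?thesis
    using kernel_op_lincomb[of "\<lambda>u. u" Av 1 "-1"] by simp
qed

lemma av_Kv: "av (Kv u) = av u"
proof -
  have "av (Kv u) = (\<Sum>b\<in>V. \<Sum>a\<in>V. \<pi> a * K a b * u b)"
    by (simp add: av_def Kv_def sum_distrib_left mult.assoc) (rule sum.swap)
  also have "\<dots> = av u"
    unfolding av_def by (intro sum.cong) (simp_all add: stationary flip: sum_distrib_right)
  finally show ?thesis .
qed

lemma Kv_const [simp]: "Kv (\<lambda>a. c) = (\<lambda>a. c)"
  using K_sum by (auto simp: Kv_def simp flip: sum_distrib_right)

lemma Kv_add: "Kv (\<lambda>a. u a + v a) = (\<lambda>a. Kv u a + Kv v a)"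
  by (auto simp: Kv_def algebra_simps sum.distrib)

lemma Kv_scale: "Kv (\<lambda>a. c * u a) = (\<lambda>a. c * Kv u a)"
  by (auto simp: Kv_def algebra_simps sum_distrib_left)

lemma av_Av [simp]: "av (Av u) = av u"
  by (simp add: Av_def[abs_def])

lemma av_Dv [simp]: "av (Dv u) = 0"
  by (simp add: Dv_def[abs_def] av_diff)

lemma av_Rv [simp]: "av (Rv t u) = av u"
  by (simp add: Rv_def[abs_def] av_add av_scale) (simp add: algebra_simps)

lemma Rv_Rv: "Rv s (Rv t u) = Rv (s * t) u"
  by (rule ext) (simp only: Rv_def[of s] av_Rv, simp add: Rv_def algebra_simps)

lemma Rv_Kv: "Rv t (Kv u) = Kv (Rv t u)"
  by (simp add: Rv_def[abs_def] Kv_add Kv_scale av_Kv)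

lemma Rv_1: "Rv 1 u = u"
  by (auto simp: Rv_def)

lemma Dv_Dv [simp]: "Dv (Dv u) = Dv u"
  by (rule ext) (simp add: Dv_def[of "Dv u"])

lemma Dv_Rv: "Dv (Rv t u) = (\<lambda>a. t * Dv u a)"
  by (rule ext) (simp only: Dv_def av_Rv, simp add: Rv_def algebra_simps)

lemma Rv_Dv: "Rv t (Dv u) = (\<lambda>a. t * Dv u a)"
  by (rule ext) (simp add: Rv_def)

lemma Rv_adjoint: "av (\<lambda>a. u a * Rv t v a) = av (\<lambda>a. Rv t u a * v a)"
proof -
  have "av (\<lambda>a. u a * Rv t v a) = av (\<lambda>a. t * (u a * v a) + (1 - t) * av v * u a)"
    by (simp add: Rv_def algebra_simps)
  moreover have "av (\<lambda>a. Rv t u a * v a) = av (\<lambda>a. t * (u a * v a) + (1 - t) * av u * v a)"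
    by (simp add: Rv_def algebra_simps)
  ultimately show ?thesis by (simp add: av_add av_scale mult.assoc)
qed

lemma Dv_adjoint: "av (\<lambda>a. u a * Dv v a) = av (\<lambda>a. Dv u a * v a)"
proof -
  have "av (\<lambda>a. u a * Dv v a) = av (\<lambda>a. u a * v a - av v * u a)"
    by (simp add: Dv_def algebra_simps)
  moreover have "av (\<lambda>a. Dv u a * v a) = av (\<lambda>a. u a * v a - av u * v a)"
    by (simp add: Dv_def algebra_simps)
  ultimately show ?thesis by (simp add: av_diff av_scale)
qed

lemma av_power2_add_const: "av (\<lambda>a. (c + t * Dv u a)\<^sup>2) = c\<^sup>2 + t\<^sup>2 * av (\<lambda>a. (Dv u a)\<^sup>2)"
proof -
  have "av (\<lambda>a. (c + t * Dv u a)\<^sup>2) = av (\<lambda>a. c\<^sup>2 + ((2 * c * t) * Dv u a + t\<^sup>2 * (Dv u a)\<^sup>2))"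
    by (simp add: power2_eq_square algebra_simps)
  then show ?thesis by (simp add: av_add av_scale)
qed

lemma Rv_decompose: "Rv t u a = av u + t * Dv u a"
  by (simp add: Dv_def Rv_def algebra_simps)

lemma av_power2_Rv: "av (\<lambda>a. (Rv t u a)\<^sup>2) = (av u)\<^sup>2 + t\<^sup>2 * av (\<lambda>a. (Dv u a)\<^sup>2)"
  unfolding Rv_decompose by (rule av_power2_add_const)

lemma av_power2: "av (\<lambda>a. (u a)\<^sup>2) = (av u)\<^sup>2 + av (\<lambda>a. (Dv u a)\<^sup>2)"
  using av_power2_Rv[of 1 u] by (simp add: Rv_1)

text \<open>The transition preserves the mean and contracts the mean-zero part by
  \<open>\<rho>\<close>, which the noise merely multiplies by \<open>\<rho>\<close>. In square mean
  the chain may thus be replaced by a self-adjoint operator.\<close>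

lemma av_power2_Kv_le: "av (\<lambda>a. (Kv u a)\<^sup>2) \<le> av (\<lambda>a. (Rv \<rho> u a)\<^sup>2)"
proof -
  have "Dv (Kv u) = Kv (Dv u)"
  proof
    fix a
    have "Kv u = Kv (\<lambda>a. av u + Dv u a)" by (simp add: Dv_def)
    then have "Kv u a = av u + Kv (Dv u) a" by (simp add: Kv_add)
    then show "Dv (Kv u) a = Kv (Dv u) a" by (simp add: Dv_def[of "Kv u"] av_Kv)
  qed
  then have "av (\<lambda>a. (Kv u a)\<^sup>2) = (av u)\<^sup>2 + av (\<lambda>a. (Kv (Dv u) a)\<^sup>2)"
    by (subst av_power2) (simp add: av_Kv)
  also have "av (\<lambda>a. (Kv (Dv u) a)\<^sup>2) \<le> \<rho>\<^sup>2 * av (\<lambda>a. (Dv u a)\<^sup>2)"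
    using contractive[of "Dv u"] av_Dv[of u] unfolding Kv_def av_def by simp
  finally show ?thesis by (simp add: av_power2_Rv)
qed

lemma av_Jensen4: "(av u) ^ 4 \<le> av (\<lambda>a. (u a) ^ 4)"
proof -
  have sq: "(av v)\<^sup>2 \<le> av (\<lambda>a. (v a)\<^sup>2)" for v
    using av_power2[of v] av_nonneg[of "\<lambda>a. (Dv v a)\<^sup>2"] by simp
  have "(av u) ^ 4 = ((av u)\<^sup>2)\<^sup>2" by simp
  also have "\<dots> \<le> (av (\<lambda>a. (u a)\<^sup>2))\<^sup>2" using sq by (intro power_mono) auto
  also have "\<dots> \<le> av (\<lambda>a. ((u a)\<^sup>2)\<^sup>2)" by (rule sq)
  finally show ?thesis by simp
qed

section \<open>Expectation over the coordinates \<open>1..n\<close>\<close>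

lemma EE_Suc: "EE (Suc n) f = EE n (coord (Suc n) Av f)"
  by simp

lemma EE_Suc_av: "EE (Suc n) f x = av (\<lambda>b. EE n f (x(Suc n := b)))"
  by (subst tens_Suc') (auto simp: coord_def Av_def)

lemma EE_add: "EE n (\<lambda>x. f x + g x) x = EE n f x + EE n g x"
  by (subst tens_add) auto

lemma EE_diff: "EE n (\<lambda>x. f x - g x) x = EE n f x - EE n g x"
  by (subst tens_diff) auto

lemma EE_scale: "EE n (\<lambda>x. c * f x) x = c * EE n f x"
  by (subst tens_scale) auto

lemma EE_sum: "finite I \<Longrightarrow> EE n (\<lambda>x. \<Sum>k\<in>I. f k x) x = (\<Sum>k\<in>I. EE n (f k) x)"
  by (subst tens_sum) auto

lemma EE_mono: "(\<And>x. f x \<le> g x) \<Longrightarrow> EE n f x \<le> EE n g x"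
proof (induction n arbitrary: f g)
  case (Suc n)
  have "coord (Suc n) Av f x \<le> coord (Suc n) Av g x" for x
    using Suc.prems by (auto simp: coord_def Av_def intro!: av_mono)
  then show ?case using Suc.IH by simp
qed simp

lemma EE_const [simp]: "EE n (\<lambda>_. c) x = c"
  by (induction n) (auto simp: coord_def[abs_def] Av_def)

lemma EE_nonneg: "(\<And>x. 0 \<le> f x) \<Longrightarrow> 0 \<le> EE n f x"
  using EE_mono[of "\<lambda>_. 0" f n x] by simp

lemma EE_absorb:
  assumes "kernel_op L" "\<And>u. av (L u) = av u" "i \<in> {1..n}"
  shows "EE n (coord i L f) = EE n f"
proof -
  have "Av (L u) = Av u" for u by (rule ext) (simp add: Av_def assms)
  then show ?thesis
    by (subst tens_coord) (use assms in \<open>auto intro!: tens_cong\<close>)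
qed

lemma coord_Av: "coord i Av f = (\<lambda>x. av (\<lambda>b. f (x(i := b))))"
  by (auto simp: coord_def Av_def)

text \<open>Read from right to left, it exposes coordinate \<open>i\<close> under the expectation,
  so that a fact about that coordinate alone can be applied.\<close>

lemma EE_absorb_av:
  assumes "i \<in> {1..n}"
  shows "EE n (\<lambda>x. av (\<lambda>b. f (x(i := b)))) = EE n f"
  using EE_absorb[of Av i n f] assms by (simp add: coord_Av)

lemma EE_Cauchy_Schwarz: "(EE n (\<lambda>y. f y * g y) x)\<^sup>2 \<le> EE n (\<lambda>y. (f y)\<^sup>2) x * EE n (\<lambda>y. (g y)\<^sup>2) x"
proof (rule cauchy_schwarz_discriminant)
  fix t
  have "0 \<le> EE n (\<lambda>y. (f y - t * g y)\<^sup>2) x" by (intro EE_nonneg) simp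
  also have "(\<lambda>y. (f y - t * g y)\<^sup>2) = (\<lambda>y. (f y)\<^sup>2 - (2 * t) * (f y * g y) + t\<^sup>2 * (g y)\<^sup>2)"
    by (auto simp: power2_eq_square algebra_simps)
  finally show "0 \<le> EE n (\<lambda>y. (f y)\<^sup>2) x - 2 * t * EE n (\<lambda>y. f y * g y) x + t\<^sup>2 * EE n (\<lambda>y. (g y)\<^sup>2) x"
    by (simp only: EE_add EE_diff EE_scale)
qed

lemma EE_coord_adjoint:
  assumes "i \<in> {1..n}" "\<And>u v. av (\<lambda>a. u a * L v a) = av (\<lambda>a. L u a * v a)"
  shows "EE n (\<lambda>y. f y * coord i L g y) = EE n (\<lambda>y. coord i L f y * g y)"
  by (subst (1 2) EE_absorb_av[OF assms(1), symmetric]) (simp add: coord_def assms(2))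

lemma EE_RR_adjoint: "EE n (\<lambda>y. f y * RR t n g y) = EE n (\<lambda>y. RR t n f y * g y)"
proof -
  \<comment> \<open>Only the number \<open>k\<close> of noisy coordinates is inducted on: coordinate
    \<open>Suc k\<close> must be among those averaged by \<open>EE n\<close> when its noise is moved
    across.\<close>
  have "k \<le> n \<Longrightarrow> EE n (\<lambda>y. f y * RR t k g y) = EE n (\<lambda>y. RR t k f y * g y)" for k
  proof (induction k arbitrary: f)
    case (Suc k)
    have "EE n (\<lambda>y. f y * RR t (Suc k) g y) = EE n (\<lambda>y. f y * coord (Suc k) (Rv t) (RR t k g) y)"
      by (subst tens_Suc') auto
    also have "\<dots> = EE n (\<lambda>y. coord (Suc k) (Rv t) f y * RR t k g y)"
      using Suc.prems by (intro EE_coord_adjoint Rv_adjoint) auto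
    also have "\<dots> = EE n (\<lambda>y. RR t (Suc k) f y * g y)"
      using Suc by simp
    finally show ?case .
  qed simp
  then show ?thesis by simp
qed

lemma RR_RR: "RR s n (RR t n f) = RR (s * t) n f"
  by (subst tens_tens) (auto simp: Rv_Rv)

lemma RR_1: "RR 1 n f = f"
  by (rule tens_id) (auto simp: Rv_1[abs_def])

lemma RR_Kn: "RR t n (Kn n f) = Kn n (RR t n f)"
  by (simp add: tens_tens Rv_Kv)

lemma RR_D: "D i (RR t n f) = RR t n (D i f)"
proof (cases "i \<in> {1..n}")
  case True
  then show ?thesis
    by (simp add: coord_tens tens_coord Dv_Rv Rv_Dv)
next
  case False
  then show ?thesis by (simp add: coord_tens_commute)
qed

end

section \<open>Noise and influences\<close>

lemma sum_mult_le_mult_sum: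
  fixes f g :: "'b \<Rightarrow> real"
  assumes "\<And>k. k \<in> A \<Longrightarrow> f k \<le> C * g k"
  shows "sum f A \<le> C * sum g A"
  using sum_mono[of A f "\<lambda>k. C * g k"] assms by (simp add: sum_distrib_left)

text \<open>Comparison of \<open>k\<close> equal powers with a geometric series. The bound is
  uniform in \<open>k\<close>, which is what removes \<open>n\<close> from the influence and
  smoothing bounds.\<close>

lemma mult_power_le_geometric:
  fixes t :: real
  assumes "0 \<le> t" "t < 1"
  shows "real k * t ^ k * (1 - t) \<le> 1"
proof -
  have "real k * t ^ k = (\<Sum>j<k. t ^ k)" by simp
  also have "\<dots> \<le> (\<Sum>j<k. t ^ j)"
    using assms by (intro sum_mono power_decreasing) auto
  finally have "real k * t ^ k * (1 - t) \<le> (\<Sum>j<k. t ^ j) * (1 - t)"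
    using assms by (intro mult_right_mono) auto
  also have "\<dots> = 1 - t ^ k" using one_diff_power_eq[of t k] by (simp add: mult.commute)
  also have "\<dots> \<le> 1" using assms by simp
  finally show ?thesis .
qed

context contractive_kernel
begin

lemma EE_mult_indep:
  assumes "i \<in> {1..n}" "\<And>y b. f (y(i := b)) = f y"
  shows "EE n (\<lambda>y. f y * g y) = EE n (\<lambda>y. f y * av (\<lambda>b. g (y(i := b))))"
  by (subst EE_absorb_av[OF assms(1), symmetric]) (simp add: assms(2) av_scale)

lemma EE_Suc_indep: "(\<And>y b. h (y(Suc n := b)) = h y) \<Longrightarrow> EE (Suc n) h x = EE n h x"
  by (simp add: coord_Av)

lemma coord_Rv: "coord i (Rv t) f = (\<lambda>x. coord i Av f x + t * D i f x)"
  by (auto simp: coord_def Rv_decompose Av_def)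

lemma RR_coord_Rv: "RR u n (coord i (Rv t) f) = (\<lambda>x. RR u n (coord i Av f) x + t * RR u n (D i f) x)"
  unfolding coord_Rv by (simp add: tens_add tens_scale)

lemma coord_Av_upd: "coord i Av f (x(i := b)) = coord i Av f x"
  by (simp add: coord_def Av_def)

lemma RR_coord_Av_upd: "RR t n (coord (Suc n) Av f) (x(Suc n := b)) = RR t n (coord (Suc n) Av f) x"
  by (subst tens_upd) (auto simp: coord_Av_upd)

lemma av_RR_D: "av (\<lambda>b. RR t n (D (Suc n) f) (x(Suc n := b))) = 0"
proof -
  have "av (\<lambda>b. RR t n (D (Suc n) f) (x(Suc n := b))) = coord (Suc n) Av (RR t n (D (Suc n) f)) x"
    by (simp add: coord_Av)
  also have "\<dots> = RR t n (coord (Suc n) Av (D (Suc n) f)) x"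
    by (subst coord_tens_commute) auto
  also have "coord (Suc n) Av (D (Suc n) f) = (\<lambda>_. 0 * 0)"
    by (auto simp: coord_def Av_def)
  also have "RR t n (\<lambda>_. 0 * 0) x = 0"
    using tens_scale[of "\<lambda>_. Rv t" n 0 "\<lambda>_. 0"] by simp
  finally show ?thesis .
qed

text \<open>A factor independent of the last coordinate is orthogonal to one with mean zero there,
  so both cross terms vanish; of the last noise only the factor \<open>t\<close> on the mean-zero
  part remains.\<close>

lemma EE_RR_split:
  assumes g: "\<And>y b. g1 (y(Suc n := b)) = g1 y" "\<And>y. av (\<lambda>b. g2 (y(Suc n := b))) = 0"
  shows "EE (Suc n) (\<lambda>y. (g1 y + g2 y) * RR t (Suc n) f y) x =
    EE n (\<lambda>y. g1 y * RR t n (coord (Suc n) Av f) y) x +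
    t * av (\<lambda>b. EE n (\<lambda>y. g2 y * RR t n (D (Suc n) f) y) (x(Suc n := b)))"
proof -
  let ?a = "RR t n (coord (Suc n) Av f)" and ?d = "RR t n (D (Suc n) f)"
  have pt: "(g1 y + g2 y) * RR t (Suc n) f y =
      (g1 y * ?a y + t * (g1 y * ?d y)) + (?a y * g2 y + t * (g2 y * ?d y))" for y
    unfolding tens.simps RR_coord_Rv by (simp only: ring_distribs ac_simps)
  have "EE (Suc n) (\<lambda>y. (g1 y + g2 y) * RR t (Suc n) f y) x =
      EE (Suc n) (\<lambda>y. (g1 y * ?a y + t * (g1 y * ?d y)) + (?a y * g2 y + t * (g2 y * ?d y))) x"
    by (simp only: pt)
  also have "\<dots> = EE (Suc n) (\<lambda>y. g1 y * ?a y) x + t * EE (Suc n) (\<lambda>y. g1 y * ?d y) x +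
      EE (Suc n) (\<lambda>y. ?a y * g2 y) x + t * EE (Suc n) (\<lambda>y. g2 y * ?d y) x"
    by (simp only: EE_add EE_scale)
  also have "EE (Suc n) (\<lambda>y. g1 y * ?d y) = EE (Suc n) (\<lambda>y. g1 y * 0)"
    by (subst EE_mult_indep[where i = "Suc n"]) (simp_all add: g av_RR_D)
  also have "EE (Suc n) (\<lambda>y. ?a y * g2 y) = EE (Suc n) (\<lambda>y. ?a y * 0)"
    by (subst EE_mult_indep[where i = "Suc n"]) (simp_all add: g RR_coord_Av_upd)
  also have "EE (Suc n) (\<lambda>y. g1 y * ?a y) x = EE n (\<lambda>y. g1 y * ?a y) x"
    by (rule EE_Suc_indep) (simp only: g RR_coord_Av_upd)
  finally show ?thesis by (simp add: EE_Suc_av del: tens.simps(2))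
qed

text \<open>\<open>c k\<close> stands for the square mean of the degree-\<open>k\<close> part of
  \<open>f\<close> in the orthogonal decomposition over sets of coordinates. The second series
  carries the factor \<open>k\<close> because such a part fluctuates in \<open>k\<close>
  coordinates. Both series must share one \<open>c\<close>, hence the joint induction.\<close>

lemma noise_expansion:
  "\<exists>c. (\<forall>k. c k \<ge> 0) \<and>
     (\<forall>t. EE n (\<lambda>y. f y * RR t n f y) x = (\<Sum>k\<le>n. c k * t ^ k)) \<and>
     (\<forall>t. (\<Sum>i\<in>{1..n}. EE n (\<lambda>y. D i f y * RR t n f y) x) = (\<Sum>k\<le>n. real k * c k * t ^ k))"
proof (induction n arbitrary: f x)
  case 0
  show ?case by (rule exI[where x = "\<lambda>k. (f x)\<^sup>2"]) (simp add: power2_eq_square)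
next
  case (Suc n)
  let ?a = "coord (Suc n) Av f" and ?d = "D (Suc n) f"
  let ?x = "\<lambda>b. x(Suc n := b)"
  obtain c where c: "\<And>k. c k \<ge> 0" "\<And>t. EE n (\<lambda>y. ?a y * RR t n ?a y) x = (\<Sum>k\<le>n. c k * t ^ k)"
    "\<And>t. (\<Sum>i\<in>{1..n}. EE n (\<lambda>y. D i ?a y * RR t n ?a y) x) = (\<Sum>k\<le>n. real k * c k * t ^ k)"
    using Suc.IH[of ?a x] by blast
  have "\<forall>b. \<exists>e. (\<forall>k. e k \<ge> 0) \<and>
     (\<forall>t. EE n (\<lambda>y. ?d y * RR t n ?d y) (?x b) = (\<Sum>k\<le>n. e k * t ^ k)) \<and>
     (\<forall>t. (\<Sum>i\<in>{1..n}. EE n (\<lambda>y. D i ?d y * RR t n ?d y) (?x b)) = (\<Sum>k\<le>n. real k * e k * t ^ k))"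
    using Suc.IH by blast
  then obtain e where e: "\<And>b k. e b k \<ge> 0"
    "\<And>b t. EE n (\<lambda>y. ?d y * RR t n ?d y) (?x b) = (\<Sum>k\<le>n. e b k * t ^ k)"
    "\<And>b t. (\<Sum>i\<in>{1..n}. EE n (\<lambda>y. D i ?d y * RR t n ?d y) (?x b)) = (\<Sum>k\<le>n. real k * e b k * t ^ k)"
    by metis
  define e' where "e' k = av (\<lambda>b. e b k)" for k
  \<comment> \<open>Averaging over the last coordinate keeps the degree and fluctuating in it raises
    the degree by one, so the weights \<open>e'\<close> enter shifted.\<close>
  define c' where "c' k = (if k \<le> n then c k else 0) + (if k = 0 then 0 else e' (k - 1))" for k
  have e': "e' k \<ge> 0" for k unfolding e'_def by (intro av_nonneg e)
  have avd: "av (\<lambda>b. EE n (\<lambda>y. ?d y * RR t n ?d y) (?x b)) = (\<Sum>k\<le>n. e' k * t ^ k)" for t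
    unfolding e e'_def by (subst av_sum) (simp_all add: av_scale mult.commute)
  have avd': "av (\<lambda>b. \<Sum>i\<in>{1..n}. EE n (\<lambda>y. D i ?d y * RR t n ?d y) (?x b)) = (\<Sum>k\<le>n. real k * e' k * t ^ k)" for t
  proof -
    have "av (\<lambda>b. \<Sum>k\<le>n. real k * e b k * t ^ k) = (\<Sum>k\<le>n. av (\<lambda>b. (real k * t ^ k) * e b k))"
      by (subst av_sum) (simp_all add: ac_simps)
    then show ?thesis unfolding e by (simp only: av_scale e'_def) (simp add: ac_simps)
  qed
  have split_f: "f y = ?a y + ?d y" for y by (simp add: coord_def Av_def Dv_def)
  have d0: "av (\<lambda>b. ?d (y(Suc n := b))) = 0" for y by (simp add: coord_def)
  have E1: "EE (Suc n) (\<lambda>y. f y * RR t (Suc n) f y) x = (\<Sum>k\<le>n. c k * t ^ k) + t * (\<Sum>k\<le>n. e' k * t ^ k)" for t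
  proof -
    have "EE (Suc n) (\<lambda>y. f y * RR t (Suc n) f y) x = EE (Suc n) (\<lambda>y. (?a y + ?d y) * RR t (Suc n) f y) x"
      by (simp only: split_f[symmetric])
    also have "\<dots> = EE n (\<lambda>y. ?a y * RR t n ?a y) x + t * av (\<lambda>b. EE n (\<lambda>y. ?d y * RR t n ?d y) (?x b))"
      by (rule EE_RR_split) (simp_all add: coord_Av_upd d0)
    finally show ?thesis unfolding c(2) avd .
  qed
  have E2: "EE (Suc n) (\<lambda>y. D (Suc n) f y * RR t (Suc n) f y) x = t * (\<Sum>k\<le>n. e' k * t ^ k)" for t
    using EE_RR_split[of "\<lambda>_. 0" n ?d t f x] by (simp add: d0 avd del: tens.simps(2))
  have E3: "(\<Sum>i\<in>{1..n}. EE (Suc n) (\<lambda>y. D i f y * RR t (Suc n) f y) x) =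
      (\<Sum>k\<le>n. real k * c k * t ^ k) + t * (\<Sum>k\<le>n. real k * e' k * t ^ k)" for t
  proof -
    have "EE (Suc n) (\<lambda>y. D i f y * RR t (Suc n) f y) x = EE n (\<lambda>y. D i ?a y * RR t n ?a y) x +
        t * av (\<lambda>b. EE n (\<lambda>y. D i ?d y * RR t n ?d y) (?x b))" if "i \<in> {1..n}" for i
    proof -
      have i: "i \<noteq> Suc n" using that by simp
      have "D i f = D i (\<lambda>y. ?a y + ?d y)" by (simp only: split_f[symmetric])
      then have Di: "D i f = (\<lambda>y. D i ?a y + D i ?d y)" by (simp add: coord_add)
      have "D i ?a (y(Suc n := b)) = D i ?a y" for y b
        using i by (subst (1 2) coord_commute) (auto simp: coord_Av_upd)
      moreover have "av (\<lambda>b. D i ?d (y(Suc n := b))) = 0" for y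
        using i by (subst coord_commute) (auto simp: coord_def)
      ultimately show ?thesis unfolding Di by (intro EE_RR_split) auto
    qed
    then have "(\<Sum>i\<in>{1..n}. EE (Suc n) (\<lambda>y. D i f y * RR t (Suc n) f y) x) =
        (\<Sum>i\<in>{1..n}. EE n (\<lambda>y. D i ?a y * RR t n ?a y) x) +
        t * (\<Sum>i\<in>{1..n}. av (\<lambda>b. EE n (\<lambda>y. D i ?d y * RR t n ?d y) (?x b)))"
      by (simp add: sum.distrib sum_distrib_left del: tens.simps(2))
    then show ?thesis
      unfolding c(3) avd'[symmetric] by (simp add: av_sum del: tens.simps(2))
  qed
  have shift: "(\<Sum>k\<le>Suc n. (if k = 0 then 0 else F (k - 1)) * t ^ k) = t * (\<Sum>k\<le>n. F k * t ^ k)"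
    for F :: "nat \<Rightarrow> real" and t
    by (subst sum.atMost_Suc_shift) (simp add: sum_distrib_left ac_simps)
  have shift': "(\<Sum>k\<le>Suc n. real k * (if k = 0 then 0 else F (k - 1)) * t ^ k) =
      t * (\<Sum>k\<le>n. F k * t ^ k) + t * (\<Sum>k\<le>n. real k * F k * t ^ k)" for F :: "nat \<Rightarrow> real" and t
    by (subst sum.atMost_Suc_shift) (simp add: sum_distrib_left algebra_simps sum.distrib)
  have cut: "(\<Sum>k\<le>Suc n. (if k \<le> n then F k else 0) * t ^ k) = (\<Sum>k\<le>n. F k * t ^ k)"
    for F :: "nat \<Rightarrow> real" and t by simp
  have cut': "(\<Sum>k\<le>Suc n. real k * (if k \<le> n then F k else 0) * t ^ k) = (\<Sum>k\<le>n. real k * F k * t ^ k)"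
    for F :: "nat \<Rightarrow> real" and t by simp
  show ?case
  proof (intro exI[where x = c'] conjI allI)
    show "c' k \<ge> 0" for k using c(1) e' by (simp add: c'_def)
    show "EE (Suc n) (\<lambda>y. f y * RR t (Suc n) f y) x = (\<Sum>k\<le>Suc n. c' k * t ^ k)" for t
      unfolding E1 c'_def ring_distribs sum.distrib cut shift by (rule refl)
    have "(\<Sum>i\<in>{1..Suc n}. EE (Suc n) (\<lambda>y. D i f y * RR t (Suc n) f y) x) =
      (\<Sum>i\<in>{1..n}. EE (Suc n) (\<lambda>y. D i f y * RR t (Suc n) f y) x) +
      EE (Suc n) (\<lambda>y. D (Suc n) f y * RR t (Suc n) f y) x" for t
      by (simp del: tens.simps(2))
    then show "(\<Sum>i\<in>{1..Suc n}. EE (Suc n) (\<lambda>y. D i f y * RR t (Suc n) f y) x) =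
        (\<Sum>k\<le>Suc n. real k * c' k * t ^ k)" for t
      unfolding E2 E3 c'_def ring_distribs sum.distrib cut' shift' by simp
  qed
qed

text \<open>\<open>D i\<close> is a self-adjoint projection commuting with the noise, so both noises
  and both projections can be collected; the result is a summand of the second series in
  \<open>noise_expansion\<close>.\<close>

lemma EE_D_power2: "i \<in> {1..n} \<Longrightarrow> EE n (\<lambda>y. (D i (RR s n f) y)\<^sup>2) x = EE n (\<lambda>y. D i f y * RR (s * s) n f y) x"
proof -
  assume i: "i \<in> {1..n}"
  have "EE n (\<lambda>y. (D i (RR s n f) y)\<^sup>2) = EE n (\<lambda>y. RR s n (D i f) y * RR s n (D i f) y)"
    by (simp add: RR_D power2_eq_square)
  also have "\<dots> = EE n (\<lambda>y. D i f y * D i (RR (s * s) n f) y)"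
    by (subst EE_RR_adjoint[symmetric]) (simp add: RR_RR RR_D)
  also have "\<dots> = EE n (\<lambda>y. D i (D i f) y * RR (s * s) n f y)"
    using i by (intro EE_coord_adjoint Dv_adjoint)
  finally show ?thesis by (simp add: coord_at)
qed

lemma EE_le_1: "(\<And>y. f y \<le> 1) \<Longrightarrow> EE n f x \<le> 1"
  using EE_mono[of f "\<lambda>_. 1" n x] by simp

lemma noise_expansion_bounded:
  assumes "\<And>y. \<bar>f y\<bar> \<le> 1"
  obtains c where "\<And>k. c k \<ge> 0" "(\<Sum>k\<le>n. c k) \<le> 1"
    "\<And>t. EE n (\<lambda>y. f y * RR t n f y) x = (\<Sum>k\<le>n. c k * t ^ k)"
    "\<And>t. (\<Sum>i\<in>{1..n}. EE n (\<lambda>y. D i f y * RR t n f y) x) = (\<Sum>k\<le>n. real k * c k * t ^ k)"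
proof -
  obtain c where c: "\<And>k. c k \<ge> 0" "\<And>t. EE n (\<lambda>y. f y * RR t n f y) x = (\<Sum>k\<le>n. c k * t ^ k)"
    "\<And>t. (\<Sum>i\<in>{1..n}. EE n (\<lambda>y. D i f y * RR t n f y) x) = (\<Sum>k\<le>n. real k * c k * t ^ k)"
    using noise_expansion[of n f x] by blast
  have "(\<Sum>k\<le>n. c k) = EE n (\<lambda>y. (f y)\<^sup>2) x"
    using c(2)[of 1] by (simp add: RR_1 power2_eq_square)
  also have "\<dots> \<le> 1"
    using assms by (intro EE_le_1) (simp add: abs_square_le_1)
  finally show thesis using c that by blast
qed

text \<open>The sum is that of \<open>c k * k * s^(2 k)\<close>, and \<open>k * s^(2 k)\<close> is
  at most \<open>1 / (1 - s^2)\<close> for every \<open>k\<close>.\<close>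

lemma sum_influence_le:
  assumes "\<And>y. \<bar>f y\<bar> \<le> 1" "0 \<le> s" "s < 1"
  shows "(\<Sum>i\<in>{1..n}. EE n (\<lambda>y. (D i (RR s n f) y)\<^sup>2) x) \<le> 1 / (1 - s\<^sup>2)"
proof -
  obtain c where c: "\<And>k. c k \<ge> 0" "(\<Sum>k\<le>n. c k) \<le> 1"
    "\<And>t. EE n (\<lambda>y. f y * RR t n f y) x = (\<Sum>k\<le>n. c k * t ^ k)"
    "\<And>t. (\<Sum>i\<in>{1..n}. EE n (\<lambda>y. D i f y * RR t n f y) x) = (\<Sum>k\<le>n. real k * c k * t ^ k)"
    by (rule noise_expansion_bounded[OF assms(1), where n = n and x = x]) (rule that)
  have s: "s\<^sup>2 < 1" using assms by (simp add: power_less_one_iff)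
  have "(\<Sum>i\<in>{1..n}. EE n (\<lambda>y. (D i (RR s n f) y)\<^sup>2) x) = (\<Sum>k\<le>n. real k * c k * (s * s) ^ k)"
    unfolding c(4)[of "s * s", symmetric] by (intro sum.cong refl EE_D_power2)
  also have "\<dots> \<le> 1 / (1 - s\<^sup>2) * (\<Sum>k\<le>n. c k)"
  proof (rule sum_mult_le_mult_sum)
    fix k
    have "real k * (s\<^sup>2) ^ k \<le> 1 / (1 - s\<^sup>2)"
      using mult_power_le_geometric[of "s\<^sup>2" k] s by (simp add: field_simps)
    then have "c k * (real k * (s\<^sup>2) ^ k) \<le> c k * (1 / (1 - s\<^sup>2))"
      by (intro mult_left_mono c)
    then show "real k * c k * (s * s) ^ k \<le> 1 / (1 - s\<^sup>2) * c k"
      by (simp add: ac_simps power2_eq_square)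
  qed
  also have "\<dots> \<le> 1 / (1 - s\<^sup>2) * 1" using s c by (intro mult_left_mono) auto
  finally show ?thesis by simp
qed

text \<open>The transition is traded for noise one coordinate at a time; operators already traded
  and those still pending act on different coordinates and commute.\<close>

lemma EE_Kn_power2_le: "EE n (\<lambda>y. (Kn n f y)\<^sup>2) x \<le> EE n (\<lambda>y. (RR \<rho> n f y)\<^sup>2) x"
proof (induction n arbitrary: f x)
  case (Suc n)
  let ?w = "Kn n f" and ?g = "coord (Suc n) (Rv \<rho>) f"
  have "EE (Suc n) (\<lambda>y. (Kn (Suc n) f y)\<^sup>2) x = EE n (\<lambda>y. av (\<lambda>b. (Kv (\<lambda>b. ?w (y(Suc n := b))) b)\<^sup>2)) x"
    by (subst tens_Suc'[of "\<lambda>_. Kv"]) (auto simp: coord_Av, auto simp: coord_def)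
  also have "\<dots> \<le> EE n (\<lambda>y. av (\<lambda>b. (Rv \<rho> (\<lambda>b. ?w (y(Suc n := b))) b)\<^sup>2)) x"
    by (intro EE_mono av_power2_Kv_le)
  also have "\<dots> = EE (Suc n) (\<lambda>y. (coord (Suc n) (Rv \<rho>) ?w y)\<^sup>2) x"
    by (auto simp: coord_Av, auto simp: coord_def)
  also have "\<dots> = EE (Suc n) (\<lambda>y. (Kn n ?g y)\<^sup>2) x"
    by (subst coord_tens_commute) auto
  also have "\<dots> = av (\<lambda>b. EE n (\<lambda>y. (Kn n ?g y)\<^sup>2) (x(Suc n := b)))"
    by (rule EE_Suc_av)
  also have "\<dots> \<le> av (\<lambda>b. EE n (\<lambda>y. (RR \<rho> n ?g y)\<^sup>2) (x(Suc n := b)))"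
    by (intro av_mono Suc.IH)
  also have "\<dots> = EE (Suc n) (\<lambda>y. (RR \<rho> (Suc n) f y)\<^sup>2) x"
    by (simp add: EE_Suc_av del: tens.simps(2)) simp
  finally show ?case .
qed simp

text \<open>In degree \<open>k\<close> the defect has weight
  \<open>\<rho>^(2 k) * (1 - m^k)^2\<close>. High degrees are damped by \<open>\<rho>\<close>, and
  low ones are hardly changed by \<open>m\<close>, since \<open>1 - m^k\<close> is at most
  \<open>(1 - m) * k\<close>.\<close>

lemma noise_stability_defect:
  assumes "\<And>y. \<bar>f y\<bar> \<le> 1" "0 \<le> m" "m \<le> 1"
  shows "EE n (\<lambda>y. (RR \<rho> n (\<lambda>y. f y - RR m n f y) y)\<^sup>2) x \<le> (1 - m) / (1 - \<rho>\<^sup>2)"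
proof -
  obtain c where c: "\<And>k. c k \<ge> 0" "(\<Sum>k\<le>n. c k) \<le> 1"
    "\<And>t. EE n (\<lambda>y. f y * RR t n f y) x = (\<Sum>k\<le>n. c k * t ^ k)"
    "\<And>t. (\<Sum>i\<in>{1..n}. EE n (\<lambda>y. D i f y * RR t n f y) x) = (\<Sum>k\<le>n. real k * c k * t ^ k)"
    by (rule noise_expansion_bounded[OF assms(1), where n = n and x = x]) (rule that)
  let ?q = "\<lambda>t. EE n (\<lambda>y. f y * RR t n f y) x"
  let ?g = "\<lambda>y. f y - RR m n f y"
  have r: "\<rho>\<^sup>2 < 1" using rho by (simp add: power_less_one_iff)
  have "EE n (\<lambda>y. (RR \<rho> n ?g y)\<^sup>2) x = EE n (\<lambda>y. ?g y * RR (\<rho>\<^sup>2) n ?g y) x"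
    by (subst power2_eq_square, subst EE_RR_adjoint[symmetric]) (simp add: RR_RR power2_eq_square)
  also have "RR (\<rho>\<^sup>2) n ?g = (\<lambda>y. RR (\<rho>\<^sup>2) n f y - RR (\<rho>\<^sup>2 * m) n f y)"
    by (simp add: tens_diff RR_RR)
  also have "EE n (\<lambda>y. ?g y * (RR (\<rho>\<^sup>2) n f y - RR (\<rho>\<^sup>2 * m) n f y)) x =
      EE n (\<lambda>y. (f y * RR (\<rho>\<^sup>2) n f y - f y * RR (\<rho>\<^sup>2 * m) n f y) -
        (RR m n f y * RR (\<rho>\<^sup>2) n f y - RR m n f y * RR (\<rho>\<^sup>2 * m) n f y)) x"
    by (simp add: algebra_simps)
  also have "\<dots> = ?q (\<rho>\<^sup>2) - ?q (\<rho>\<^sup>2 * m) - (?q (m * \<rho>\<^sup>2) - ?q (m * (\<rho>\<^sup>2 * m)))"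
    by (simp only: EE_diff EE_RR_adjoint[symmetric] RR_RR)
  also have "\<dots> = (\<Sum>k\<le>n. c k * ((\<rho>\<^sup>2) ^ k * (1 - m ^ k)\<^sup>2))"
    unfolding c(3) by (simp flip: sum_subtractf add: power_mult_distrib power2_eq_square algebra_simps)
  also have "\<dots> \<le> (1 - m) / (1 - \<rho>\<^sup>2) * (\<Sum>k\<le>n. c k)"
  proof (rule sum_mult_le_mult_sum)
    fix k
    have "1 - m ^ k = (1 - m) * (\<Sum>j<k. m ^ j)" by (rule one_diff_power_eq)
    also have "\<dots> \<le> (1 - m) * (\<Sum>j<k. 1)"
      using assms by (intro mult_left_mono sum_mono) (auto simp: power_le_one)
    finally have 1: "1 - m ^ k \<le> (1 - m) * real k" by simp
    have mk: "0 \<le> 1 - m ^ k" "1 - m ^ k \<le> 1" using assms by (auto simp: power_le_one)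
    have "(1 - m ^ k)\<^sup>2 \<le> (1 - m ^ k) * 1"
      unfolding power2_eq_square using mk by (intro mult_left_mono) auto
    also have "\<dots> \<le> (1 - m) * real k" using 1 by simp
    finally have "(1 - m ^ k)\<^sup>2 \<le> (1 - m) * real k" .
    then have "(\<rho>\<^sup>2) ^ k * (1 - m ^ k)\<^sup>2 \<le> (\<rho>\<^sup>2) ^ k * ((1 - m) * real k)"
      by (intro mult_left_mono) auto
    also have "\<dots> = (1 - m) * (real k * (\<rho>\<^sup>2) ^ k)" by simp
    also have "\<dots> \<le> (1 - m) * (1 / (1 - \<rho>\<^sup>2))"
      using mult_power_le_geometric[of "\<rho>\<^sup>2" k] r assms by (intro mult_left_mono) (auto simp: field_simps)
    finally have "c k * ((\<rho>\<^sup>2) ^ k * (1 - m ^ k)\<^sup>2) \<le> c k * ((1 - m) * (1 / (1 - \<rho>\<^sup>2)))"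
      by (intro mult_left_mono c)
    then show "c k * ((\<rho>\<^sup>2) ^ k * (1 - m ^ k)\<^sup>2) \<le> (1 - m) / (1 - \<rho>\<^sup>2) * c k"
      by (simp add: ac_simps)
  qed
  also have "\<dots> \<le> (1 - m) / (1 - \<rho>\<^sup>2) * 1" using r c assms by (intro mult_left_mono) auto
  finally show ?thesis by simp
qed

text \<open>Noise is self-adjoint and commutes with the chain, so both copies act as noise
  \<open>s^2\<close> on one argument. The difference is a correlation of \<open>f\<close> with the
  chain applied to \<open>f - RR (s\<^sup>2) n f\<close>, which Cauchy-Schwarz and the noise defect
  control.\<close>

lemma smoothing_error:
  assumes "\<And>y. 0 \<le> f y" "\<And>y. f y \<le> 1" "0 \<le> s" "s \<le> 1"
  shows "EE n (\<lambda>y. RR s n f y * Kn n (RR s n f) y) x - sqrt ((1 - s\<^sup>2) / (1 - \<rho>\<^sup>2)) \<le>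
    EE n (\<lambda>y. f y * Kn n f y) x"
proof -
  let ?g = "\<lambda>y. f y - RR (s\<^sup>2) n f y"
  have f: "\<bar>f y\<bar> \<le> 1" for y using assms by (simp add: abs_le_iff order_trans[of _ 0])
  have "EE n (\<lambda>y. RR s n f y * Kn n (RR s n f) y) x = EE n (\<lambda>y. f y * Kn n (RR (s\<^sup>2) n f) y) x"
    by (subst EE_RR_adjoint[symmetric]) (simp add: RR_Kn RR_RR power2_eq_square)
  then have eq: "EE n (\<lambda>y. f y * Kn n f y) x - EE n (\<lambda>y. RR s n f y * Kn n (RR s n f) y) x =
      EE n (\<lambda>y. f y * Kn n ?g y) x"
    by (simp add: tens_diff right_diff_distrib EE_diff)
  have "(EE n (\<lambda>y. f y * Kn n ?g y) x)\<^sup>2 \<le> EE n (\<lambda>y. (f y)\<^sup>2) x * EE n (\<lambda>y. (Kn n ?g y)\<^sup>2) x"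
    by (rule EE_Cauchy_Schwarz)
  also have "\<dots> \<le> 1 * EE n (\<lambda>y. (RR \<rho> n ?g y)\<^sup>2) x"
    using f by (intro mult_mono EE_Kn_power2_le EE_le_1 EE_nonneg) (auto simp: abs_square_le_1)
  also have "\<dots> \<le> 1 * ((1 - s\<^sup>2) / (1 - \<rho>\<^sup>2))"
    using assms f by (intro mult_left_mono noise_stability_defect) (auto simp: power_le_one)
  finally have "\<bar>EE n (\<lambda>y. f y * Kn n ?g y) x\<bar> \<le> sqrt ((1 - s\<^sup>2) / (1 - \<rho>\<^sup>2))"
    using real_le_rsqrt[of "\<bar>EE n (\<lambda>y. f y * Kn n ?g y) x\<bar>"] by simp
  then show ?thesis using eq by linarith
qed

end

section \<open>Hypercontractivity\<close>

context contractive_kernel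
begin

lemma EE_power2_Suc:
  "EE (Suc n) (\<lambda>y. (f y)\<^sup>2) x =
    EE n (\<lambda>y. (coord (Suc n) Av f y)\<^sup>2) x + av (\<lambda>b. EE n (\<lambda>y. (D (Suc n) f y)\<^sup>2) (x(Suc n := b)))"
proof -
  have "EE (Suc n) (\<lambda>y. (f y)\<^sup>2) x = EE n (\<lambda>y. av (\<lambda>b. (f (y(Suc n := b)))\<^sup>2)) x"
    by (simp add: coord_Av)
  also have "\<dots> = EE n (\<lambda>y. (coord (Suc n) Av f y)\<^sup>2 + coord (Suc n) Av (\<lambda>y. (D (Suc n) f y)\<^sup>2) y) x"
    by (subst av_power2) (simp add: coord_Av, simp add: coord_def)
  also have "\<dots> = EE n (\<lambda>y. (coord (Suc n) Av f y)\<^sup>2) x + EE (Suc n) (\<lambda>y. (D (Suc n) f y)\<^sup>2) x"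
    by (simp add: EE_add)
  finally show ?thesis by (simp only: EE_Suc_av)
qed

text \<open>Each value is at most the mean divided by \<open>p\<close>. This is where the least atom
  enters hypercontractivity.\<close>

lemma av_power2_le:
  assumes "\<And>b. b \<in> V \<Longrightarrow> 0 \<le> Y b"
  shows "p * av (\<lambda>b. (Y b)\<^sup>2) \<le> (av Y)\<^sup>2"
proof -
  have "p * av (\<lambda>b. (Y b)\<^sup>2) = av (\<lambda>b. Y b * (p * Y b))"
    by (simp add: av_scale[symmetric] power2_eq_square ac_simps)
  also have "\<dots> \<le> av (\<lambda>b. Y b * av Y)"
    using assms by (intro av_mono mult_left_mono av_ge_single) auto
  also have "\<dots> = (av Y)\<^sup>2"
    using av_scale[of "av Y" Y] by (simp add: power2_eq_square mult.commute)
  finally show ?thesis .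
qed

text \<open>In the split at the last coordinate the term \<open>w^3 v\<close> has mean zero and
  \<open>w v^3\<close> is absorbed into even terms. The two upper bounds on \<open>s\<close> match
  the cross term and the last term of \<open>(X + av Y)\<^sup>2\<close>.\<close>

lemma hypercontractivity:
  assumes s: "0 \<le> s" "8 * s\<^sup>2 \<le> 2" "3 * s ^ 4 \<le> p"
  shows "EE n (\<lambda>y. (RR s n f y) ^ 4) x \<le> (EE n (\<lambda>y. (f y)\<^sup>2) x)\<^sup>2"
proof (induction n arbitrary: f x)
  case (Suc n)
  let ?w = "RR s n (coord (Suc n) Av f)" and ?v = "RR s n (D (Suc n) f)"
  let ?x = "\<lambda>b. x(Suc n := b)"
  define X where "X = EE n (\<lambda>y. (coord (Suc n) Av f y)\<^sup>2) x"
  define Y where "Y b = EE n (\<lambda>y. (D (Suc n) f y)\<^sup>2) (?x b)" for b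
  have X0: "X \<ge> 0" and Y0: "Y b \<ge> 0" for b by (auto simp: X_def Y_def intro!: EE_nonneg)
  have w_upd: "?w (y(Suc n := b)) = ?w y" for y b by (rule RR_coord_Av_upd)
  have X': "EE n (\<lambda>y. (coord (Suc n) Av f y)\<^sup>2) (?x b) = X" for b
    unfolding X_def by (subst tens_upd) (auto simp: coord_Av_upd)
  have expand: "(RR s (Suc n) f y) ^ 4 \<le>
      (?w y ^ 4 + 4 * s * (?w y ^ 3 * ?v y)) + (8 * s\<^sup>2 * ((?w y)\<^sup>2 * (?v y)\<^sup>2) + 3 * s ^ 4 * ?v y ^ 4)" for y
  proof -
    \<comment> \<open>Adding a nonnegative term trades the odd term \<open>4 c (s d)^3\<close> for
      even ones, raising their coefficients from 6 and 1 to 8 and 3.\<close>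
    have eq: "(c + s * d) ^ 4 + 2 * (s * d)\<^sup>2 * (c - s * d)\<^sup>2 =
      (c ^ 4 + 4 * s * (c ^ 3 * d)) + (8 * s\<^sup>2 * (c\<^sup>2 * d\<^sup>2) + 3 * s ^ 4 * d ^ 4)" for c d :: real
      by algebra
    have "0 \<le> 2 * (s * ?v y)\<^sup>2 * (?w y - s * ?v y)\<^sup>2" by simp
    then show ?thesis using eq[of "?w y" "?v y"] unfolding tens.simps RR_coord_Rv by linarith
  qed
  have 0: "EE (Suc n) (\<lambda>y. ?w y ^ 3 * ?v y) x = 0"
    by (subst EE_mult_indep[where i = "Suc n"]) (simp_all add: w_upd av_RR_D del: tens.simps(2))
  have 1: "EE (Suc n) (\<lambda>y. ?w y ^ 4) x \<le> X\<^sup>2"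
    using Suc.IH[of "coord (Suc n) Av f" x] by (subst EE_Suc_indep) (auto simp only: w_upd X_def)
  have "EE n (\<lambda>y. (?w y)\<^sup>2 * (?v y)\<^sup>2) (?x b) \<le> X * Y b" for b
  proof (rule power2_le_imp_le)
    have "(EE n (\<lambda>y. (?w y)\<^sup>2 * (?v y)\<^sup>2) (?x b))\<^sup>2 \<le>
        EE n (\<lambda>y. ((?w y)\<^sup>2)\<^sup>2) (?x b) * EE n (\<lambda>y. ((?v y)\<^sup>2)\<^sup>2) (?x b)"
      by (rule EE_Cauchy_Schwarz)
    also have "\<dots> = EE n (\<lambda>y. ?w y ^ 4) (?x b) * EE n (\<lambda>y. ?v y ^ 4) (?x b)"
      by simp
    also have "\<dots> \<le> X\<^sup>2 * (Y b)\<^sup>2"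
    proof (intro mult_mono)
      show "EE n (\<lambda>y. ?w y ^ 4) (?x b) \<le> X\<^sup>2"
        using Suc.IH[of "coord (Suc n) Av f" "?x b"] unfolding X' .
      show "EE n (\<lambda>y. ?v y ^ 4) (?x b) \<le> (Y b)\<^sup>2"
        unfolding Y_def by (rule Suc.IH)
    qed (auto intro!: EE_nonneg)
    finally show "(EE n (\<lambda>y. (?w y)\<^sup>2 * (?v y)\<^sup>2) (?x b))\<^sup>2 \<le> (X * Y b)\<^sup>2"
      by (simp add: power_mult_distrib)
  qed (use X0 Y0 in simp)
  then have 2: "EE (Suc n) (\<lambda>y. (?w y)\<^sup>2 * (?v y)\<^sup>2) x \<le> X * av Y"
    unfolding EE_Suc_av av_scale[symmetric] by (intro av_mono)
  have 3: "p * EE (Suc n) (\<lambda>y. ?v y ^ 4) x \<le> (av Y)\<^sup>2"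
  proof -
    have "EE (Suc n) (\<lambda>y. ?v y ^ 4) x \<le> av (\<lambda>b. (Y b)\<^sup>2)"
      unfolding EE_Suc_av Y_def by (intro av_mono Suc.IH)
    then have "p * EE (Suc n) (\<lambda>y. ?v y ^ 4) x \<le> p * av (\<lambda>b. (Y b)\<^sup>2)"
      using p_pos by (intro mult_left_mono) auto
    also have "\<dots> \<le> (av Y)\<^sup>2" using Y0 by (intro av_power2_le)
    finally show ?thesis .
  qed
  have v0: "0 \<le> EE (Suc n) (\<lambda>y. ?v y ^ 4) x" by (intro EE_nonneg) auto
  have avY: "0 \<le> av Y" using Y0 by (intro av_nonneg)
  have "EE (Suc n) (\<lambda>y. (RR s (Suc n) f y) ^ 4) x \<le> EE (Suc n) (\<lambda>y.
      (?w y ^ 4 + 4 * s * (?w y ^ 3 * ?v y)) + (8 * s\<^sup>2 * ((?w y)\<^sup>2 * (?v y)\<^sup>2) + 3 * s ^ 4 * ?v y ^ 4)) x"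
    by (intro EE_mono expand)
  also have "\<dots> = EE (Suc n) (\<lambda>y. ?w y ^ 4) x + 4 * s * EE (Suc n) (\<lambda>y. ?w y ^ 3 * ?v y) x +
      (8 * s\<^sup>2 * EE (Suc n) (\<lambda>y. (?w y)\<^sup>2 * (?v y)\<^sup>2) x + 3 * s ^ 4 * EE (Suc n) (\<lambda>y. ?v y ^ 4) x)"
    by (simp only: EE_add EE_scale)
  also have "\<dots> \<le> X\<^sup>2 + 4 * s * 0 + (2 * (X * av Y) + (av Y)\<^sup>2)"
  proof (intro add_mono)
    have "8 * s\<^sup>2 * EE (Suc n) (\<lambda>y. (?w y)\<^sup>2 * (?v y)\<^sup>2) x \<le> 8 * s\<^sup>2 * (X * av Y)"
      using 2 by (intro mult_left_mono) auto
    also have "\<dots> \<le> 2 * (X * av Y)"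
      using s X0 avY by (intro mult_right_mono) auto
    finally show "8 * s\<^sup>2 * EE (Suc n) (\<lambda>y. (?w y)\<^sup>2 * (?v y)\<^sup>2) x \<le> 2 * (X * av Y)" .
    have "3 * s ^ 4 * EE (Suc n) (\<lambda>y. ?v y ^ 4) x \<le> p * EE (Suc n) (\<lambda>y. ?v y ^ 4) x"
      using s v0 by (intro mult_right_mono) auto
    then show "3 * s ^ 4 * EE (Suc n) (\<lambda>y. ?v y ^ 4) x \<le> (av Y)\<^sup>2" using 3 by linarith
  qed (use 0 1 in simp_all)
  also have "\<dots> = (X + av Y)\<^sup>2" by (simp add: power2_eq_square algebra_simps)
  also have "X + av Y = EE (Suc n) (\<lambda>y. (f y)\<^sup>2) x"
    unfolding EE_power2_Suc X_def Y_def[abs_def] by simp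
  finally show ?case .
qed simp

lemma RR_power2: "EE n (\<lambda>y. (RR s n f y)\<^sup>2) x = EE n (\<lambda>y. f y * RR (s\<^sup>2) n f y) x"
  unfolding power2_eq_square by (subst EE_RR_adjoint[symmetric]) (simp add: RR_RR)

lemma RR_contraction:
  assumes "0 \<le> s" "s \<le> 1"
  shows "EE n (\<lambda>y. (RR s n f y)\<^sup>2) x \<le> EE n (\<lambda>y. (f y)\<^sup>2) x"
proof -
  obtain c where c: "\<And>k. c k \<ge> 0" "\<And>t. EE n (\<lambda>y. f y * RR t n f y) x = (\<Sum>k\<le>n. c k * t ^ k)"
    using noise_expansion[of n f x] by blast
  have "(\<Sum>k\<le>n. c k * (s\<^sup>2) ^ k) \<le> (\<Sum>k\<le>n. c k * 1 ^ k)"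
    using assms by (intro sum_mono mult_left_mono power_mono c) (auto simp: power_le_one)
  then show ?thesis
    unfolding c(2)[symmetric] RR_power2 by (simp add: RR_1 power2_eq_square)
qed

text \<open>
  A weak noise is a root of a strong one: by Cauchy-Schwarz the correlation \<open>\<langle>u, R\<^sub>t u\<rangle>\<close> is
  log-convex along \<open>t, t\<^sup>2, t\<^sup>4, \<dots>\<close>, so that the hypercontractive gain at the strong noise \<open>s0\<close>
  survives, with a smaller exponent, at \<open>s\<close>.
\<close>

lemma fourth_moment_small:
  assumes s0: "0 \<le> s0" "8 * s0\<^sup>2 \<le> 2" "3 * s0 ^ 4 \<le> p"
    and s: "0 \<le> s" "s \<le> 1" "s ^ (2 ^ j) = s0" and e: "0 \<le> e"
    and bounded: "\<And>y. \<bar>RR s n h y\<bar> \<le> 1"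
    and small: "EE n (\<lambda>y. (h y)\<^sup>2) x \<le> (e ^ (2 ^ j))\<^sup>2"
  shows "EE n (\<lambda>y. (RR s n h y) ^ 4) x \<le> e * EE n (\<lambda>y. (h y)\<^sup>2) x"
proof -
  let ?g = "RR s n h"
  \<comment> \<open>The cube is dual to \<open>?g\<close> in fourth mean: their pairing is
    \<open>G\<close>.\<close>
  let ?u = "\<lambda>y. ?g y ^ 3"
  define G where "G = EE n (\<lambda>y. ?g y ^ 4) x"
  define A where "A t = EE n (\<lambda>y. ?u y * RR t n ?u y) x" for t
  have cancel: "a \<le> b" if "a * a \<le> b * a" "0 \<le> a" "0 \<le> b" for a b :: real
    using that by (cases "a = 0") (auto simp: mult_le_cancel_right)
  have G0: "G \<ge> 0" unfolding G_def by (intro EE_nonneg) auto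
  have pow_le: "?g y ^ (2 * (m + k)) \<le> ?g y ^ (2 * m)" for y m k
  proof -
    have "\<bar>?g y\<bar> ^ (2 * (m + k)) \<le> \<bar>?g y\<bar> ^ (2 * m)"
      by (intro power_decreasing bounded) auto
    then show ?thesis by (simp only: power_even_abs dvd_triv_left)
  qed
  have A1: "A 1 \<le> G"
    using pow_le[of _ 2 1] unfolding A_def G_def RR_1
    by (intro EE_mono) (simp add: eval_nat_numeral mult.assoc)
  have "G \<le> EE n (\<lambda>y. (?g y)\<^sup>2) x"
    using pow_le[of _ 1 1] unfolding G_def by (intro EE_mono) simp
  also have "\<dots> \<le> EE n (\<lambda>y. (h y)\<^sup>2) x" using s by (intro RR_contraction) auto
  finally have G1: "G \<le> (e ^ (2 ^ j))\<^sup>2" using small by linarith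
  have A_ge0: "A (t\<^sup>2) \<ge> 0" for t
    unfolding A_def RR_power2[symmetric] by (intro EE_nonneg) auto
  have A_sqrt: "(A t)\<^sup>2 \<le> A 1 * A (t\<^sup>2)" for t
    using EE_Cauchy_Schwarz[of n ?u "RR t n ?u" x]
    unfolding A_def RR_1 RR_power2 by (simp only: power2_eq_square)
  \<comment> \<open>Two Cauchy-Schwarz steps and hypercontractivity for \<open>?w\<close> bring
    \<open>A (s0\<^sup>2)\<close> back on the right. Cancelling it bounds its square by
    \<open>G^3\<close>, and one factor \<open>G\<close> is spent on the smallness
    assumption.\<close>
  have top: "A (s0\<^sup>2) \<le> e ^ (2 ^ j) * G"
  proof -
    let ?w = "RR s0 n (RR s0 n ?u)"
    let ?B = "EE n (\<lambda>y. (?g y * ?w y)\<^sup>2) x"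
    have "A (s0\<^sup>2) = EE n (\<lambda>y. (?g y)\<^sup>2 * (?g y * ?w y)) x"
      unfolding A_def by (simp add: RR_RR power2_eq_square power3_eq_cube mult.assoc)
    then have 1: "(A (s0\<^sup>2))\<^sup>2 \<le> G * ?B"
      using EE_Cauchy_Schwarz[of n "\<lambda>y. (?g y)\<^sup>2" "\<lambda>y. ?g y * ?w y" x] by (simp add: G_def)
    have "?B\<^sup>2 \<le> G * EE n (\<lambda>y. ?w y ^ 4) x"
      using EE_Cauchy_Schwarz[of n "\<lambda>y. (?g y)\<^sup>2" "\<lambda>y. (?w y)\<^sup>2" x]
      by (simp add: G_def power_mult_distrib)
    also have "\<dots> \<le> G * (EE n (\<lambda>y. (RR s0 n ?u y)\<^sup>2) x)\<^sup>2"
      by (intro mult_left_mono hypercontractivity s0 G0)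
    also have "EE n (\<lambda>y. (RR s0 n ?u y)\<^sup>2) x = A (s0\<^sup>2)"
      unfolding A_def by (rule RR_power2)
    finally have 2: "?B\<^sup>2 \<le> G * (A (s0\<^sup>2))\<^sup>2" .
    have "((A (s0\<^sup>2))\<^sup>2)\<^sup>2 \<le> (G * ?B)\<^sup>2" using 1 by (intro power_mono) auto
    also have "\<dots> \<le> G\<^sup>2 * (G * (A (s0\<^sup>2))\<^sup>2)"
      unfolding power_mult_distrib[of G] using 2 by (intro mult_left_mono) auto
    finally have "(A (s0\<^sup>2))\<^sup>2 * (A (s0\<^sup>2))\<^sup>2 \<le> (G\<^sup>2 * G) * (A (s0\<^sup>2))\<^sup>2"
      by (simp add: power2_eq_square ac_simps)
    then have "(A (s0\<^sup>2))\<^sup>2 \<le> G\<^sup>2 * G"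
      by (rule cancel) (use G0 in auto)
    also have "\<dots> \<le> G\<^sup>2 * (e ^ (2 ^ j))\<^sup>2" using G1 by (intro mult_left_mono) auto
    finally show ?thesis
      by (rule power2_le_imp_le[OF ord_le_eq_trans]) (use G0 e in \<open>simp_all add: power_mult_distrib mult.commute\<close>)
  qed
  \<comment> \<open>Each step of the descent halves the exponent of \<open>s\<close> and, by
    comparison with \<open>A 1\<close>, takes the square root of the gain.\<close>
  have "k \<le> j \<Longrightarrow> A (s ^ (2 * 2 ^ (j - k))) \<le> e ^ (2 ^ (j - k)) * G" for k
  proof (induction k)
    case 0
    then show ?case using top s(3) by (simp add: power_mult mult.commute[of 2])
  next
    case (Suc k)
    define i where "i = j - Suc k"
    have i: "j - k = Suc i" using Suc.prems by (simp add: i_def)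
    let ?t = "s ^ (2 * 2 ^ i)"
    have "(A ?t)\<^sup>2 \<le> A 1 * A (?t\<^sup>2)" by (rule A_sqrt)
    also have "\<dots> \<le> G * A (?t\<^sup>2)" by (intro mult_right_mono A1 A_ge0)
    also have "?t\<^sup>2 = s ^ (2 * 2 ^ (j - k))" unfolding i by (simp flip: power_mult add: ac_simps)
    also have "G * A (s ^ (2 * 2 ^ (j - k))) \<le> G * (e ^ (2 ^ (j - k)) * G)"
      using Suc by (intro mult_left_mono G0) auto
    also have "\<dots> = (e ^ (2 ^ i) * G)\<^sup>2"
      unfolding i by (simp add: power_mult_distrib power2_eq_square flip: power_add mult_2)
    finally show ?case unfolding i_def[symmetric] by (rule power2_le_imp_le) (use G0 e in simp)
  qed
  from this[of j] have bottom: "A (s\<^sup>2) \<le> e * G" by simp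
  \<comment> \<open>One factor \<open>?g\<close> is written as noise on \<open>h\<close>, and the
    noise is moved to the cube, so that \<open>A (s\<^sup>2)\<close> appears.\<close>
  have "G = EE n (\<lambda>y. ?u y * RR s n h y) x"
    by (simp add: G_def eval_nat_numeral ac_simps)
  also have "\<dots> = EE n (\<lambda>y. RR s n ?u y * h y) x" by (rule fun_cong[OF EE_RR_adjoint])
  finally have "G\<^sup>2 \<le> EE n (\<lambda>y. (RR s n ?u y)\<^sup>2) x * EE n (\<lambda>y. (h y)\<^sup>2) x"
    using EE_Cauchy_Schwarz[of n "RR s n ?u" h x] by simp
  also have "EE n (\<lambda>y. (RR s n ?u y)\<^sup>2) x = A (s\<^sup>2)"
    unfolding A_def by (rule RR_power2)
  also have "A (s\<^sup>2) * EE n (\<lambda>y. (h y)\<^sup>2) x \<le> (e * G) * EE n (\<lambda>y. (h y)\<^sup>2) x"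
    by (intro mult_right_mono bottom EE_nonneg) auto
  finally have "G * G \<le> (e * EE n (\<lambda>y. (h y)\<^sup>2) x) * G"
    by (simp add: power2_eq_square ac_simps)
  moreover have "0 \<le> e * EE n (\<lambda>y. (h y)\<^sup>2) x" using e by (intro mult_nonneg_nonneg EE_nonneg) auto
  ultimately have "G \<le> e * EE n (\<lambda>y. (h y)\<^sup>2) x"
    by (rule cancel[OF _ G0])
  then show ?thesis by (simp add: G_def)
qed

end

section \<open>The correlation inequality up to local fluctuations\<close>

text \<open>The induction multiplies by \<open>1 + s\<close>; shrinking the quadratic coefficient by
  a further factor \<open>1 - \<delta>\<close> pays for the cubic term when \<open>s\<close> is
  negative.\<close>

lemma power_one_plus_ge:
  fixes s \<delta> :: real
  assumes "\<bar>s\<bar> \<le> \<delta>" "\<delta> \<le> 1"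
  shows "(1 + s) ^ k \<ge> 1 + real k * s + real k * (real k - 1) / 2 * (1 - \<delta>) ^ k * s\<^sup>2"
proof (induction k)
  case (Suc k)
  define a where "a = real k * (real k - 1) / 2 * (1 - \<delta>) ^ k"
  have "real k * (real k - 1) \<ge> 0" by (cases k) auto
  then have a: "a \<ge> 0" using assms by (simp add: a_def)
  have "(1 + s) ^ Suc k \<ge> (1 + s) * (1 + real k * s + a * s\<^sup>2)"
    using Suc assms unfolding a_def power_Suc by (intro mult_left_mono) auto
  also have "(1 + s) * (1 + real k * s + a * s\<^sup>2) = 1 + real (Suc k) * s + real k * s\<^sup>2 + a * s\<^sup>2 + a * s\<^sup>2 * s"
    by (simp add: algebra_simps power2_eq_square)
  finally have 1: "1 + real (Suc k) * s + real k * s\<^sup>2 + a * s\<^sup>2 + a * s\<^sup>2 * s \<le> (1 + s) ^ Suc k" .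
  have 2: "a * s\<^sup>2 * s \<ge> a * s\<^sup>2 * (- \<delta>)"
    using a assms by (intro mult_left_mono) auto
  have "real k * s\<^sup>2 * (1 - \<delta>) ^ Suc k \<le> real k * s\<^sup>2 * 1"
    using assms by (intro mult_left_mono power_le_one) auto
  moreover have "real (Suc k) * (real (Suc k) - 1) / 2 * (1 - \<delta>) ^ Suc k * s\<^sup>2 =
      real k * s\<^sup>2 * (1 - \<delta>) ^ Suc k + a * s\<^sup>2 * (1 - \<delta>)"
    unfolding a_def by (simp add: field_simps)
  ultimately show ?case using 1 2 by (simp add: algebra_simps)
qed simp

text \<open>The product of the two quadratic lower bounds has the wanted linear and mixed terms. Its
  pure squares lose a factor \<open>1 - k \<delta>\<close> to Bernoulli and another to the linear
  part of the other argument; together these are at least \<open>1 - 2 k \<delta>\<close>.\<close>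

lemma product_power_ge:
  fixes s t \<delta> \<kappa> :: real
  assumes st: "\<bar>s\<bar> \<le> \<delta>" "\<bar>t\<bar> \<le> \<delta>" and k: "real k * \<delta> \<le> 1" "k \<ge> 1"
    and lam: "real k * (real k - 1) / 2 * (1 - 2 * (real k * \<delta>)) \<ge> \<kappa>"
  shows "(1 + s) ^ k * (1 + t) ^ k \<ge> 1 + real k * s + real k * t + (real k)\<^sup>2 * (s * t) + \<kappa> * (s\<^sup>2 + t\<^sup>2)"
proof -
  define a where "a = real k * (real k - 1) / 2 * (1 - \<delta>) ^ k"
  have \<delta>0: "0 \<le> \<delta>" using st by linarith
  have \<delta>1: "\<delta> \<le> 1" using k \<delta>0 mult_right_mono[of 1 "real k" \<delta>] by simp
  have kk: "real k * (real k - 1) \<ge> 0" using k by simp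
  then have a: "a \<ge> 0" using \<delta>1 by (simp add: a_def)
  have ks: "\<bar>real k * r\<bar> \<le> real k * \<delta>" if "\<bar>r\<bar> \<le> \<delta>" for r
    using that by (simp add: abs_mult mult_left_mono)
  have pos: "0 \<le> 1 + real k * r" if "\<bar>r\<bar> \<le> \<delta>" for r
    using ks[OF that] k by linarith
  have aa: "a * (1 - real k * \<delta>) \<ge> \<kappa>"
  proof -
    have "1 - real k * \<delta> \<le> (1 - \<delta>) ^ k"
      using Bernoulli_inequality[of "- \<delta>" k] \<delta>1 by simp
    then have "real k * (real k - 1) / 2 * (1 - real k * \<delta>) \<le> a"
      unfolding a_def using kk by (intro mult_left_mono) auto
    note B = this
    note lam
    also have "real k * (real k - 1) / 2 * (1 - 2 * (real k * \<delta>)) \<le>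
        real k * (real k - 1) / 2 * ((1 - real k * \<delta>) * (1 - real k * \<delta>))"
      using kk zero_le_square[of "real k * \<delta>"] by (intro mult_left_mono) (simp_all add: algebra_simps)
    also have "\<dots> = real k * (real k - 1) / 2 * (1 - real k * \<delta>) * (1 - real k * \<delta>)"
      by (simp only: mult.assoc)
    also have "\<dots> \<le> a * (1 - real k * \<delta>)"
      using B k by (intro mult_right_mono) auto
    finally show ?thesis .
  qed
  have "(1 + real k * s + a * s\<^sup>2) * (1 + real k * t + a * t\<^sup>2) \<le> (1 + s) ^ k * (1 + t) ^ k"
    using power_one_plus_ge[of s \<delta> k] power_one_plus_ge[of t \<delta> k] st \<delta>1 a pos[of s] pos[of t]
    by (intro mult_mono) (auto simp: a_def intro!: zero_le_power add_nonneg_nonneg mult_nonneg_nonneg)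
  moreover have "(1 + real k * s + a * s\<^sup>2) * (1 + real k * t + a * t\<^sup>2) =
     1 + real k * s + real k * t + (real k)\<^sup>2 * (s * t) +
     (a * s\<^sup>2) * (1 + real k * t) + (a * t\<^sup>2) * (1 + real k * s) + (a * s\<^sup>2) * (a * t\<^sup>2)"
    by (simp add: power2_eq_square algebra_simps)
  moreover have "(a * s\<^sup>2) * (1 + real k * t) \<ge> \<kappa> * s\<^sup>2"
  proof -
    have "(a * s\<^sup>2) * (1 - real k * \<delta>) \<le> (a * s\<^sup>2) * (1 + real k * t)"
      using ks[OF st(2)] a by (intro mult_left_mono) auto
    moreover have "\<kappa> * s\<^sup>2 \<le> a * (1 - real k * \<delta>) * s\<^sup>2" by (intro mult_right_mono aa) auto
    ultimately show ?thesis by (simp add: ac_simps)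
  qed
  moreover have "(a * t\<^sup>2) * (1 + real k * s) \<ge> \<kappa> * t\<^sup>2"
  proof -
    have "(a * t\<^sup>2) * (1 - real k * \<delta>) \<le> (a * t\<^sup>2) * (1 + real k * s)"
      using ks[OF st(1)] a by (intro mult_left_mono) auto
    moreover have "\<kappa> * t\<^sup>2 \<le> a * (1 - real k * \<delta>) * t\<^sup>2" by (intro mult_right_mono aa) auto
    ultimately show ?thesis by (simp add: ac_simps)
  qed
  moreover have "(a * s\<^sup>2) * (a * t\<^sup>2) \<ge> 0" using a by simp
  ultimately show ?thesis unfolding distrib_left[of \<kappa>] by linarith
qed

section \<open>The inequality in one coordinate and its tensorisation\<close>

context contractive_kernel
begin

lemma Kv_mono: "(\<And>b. b \<in> V \<Longrightarrow> u b \<le> v b) \<Longrightarrow> Kv u a \<le> Kv v a"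
  unfolding Kv_def by (intro sum_mono mult_left_mono K_nonneg)

lemma Kv_nonneg: "(\<And>b. b \<in> V \<Longrightarrow> 0 \<le> u b) \<Longrightarrow> 0 \<le> Kv u a"
  unfolding Kv_def by (intro sum_nonneg mult_nonneg_nonneg K_nonneg)

text \<open>The weights \<open>\<rho>\<close> and \<open>1 / \<rho>\<close> in the completed square
  are chosen so that contraction by \<open>\<rho>^2\<close> leaves the same coefficient
  \<open>\<rho> / 2\<close> on both arguments.\<close>

lemma av_mult_Kv_ge:
  assumes "av t = 0"
  shows "av (\<lambda>a. s a * Kv t a) \<ge> - (\<rho> / 2) * (av (\<lambda>a. (s a)\<^sup>2) + av (\<lambda>a. (t a)\<^sup>2))"
proof -
  have "av (\<lambda>a. (Kv t a)\<^sup>2) \<le> \<rho>\<^sup>2 * av (\<lambda>a. (t a)\<^sup>2)"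
    using contractive[of t] assms unfolding av_def Kv_def by simp
  then have 1: "1 / (2 * \<rho>) * av (\<lambda>a. (Kv t a)\<^sup>2) \<le> \<rho> / 2 * av (\<lambda>a. (t a)\<^sup>2)"
    using rho by (simp add: field_simps power2_eq_square)
  have "(- (\<rho> / 2)) * (s a)\<^sup>2 + (- (1 / (2 * \<rho>))) * (Kv t a)\<^sup>2 \<le> s a * Kv t a" for a
  proof -
    have "0 \<le> (\<rho> * s a + Kv t a)\<^sup>2 / (2 * \<rho>)" using rho by simp
    also have "\<dots> = \<rho> / 2 * (s a)\<^sup>2 + 1 / (2 * \<rho>) * (Kv t a)\<^sup>2 + s a * Kv t a"
      using rho by (simp add: field_simps power2_eq_square)
    finally show ?thesis by simp
  qed
  then have "av (\<lambda>a. (- (\<rho> / 2)) * (s a)\<^sup>2 + (- (1 / (2 * \<rho>))) * (Kv t a)\<^sup>2) \<le> av (\<lambda>a. s a * Kv t a)"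
    by (intro av_mono)
  then have "(- (\<rho> / 2)) * av (\<lambda>a. (s a)\<^sup>2) + (- (1 / (2 * \<rho>))) * av (\<lambda>a. (Kv t a)\<^sup>2) \<le> av (\<lambda>a. s a * Kv t a)"
    by (simp only: av_add av_scale)
  with 1 show ?thesis by (simp add: algebra_simps)
qed

text \<open>The relative deviations \<open>s\<close> and \<open>t\<close> have mean zero, so the
  linear terms vanish, and the gain \<open>\<kappa>\<close> on the squares cancels the worst
  covariance. \<open>\<delta>\<close> solves the condition of \<open>product_power_ge\<close> for
  this \<open>\<kappa>\<close> with equality.\<close>

lemma one_step_near:
  assumes k: "real k * (1 - \<rho>) > 1" and \<delta>: "\<delta> = (1 - real k * \<rho> / (real k - 1)) / (2 * real k)"
    and cd: "0 < c" "0 < d" and av: "av u = c" "av w = d"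
    and near: "\<And>a. a \<in> V \<Longrightarrow> \<bar>u a - c\<bar> \<le> \<delta> * c" "\<And>a. a \<in> V \<Longrightarrow> \<bar>w a - d\<bar> \<le> \<delta> * d"
  shows "c ^ k * d ^ k \<le> av (\<lambda>a. u a ^ k * Kv (\<lambda>b. w b ^ k) a)"
proof -
  define s where "s a = u a / c - 1" for a
  define t where "t a = w a / d - 1" for a
  define \<kappa> where "\<kappa> = (real k)\<^sup>2 * \<rho> / 2"
  have k1: "real k > 1" using mult_left_mono[of "1 - \<rho>" 1 "real k"] k rho by simp
  have kd: "2 * (real k * \<delta>) = 1 - real k * \<rho> / (real k - 1)" using k1 by (simp add: \<delta>)
  have "real k * \<rho> / (real k - 1) \<ge> 0" using k1 rho by simp
  then have kd1: "real k * \<delta> \<le> 1" using kd by linarith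
  have lam: "real k * (real k - 1) / 2 * (1 - 2 * (real k * \<delta>)) \<ge> \<kappa>"
    unfolding kd \<kappa>_def using k1 by (simp add: field_simps power2_eq_square)
  have us: "u a = c * (1 + s a)" and wt: "w a = d * (1 + t a)" for a
    using cd by (simp_all add: s_def t_def field_simps)
  have s: "\<bar>s a\<bar> \<le> \<delta>" and t: "\<bar>t a\<bar> \<le> \<delta>" if "a \<in> V" for a
    using near[OF that] cd unfolding us wt by (simp_all add: algebra_simps abs_mult)
  have s0: "av s = 0" and t0: "av t = 0"
    using av_scale[of "1 / c" u] av_scale[of "1 / d" w] av cd by (simp_all add: s_def[abs_def] t_def[abs_def] av_diff)
  let ?A = "\<lambda>a. 1 + real k * s a + \<kappa> * (s a)\<^sup>2" and ?B = "\<lambda>b. real k * t b + \<kappa> * (t b)\<^sup>2"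
  have "av (\<lambda>a. ?A a + Kv ?B a + (real k)\<^sup>2 * (s a * Kv t a)) =
      av (\<lambda>a. Kv (\<lambda>b. ?A a + (?B b + ((real k)\<^sup>2 * s a) * t b)) a)"
    by (simp only: Kv_add Kv_scale Kv_const) (simp add: algebra_simps)
  also have "\<dots> \<le> av (\<lambda>a. Kv (\<lambda>b. (1 + s a) ^ k * (1 + t b) ^ k) a)"
  proof (intro av_mono Kv_mono)
    fix a b assume "a \<in> V" "b \<in> V"
    then have "(1 + s a) ^ k * (1 + t b) ^ k \<ge>
        1 + real k * s a + real k * t b + (real k)\<^sup>2 * (s a * t b) + \<kappa> * ((s a)\<^sup>2 + (t b)\<^sup>2)"
      using k1 s t by (intro product_power_ge[OF _ _ kd1 _ lam]) auto
    then show "?A a + (?B b + ((real k)\<^sup>2 * s a) * t b) \<le> (1 + s a) ^ k * (1 + t b) ^ k"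
      by (simp add: algebra_simps)
  qed
  finally have 1: "av (\<lambda>a. ?A a + Kv ?B a + (real k)\<^sup>2 * (s a * Kv t a)) \<le>
      av (\<lambda>a. (1 + s a) ^ k * Kv (\<lambda>b. (1 + t b) ^ k) a)"
    by (simp add: Kv_scale)
  have "av (\<lambda>a. ?A a + Kv ?B a + (real k)\<^sup>2 * (s a * Kv t a)) =
      1 + \<kappa> * (av (\<lambda>a. (s a)\<^sup>2) + av (\<lambda>a. (t a)\<^sup>2)) + (real k)\<^sup>2 * av (\<lambda>a. s a * Kv t a)"
  proof -
    have "av (Kv ?B) = \<kappa> * av (\<lambda>a. (t a)\<^sup>2)"
      unfolding av_Kv by (simp add: av_add av_scale t0)
    moreover have "av ?A = 1 + \<kappa> * av (\<lambda>a. (s a)\<^sup>2)"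
      by (simp add: av_add av_scale s0)
    moreover have "av (\<lambda>a. ?A a + Kv ?B a + (real k)\<^sup>2 * (s a * Kv t a)) =
        av ?A + av (Kv ?B) + (real k)\<^sup>2 * av (\<lambda>a. s a * Kv t a)"
      by (subst av_add, subst av_add, subst av_scale) (rule refl)
    ultimately show ?thesis by (simp only: distrib_left)
  qed
  moreover have "(real k)\<^sup>2 * av (\<lambda>a. s a * Kv t a) \<ge>
      (real k)\<^sup>2 * (- (\<rho> / 2) * (av (\<lambda>a. (s a)\<^sup>2) + av (\<lambda>a. (t a)\<^sup>2)))"
    by (intro mult_left_mono av_mult_Kv_ge t0) auto
  ultimately have "1 \<le> av (\<lambda>a. (1 + s a) ^ k * Kv (\<lambda>b. (1 + t b) ^ k) a)"
    using 1 by (simp add: \<kappa>_def algebra_simps)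
  then have "c ^ k * d ^ k * 1 \<le> c ^ k * d ^ k * av (\<lambda>a. (1 + s a) ^ k * Kv (\<lambda>b. (1 + t b) ^ k) a)"
    using cd by (intro mult_left_mono) auto
  also have "\<dots> = av (\<lambda>a. u a ^ k * Kv (\<lambda>b. w b ^ k) a)"
    unfolding us wt power_mult_distrib Kv_scale by (simp add: av_scale[symmetric] ac_simps)
  finally show ?thesis by simp
qed

text \<open>Either both functions are near their means and nothing is lost, or some value is off by
  \<open>\<delta> * lo\<close>; then one fourth moment is at least
  \<open>p * (\<delta> * lo)^4\<close>, and the error term alone outweighs the product of the
  means.\<close>

lemma one_step:
  assumes k: "real k * (1 - \<rho>) > 1" and lo: "lo > 0"
  obtains C where "C > 0" "\<And>u w. (\<And>a. lo \<le> u a \<and> u a \<le> 2) \<Longrightarrow> (\<And>a. lo \<le> w a \<and> w a \<le> 2) \<Longrightarrow>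
    (av u) ^ k * (av w) ^ k - C * (av (\<lambda>a. (Dv u a) ^ 4) + av (\<lambda>a. (Dv w a) ^ 4)) \<le>
    av (\<lambda>a. u a ^ k * Kv (\<lambda>b. w b ^ k) a)"
proof -
  define \<delta> where "\<delta> = (1 - real k * \<rho> / (real k - 1)) / (2 * real k)"
  have k1: "real k > 1" using mult_left_mono[of "1 - \<rho>" 1 "real k"] k rho by simp
  have "real k * \<rho> < real k - 1" using k by (simp add: algebra_simps)
  then have \<delta>0: "\<delta> > 0" unfolding \<delta>_def using k1 by simp
  \<comment> \<open>\<open>4 ^ k\<close> bounds the product of the \<open>k\<close>-th powers of two
    means, each at most 2.\<close>
  define C where "C = 4 ^ k / (p * (\<delta> * lo) ^ 4)"
  have C0: "C > 0" using p_pos \<delta>0 lo by (simp add: C_def)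
  show thesis
  proof (rule that[OF C0])
    fix u w :: "'v \<Rightarrow> real"
    assume u: "\<And>a. lo \<le> u a \<and> u a \<le> 2" and w: "\<And>a. lo \<le> w a \<and> w a \<le> 2"
    have avr: "lo \<le> av v \<and> av v \<le> 2" if "\<And>a. lo \<le> v a \<and> v a \<le> 2" for v
      using that av_mono[of "\<lambda>_. lo" v] av_mono[of v "\<lambda>_. 2"] by simp
    let ?c = "av u" and ?d = "av w"
    let ?E = "\<lambda>v. av (\<lambda>a. (Dv v a) ^ 4)"
    have E0: "0 \<le> ?E v" for v by (intro av_nonneg) auto
    have rhs0: "0 \<le> av (\<lambda>a. u a ^ k * Kv (\<lambda>b. w b ^ k) a)"
    proof -
      have "0 \<le> u a" "0 \<le> w a" for a using u[of a] w[of a] lo by linarith+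
      then show ?thesis by (intro av_nonneg mult_nonneg_nonneg Kv_nonneg zero_le_power)
    qed
    have far: "4 ^ k \<le> C * ?E v" if v: "lo \<le> av v" "a \<in> V" "\<not> \<bar>v a - av v\<bar> \<le> \<delta> * av v" for v a
    proof -
      have "\<delta> * lo \<le> \<delta> * av v" using \<delta>0 v by simp
      then have "\<delta> * lo \<le> \<bar>Dv v a\<bar>" using v by (simp add: Dv_def)
      then have "(\<delta> * lo) ^ 4 \<le> \<bar>Dv v a\<bar> ^ 4" using \<delta>0 lo by (intro power_mono) auto
      then have "p * (\<delta> * lo) ^ 4 \<le> p * (Dv v a) ^ 4" using p_pos by simp
      also have "\<dots> \<le> ?E v" using v by (intro av_ge_single) auto
      finally have "C * (p * (\<delta> * lo) ^ 4) \<le> C * ?E v" using C0 by (intro mult_left_mono) auto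
      moreover have "C * (p * (\<delta> * lo) ^ 4) = 4 ^ k" using p_pos \<delta>0 lo by (simp add: C_def)
      ultimately show ?thesis by simp
    qed
    have cd: "?c ^ k * ?d ^ k \<le> 4 ^ k"
    proof -
      have "?c ^ k * ?d ^ k \<le> 2 ^ k * 2 ^ k"
        using avr[of u, OF u] avr[of w, OF w] lo by (intro mult_mono power_mono) auto
      then show ?thesis by (simp flip: power_mult_distrib)
    qed
    show "?c ^ k * ?d ^ k - C * (?E u + ?E w) \<le> av (\<lambda>a. u a ^ k * Kv (\<lambda>b. w b ^ k) a)"
    proof (cases "(\<forall>a\<in>V. \<bar>u a - ?c\<bar> \<le> \<delta> * ?c) \<and> (\<forall>a\<in>V. \<bar>w a - ?d\<bar> \<le> \<delta> * ?d)")
      case True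
      then have "?c ^ k * ?d ^ k \<le> av (\<lambda>a. u a ^ k * Kv (\<lambda>b. w b ^ k) a)"
        using avr[of u, OF u] avr[of w, OF w] lo by (intro one_step_near[OF k \<delta>_def]) auto
      moreover have "0 \<le> C * (?E u + ?E w)" using C0 E0[of u] E0[of w] by simp
      ultimately show ?thesis by simp
    next
      case False
      then have "4 ^ k \<le> C * ?E u \<or> 4 ^ k \<le> C * ?E w" using far avr[of u, OF u] avr[of w, OF w] by blast
      moreover have "0 \<le> C * ?E u" "0 \<le> C * ?E w" using C0 E0[of u] E0[of w] by simp_all
      ultimately have "4 ^ k \<le> C * (?E u + ?E w)" by (auto simp: distrib_left)
      then show ?thesis using cd rhs0 by linarith
    qed
  qed
qed

text \<open>
  The coordinates \<open>1..n\<close> of the two arguments are averaged over \<open>n\<close> independent steps of the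
  stationary chain, the first argument holding the starting points.
\<close>

primrec PP :: "nat \<Rightarrow> ((nat \<Rightarrow> 'v) \<Rightarrow> (nat \<Rightarrow> 'v) \<Rightarrow> real) \<Rightarrow> (nat \<Rightarrow> 'v) \<Rightarrow> (nat \<Rightarrow> 'v) \<Rightarrow> real" where
  "PP 0 h = h"
| "PP (Suc n) h = PP n (\<lambda>x y. av (\<lambda>a. Kv (\<lambda>b. h (x(Suc n := a)) (y(Suc n := b))) a))"

lemma PP_mono: "(\<And>x y. h x y \<le> g x y) \<Longrightarrow> PP n h x y \<le> PP n g x y"
proof (induction n arbitrary: h g)
  case (Suc n)
  show ?case
    unfolding PP.simps by (intro Suc.IH av_mono Kv_mono Suc.prems)
qed simp

lemma PP_add: "PP n (\<lambda>x y. h x y + g x y) x y = PP n h x y + PP n g x y"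
  by (induction n arbitrary: h g) (auto simp: av_add Kv_add)

lemma PP_scale: "PP n (\<lambda>x y. c * h x y) x y = c * PP n h x y"
  by (induction n arbitrary: h) (auto simp: av_scale Kv_scale)

lemma PP_sum: "finite I \<Longrightarrow> PP n (\<lambda>x y. \<Sum>k\<in>I. h k x y) x y = (\<Sum>k\<in>I. PP n (h k) x y)"
proof (induction I rule: finite_induct)
  case empty
  then show ?case using PP_scale[of n 0 "\<lambda>_ _. 0" x y] by simp
next
  case (insert k I)
  then show ?case by (simp add: PP_add)
qed

lemma PP_fst: "PP n (\<lambda>x y. f x) x y = EE n f x"
  by (induction n arbitrary: f) (auto simp: coord_Av)

lemma PP_snd: "PP n (\<lambda>x y. f y) x y = EE n f y"
proof (induction n arbitrary: f)
  case (Suc n)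
  have "av (\<lambda>a. Kv (\<lambda>b. f (y(Suc n := b))) a) = coord (Suc n) Av f y" for y
    using av_Kv[of "\<lambda>b. f (y(Suc n := b))"] by (simp add: coord_Av)
  then show ?case using Suc by simp
qed simp

text \<open>Conditioned on the starting points, the second factor averages to
  \<open>Kn n g\<close>.\<close>

lemma PP_product: "PP n (\<lambda>x y. f x * g y) x x = EE n (\<lambda>y. f y * Kn n g y) x"
proof (induction n arbitrary: f g)
  case (Suc n)
  let ?f = "\<lambda>a y. f (y(Suc n := a))" and ?g = "\<lambda>b y. g (y(Suc n := b))"
  have "PP (Suc n) (\<lambda>x y. f x * g y) x x =
      (\<Sum>a\<in>V. \<pi> a * (\<Sum>b\<in>V. K a b * PP n (\<lambda>x y. ?f a x * ?g b y) x x))"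
    by (simp add: av_def Kv_def PP_sum finite_V PP_scale)
  also have "\<dots> = av (\<lambda>a. \<Sum>b\<in>V. K a b * EE n (\<lambda>y. ?f a y * Kn n (?g b) y) x)"
    unfolding Suc.IH av_def by simp
  also have "\<dots> = av (\<lambda>a. EE n (\<lambda>y. f y * Kn (Suc n) g y) (x(Suc n := a)))"
  proof (intro av_cong)
    fix a
    have "f (y(Suc n := a)) * Kn (Suc n) g (y(Suc n := a)) = (\<Sum>b\<in>V. K a b * (?f a y * Kn n (?g b) y))" for y
      by (subst tens_Suc') (auto simp: coord_def Kv_def tens_upd sum_distrib_left intro!: sum.cong)
    then show "(\<Sum>b\<in>V. K a b * EE n (\<lambda>y. ?f a y * Kn n (?g b) y) x) =
        EE n (\<lambda>y. f y * Kn (Suc n) g y) (x(Suc n := a))"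
      by (subst tens_upd) (auto simp: EE_sum finite_V EE_scale simp del: tens.simps(2))
  qed
  also have "\<dots> = EE (Suc n) (\<lambda>y. f y * Kn (Suc n) g y) x"
    by (rule EE_Suc_av[symmetric])
  finally show ?case .
qed simp

lemma hybrid:
  assumes C: "C \<ge> 0" and step: "\<And>u w. (\<And>a. lo \<le> u a \<and> u a \<le> 2) \<Longrightarrow> (\<And>a. lo \<le> w a \<and> w a \<le> 2) \<Longrightarrow>
    (av u) ^ k * (av w) ^ k - C * (av (\<lambda>a. (Dv u a) ^ 4) + av (\<lambda>a. (Dv w a) ^ 4)) \<le>
    av (\<lambda>a. u a ^ k * Kv (\<lambda>b. w b ^ k) a)"
    and "\<And>y. lo \<le> U y \<and> U y \<le> 2" "\<And>y. lo \<le> W y \<and> W y \<le> 2"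
  shows "(EE n U x) ^ k * (EE n W y) ^ k - C * ((\<Sum>i\<in>{1..n}. EE n (\<lambda>y. (D i U y) ^ 4) x) +
    (\<Sum>i\<in>{1..n}. EE n (\<lambda>y. (D i W y) ^ 4) y)) \<le> PP n (\<lambda>x y. U x ^ k * W y ^ k) x y"
  using assms(3,4)
proof (induction n arbitrary: U W)
  case (Suc n)
  let ?U = "coord (Suc n) Av U" and ?W = "coord (Suc n) Av W"
  let ?e = "\<lambda>U x. av (\<lambda>a. (D (Suc n) U (x(Suc n := a))) ^ 4)"
  have range: "lo \<le> coord (Suc n) Av U y \<and> coord (Suc n) Av U y \<le> 2" if "\<And>y. lo \<le> U y \<and> U y \<le> 2" for U y
    using that av_mono[of "\<lambda>_. lo" "\<lambda>b. U (y(Suc n := b))"] av_mono[of "\<lambda>b. U (y(Suc n := b))" "\<lambda>_. 2"]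
    by (simp add: coord_Av)
  have e: "EE n (?e U) x = EE (Suc n) (\<lambda>y. (D (Suc n) U y) ^ 4) x" for U x
    by (simp add: coord_Av)
  \<comment> \<open>By Jensen, averaging over the last coordinate does not increase the fourth
    moments in the others, so the accumulated errors are controlled by the original
    functions.\<close>
  have mono: "(\<Sum>i\<in>{1..n}. EE n (\<lambda>y. (D i (coord (Suc n) Av U) y) ^ 4) x) \<le>
      (\<Sum>i\<in>{1..n}. EE (Suc n) (\<lambda>y. (D i U y) ^ 4) x)" for U x
  proof (intro sum_mono)
    fix i assume "i \<in> {1..n}"
    then have "D i (coord (Suc n) Av U) = coord (Suc n) Av (D i U)"
      by (intro coord_commute) auto
    then have "(D i (coord (Suc n) Av U) y) ^ 4 \<le> coord (Suc n) Av (\<lambda>y. (D i U y) ^ 4) y" for y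
      unfolding coord_Av by (simp only: av_Jensen4)
    then show "EE n (\<lambda>y. (D i (coord (Suc n) Av U) y) ^ 4) x \<le> EE (Suc n) (\<lambda>y. (D i U y) ^ 4) x"
      unfolding EE_Suc by (intro EE_mono)
  qed
  have "PP (Suc n) (\<lambda>x y. U x ^ k * W y ^ k) x y \<ge>
      PP n (\<lambda>x y. ?U x ^ k * ?W y ^ k + (- C) * (?e U x + ?e W y)) x y"
    unfolding PP.simps
  proof (rule PP_mono)
    fix x y
    have "(av (\<lambda>b. U (x(Suc n := b)))) ^ k * (av (\<lambda>b. W (y(Suc n := b)))) ^ k -
      C * (av (\<lambda>a. (Dv (\<lambda>b. U (x(Suc n := b))) a) ^ 4) + av (\<lambda>a. (Dv (\<lambda>b. W (y(Suc n := b))) a) ^ 4)) \<le>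
      av (\<lambda>a. U (x(Suc n := a)) ^ k * Kv (\<lambda>b. W (y(Suc n := b)) ^ k) a)"
      using Suc.prems by (intro step)
    then show "?U x ^ k * ?W y ^ k + (- C) * (?e U x + ?e W y) \<le>
        av (\<lambda>a. Kv (\<lambda>b. U (x(Suc n := a)) ^ k * W (y(Suc n := b)) ^ k) a)"
      by (simp add: Kv_scale coord_Av) (simp add: coord_def)
  qed
  also have "PP n (\<lambda>x y. ?U x ^ k * ?W y ^ k + (- C) * (?e U x + ?e W y)) x y =
      PP n (\<lambda>x y. ?U x ^ k * ?W y ^ k) x y - C * (EE n (?e U) x + EE n (?e W) y)"
    unfolding PP_add PP_scale by (simp add: PP_fst PP_snd)
  finally have 1: "PP n (\<lambda>x y. ?U x ^ k * ?W y ^ k) x y - C * (EE n (?e U) x + EE n (?e W) y) \<le>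
      PP (Suc n) (\<lambda>x y. U x ^ k * W y ^ k) x y" .
  have 2: "(EE n ?U x) ^ k * (EE n ?W y) ^ k - C * ((\<Sum>i\<in>{1..n}. EE n (\<lambda>y. (D i ?U y) ^ 4) x) +
      (\<Sum>i\<in>{1..n}. EE n (\<lambda>y. (D i ?W y) ^ 4) y)) \<le> PP n (\<lambda>x y. ?U x ^ k * ?W y ^ k) x y"
    by (intro Suc.IH range Suc.prems)
  have 3: "C * ((\<Sum>i\<in>{1..n}. EE n (\<lambda>y. (D i ?U y) ^ 4) x) + (\<Sum>i\<in>{1..n}. EE n (\<lambda>y. (D i ?W y) ^ 4) y)) \<le>
      C * ((\<Sum>i\<in>{1..n}. EE (Suc n) (\<lambda>y. (D i U y) ^ 4) x) + (\<Sum>i\<in>{1..n}. EE (Suc n) (\<lambda>y. (D i W y) ^ 4) y))"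
    using C by (intro mult_left_mono add_mono mono)
  have sumS: "(\<Sum>i\<in>{1..Suc n}. F i) = (\<Sum>i\<in>{1..n}. F i) + F (Suc n)" for F :: "nat \<Rightarrow> real" by simp
  show ?case
    using 1 2 3 unfolding sumS e EE_Suc[of n U] EE_Suc[of n W] distrib_left[of C] by linarith
qed simp

end

section \<open>Low influences and the energy increment\<close>

lemma fourth_power_diff_le: "(a - b) ^ 4 \<le> 8 * (a ^ 4 + b ^ 4)" for a b :: real
proof -
  have "(a - b)\<^sup>2 \<le> 2 * (a\<^sup>2 + b\<^sup>2)" using sum_squares_ge_zero[of "a + b" 0] by (simp add: power2_eq_square algebra_simps)
  then have "((a - b)\<^sup>2)\<^sup>2 \<le> (2 * (a\<^sup>2 + b\<^sup>2))\<^sup>2" by (intro power_mono) auto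
  also have "\<dots> + 4 * (a\<^sup>2 - b\<^sup>2)\<^sup>2 = 8 * (a ^ 4 + b ^ 4)" by algebra
  finally have "(a - b) ^ 4 + 4 * (a\<^sup>2 - b\<^sup>2)\<^sup>2 \<le> 8 * (a ^ 4 + b ^ 4)" by simp
  moreover have "0 \<le> 4 * (a\<^sup>2 - b\<^sup>2)\<^sup>2" by simp
  ultimately show ?thesis by linarith
qed

text \<open>In \<open>a - b = A^k - B^k\<close> the cofactor of \<open>A - B\<close> contains
  \<open>A^(k - 1)\<close>, which is at least \<open>\<eta>\<close> whether or not \<open>A\<close>
  exceeds 1.\<close>

lemma root_Lipschitz:
  fixes a b \<eta> :: real
  assumes k: "k > 0" and "0 < \<eta>" "\<eta> \<le> 1" "\<eta> \<le> a" "\<eta> \<le> b"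
  shows "\<bar>root k a - root k b\<bar> \<le> 1 / \<eta> * \<bar>a - b\<bar>"
proof -
  define A B where "A = root k a" and "B = root k b"
  have A: "A ^ k = a" "A \<ge> 0" and B: "B ^ k = b" "B \<ge> 0" using assms by (auto simp: A_def B_def)
  have "\<eta> \<le> A ^ (k - 1)"
  proof (cases "A \<ge> 1")
    case True
    then have "1 \<le> A ^ (k - 1)" by (rule one_le_power)
    then show ?thesis using assms by linarith
  next
    case False
    then have "A ^ k \<le> A ^ (k - 1)" using A by (intro power_decreasing) auto
    then show ?thesis using A assms by linarith
  qed
  also have "A ^ (k - 1) = (\<Sum>i\<in>{k - 1}. B ^ (k - Suc i) * A ^ i)" by simp
  also have "\<dots> \<le> (\<Sum>i<k. B ^ (k - Suc i) * A ^ i)"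
    using A B k by (intro sum_mono2) auto
  finally have "\<eta> * \<bar>A - B\<bar> \<le> (\<Sum>i<k. B ^ (k - Suc i) * A ^ i) * \<bar>A - B\<bar>"
    by (intro mult_right_mono) auto
  also have "\<dots> = \<bar>(A - B) * (\<Sum>i<k. B ^ (k - Suc i) * A ^ i)\<bar>"
    using A B by (simp add: abs_mult sum_nonneg)
  also have "\<dots> = \<bar>a - b\<bar>"
    using power_diff_sumr2[of A k B] A B by simp
  finally show ?thesis using assms by (simp add: A_def B_def field_simps)
qed

context contractive_kernel
begin

lemma tens_range:
  assumes "\<And>i u a. (\<And>b. lo \<le> u b \<and> u b \<le> hi) \<Longrightarrow> lo \<le> L i u a \<and> L i u a \<le> hi"
    and "\<And>y. lo \<le> f y \<and> f y \<le> hi"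
  shows "lo \<le> tens L n f y \<and> tens L n f y \<le> (hi :: real)"
  using assms(2)
proof (induction n arbitrary: f)
  case (Suc n)
  have "lo \<le> coord (Suc n) (L (Suc n)) f y \<and> coord (Suc n) (L (Suc n)) f y \<le> hi" for y
    unfolding coord_def by (intro assms(1) Suc.prems)
  then show ?case using Suc.IH by simp
qed simp

lemma av_range: "(\<And>b. lo \<le> u b \<and> u b \<le> hi) \<Longrightarrow> lo \<le> av u \<and> av u \<le> hi"
  using av_mono[of "\<lambda>_. lo" u] av_mono[of u "\<lambda>_. hi"] by simp

lemma Kv_range: "(\<And>b. lo \<le> u b \<and> u b \<le> hi) \<Longrightarrow> lo \<le> Kv u a \<and> Kv u a \<le> hi"
  using Kv_mono[of "\<lambda>_. lo" u a] Kv_mono[of u "\<lambda>_. hi" a] by simp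

lemma Rv_range:
  assumes "0 \<le> t" "t \<le> 1" "\<And>b. lo \<le> u b \<and> u b \<le> hi"
  shows "lo \<le> Rv t u a \<and> Rv t u a \<le> hi"
proof -
  have "t * lo + (1 - t) * lo \<le> Rv t u a" "Rv t u a \<le> t * hi + (1 - t) * hi"
    unfolding Rv_def using assms av_range[OF assms(3)] by (auto intro!: add_mono mult_left_mono)
  then show ?thesis by (simp add: algebra_simps)
qed

lemma EE_RR: "EE n (RR s n f) x = EE n f x"
proof -
  have "Av (Rv s u) = Av u" for u by (rule ext) (simp add: Av_def)
  then show ?thesis by (simp add: tens_tens)
qed

text \<open>The Lipschitz bound controls deviations from \<open>\<phi> (av u)\<close>; recentring
  them at their own mean costs a constant factor.\<close>

lemma av_Dv_fourth_Lipschitz: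
  assumes "\<And>a. \<bar>\<phi> (u a) - \<phi> (av u)\<bar> \<le> L * \<bar>u a - av u\<bar>"
  shows "av (\<lambda>a. (Dv (\<lambda>a. \<phi> (u a)) a) ^ 4) \<le> 16 * L ^ 4 * av (\<lambda>a. (Dv u a) ^ 4)"
proof -
  define v where "v a = \<phi> (u a) - \<phi> (av u)" for a
  have "Dv (\<lambda>a. \<phi> (u a)) a = v a - av v" for a by (simp add: Dv_def v_def[abs_def] av_diff)
  then have "av (\<lambda>a. (Dv (\<lambda>a. \<phi> (u a)) a) ^ 4) \<le> av (\<lambda>a. 8 * (v a ^ 4 + (av v) ^ 4))"
    by (simp only:) (intro av_mono fourth_power_diff_le)
  also have "\<dots> = 8 * (av (\<lambda>a. v a ^ 4) + (av v) ^ 4)" by (simp only: av_scale av_add av_const)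
  also have "\<dots> \<le> 16 * av (\<lambda>a. v a ^ 4)" using av_Jensen4[of v] by simp
  also have "av (\<lambda>a. v a ^ 4) \<le> av (\<lambda>a. L ^ 4 * (Dv u a) ^ 4)"
  proof (intro av_mono)
    fix a
    have "\<bar>v a\<bar> ^ 4 \<le> (L * \<bar>u a - av u\<bar>) ^ 4" unfolding v_def by (intro power_mono assms) auto
    then show "v a ^ 4 \<le> L ^ 4 * (Dv u a) ^ 4" by (simp add: Dv_def power_mult_distrib)
  qed
  finally show ?thesis by (simp add: av_scale)
qed

lemma Kn_const_add: "Kn n (\<lambda>y. f y + c) = (\<lambda>y. Kn n f y + c)"
proof -
  have "c \<le> Kn n (\<lambda>_. c) y \<and> Kn n (\<lambda>_. c) y \<le> c" for y
    by (rule tens_range) (use Kv_range in blast)+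
  then have "Kn n (\<lambda>_. c) = (\<lambda>_. c)" by (intro ext antisym) auto
  then show ?thesis by (simp add: tens_add)
qed

text \<open>Losses are budgeted against \<open>c0\<close>: at most \<open>c0 / 8\<close> for the
  fluctuations, \<open>3 * \<eta>\<close> with \<open>\<eta> = c0 / 16\<close> for the shift, and
  \<open>c0 / 8\<close> for the smoothing, which leaves more than \<open>c0 / 2\<close>.\<close>

lemma low_influence_bound:
  assumes \<mu>: "0 < \<mu>" "\<mu> \<le> 1"
  obtains s \<tau> c where "0 < s" "s < 1" "\<tau> > 0" "c > 0"
    "\<And>n f x. (\<And>y. 0 \<le> f y \<and> f y \<le> 1) \<Longrightarrow> \<mu> \<le> EE n f x \<Longrightarrow>
      (\<And>i. i \<in> {1..n} \<Longrightarrow> EE n (\<lambda>y. (D i (RR s n f) y)\<^sup>2) x \<le> \<tau>) \<Longrightarrow>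
      c \<le> EE n (\<lambda>y. f y * Kn n f y) x"
proof -
  obtain k where "real k > 1 / (1 - \<rho>)" using reals_Archimedean2 by blast
  then have k: "real k * (1 - \<rho>) > 1" using rho by (simp add: field_simps)
  then have k0: "k > 0" by (cases k) auto
  define c0 where "c0 = \<mu> ^ k * \<mu> ^ k"
  have c0: "0 < c0" "c0 \<le> 1" using \<mu> by (auto simp: c0_def mult_le_one power_le_one)
  define \<eta> where "\<eta> = c0 / 16"
  have \<eta>: "0 < \<eta>" "\<eta> \<le> 1" using c0 by (auto simp: \<eta>_def)
  obtain C where C: "C > 0" "\<And>u w. (\<And>a. \<eta> \<le> u a \<and> u a \<le> 2) \<Longrightarrow> (\<And>a. \<eta> \<le> w a \<and> w a \<le> 2) \<Longrightarrow>
    (av u) ^ k * (av w) ^ k - C * (av (\<lambda>a. (Dv u a) ^ 4) + av (\<lambda>a. (Dv w a) ^ 4)) \<le>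
    av (\<lambda>a. u a ^ k * Kv (\<lambda>b. w b ^ k) a)"
    using one_step[OF k \<eta>(1)] by blast
  define s0 where "s0 = min (1 / 2) (p / 3)"
  have s0: "0 < s0" "s0 \<le> 1 / 2" "s0 \<le> p / 3" using p_pos by (auto simp: s0_def)
  have s0_2: "8 * s0\<^sup>2 \<le> 2"
    using power_mono[OF s0(2), of 2] s0(1) by (simp add: power2_eq_square)
  have "s0 ^ 4 \<le> s0 ^ 1" using s0 by (intro power_decreasing) auto
  then have s0_4: "3 * s0 ^ 4 \<le> p" using s0 by simp
  have r: "\<rho>\<^sup>2 < 1" using rho by (simp add: power_less_one_iff)
  \<comment> \<open>\<open>s\<close> has to be a root of order \<open>2 ^ j\<close> of the strong
    noise \<open>s0\<close>, yet so close to 1 that smoothing with noise \<open>s^2\<close> costs at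
    most \<open>c0 / 8\<close>.\<close>
  have "(\<lambda>j. root (2 ^ j) s0) \<longlonglongrightarrow> 1"
    using LIMSEQ_subseq_LIMSEQ[OF LIMSEQ_root_const[OF s0(1)], of "\<lambda>j. 2 ^ j"]
    by (simp add: o_def strict_mono_def)
  then have "(\<lambda>j. 1 - ((root (2 ^ j) s0)\<^sup>2)\<^sup>2) \<longlonglongrightarrow> 1 - (1\<^sup>2)\<^sup>2"
    by (intro tendsto_intros)
  then have "(\<lambda>j. 1 - ((root (2 ^ j) s0)\<^sup>2)\<^sup>2) \<longlonglongrightarrow> 0" by simp
  moreover have "(c0 / 8)\<^sup>2 * (1 - \<rho>\<^sup>2) > 0" using c0 r by simp
  ultimately have "\<forall>\<^sub>F j in sequentially. 1 - ((root (2 ^ j) s0)\<^sup>2)\<^sup>2 < (c0 / 8)\<^sup>2 * (1 - \<rho>\<^sup>2)"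
    by (rule order_tendstoD)
  then obtain j where j: "1 - ((root (2 ^ j) s0)\<^sup>2)\<^sup>2 < (c0 / 8)\<^sup>2 * (1 - \<rho>\<^sup>2)"
    unfolding eventually_sequentially by blast
  define s where "s = root (2 ^ j) s0"
  have s: "0 < s" "s < 1" "s ^ (2 ^ j) = s0"
    using s0 by (auto simp: s_def)
  have s2: "s\<^sup>2 < 1" using s by (simp add: power_less_one_iff)
  \<comment> \<open>Balances three factors to \<open>c0 / 8\<close>: \<open>16 / \<eta>^4\<close>
    from the root, \<open>e / (1 - s^2)\<close> from the summed fourth moments, and
    \<open>2 * C\<close> from the two arguments.\<close>
  define e where "e = c0 * \<eta> ^ 4 * (1 - s\<^sup>2) / (256 * C)"
  have e: "e > 0" using c0 \<eta> C s2 by (simp add: e_def)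
  define \<tau> where "\<tau> = (e ^ (2 ^ j))\<^sup>2"
  show thesis
  proof (rule that[of s \<tau> "c0 / 2"])
    show "0 < s" "s < 1" "\<tau> > 0" "c0 / 2 > 0" using s e c0 by (auto simp: \<tau>_def)
    fix n f x
    assume f: "\<And>y. 0 \<le> f y \<and> f y \<le> 1" and mean: "\<mu> \<le> EE n f x"
      and inf: "\<And>i. i \<in> {1..n} \<Longrightarrow> EE n (\<lambda>y. (D i (RR s n f) y)\<^sup>2) x \<le> \<tau>"
    have fabs: "\<bar>f y\<bar> \<le> 1" for y using f[of y] by simp
    \<comment> \<open>Noise is applied twice: after the inner copy the influences are small and have
      bounded sum, the outer copy yields the hypercontractive gain.\<close>
    define F where "F = RR (s\<^sup>2) n f"
    have F: "0 \<le> F y \<and> F y \<le> 1" for y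
      unfolding F_def using f s2 by (intro tens_range Rv_range) auto
    have F_RR: "F = RR s n (RR s n f)" by (simp add: F_def RR_RR power2_eq_square)
    have KF: "0 \<le> Kn n F y \<and> Kn n F y \<le> 1" for y
      using F by (intro tens_range Kv_range) auto
    let ?h = "\<lambda>i. D i (RR s n f)"
    have DF: "D i F = RR s n (?h i)" for i unfolding F_RR by (rule RR_D)
    have DF_le: "\<bar>D i F y\<bar> \<le> 1" for i y
    proof -
      have "0 \<le> av (\<lambda>b. F (y(i := b))) \<and> av (\<lambda>b. F (y(i := b))) \<le> 1" by (rule av_range) (rule F)
      then show ?thesis using F[of y] by (simp add: coord_def Dv_def abs_le_iff)
    qed
    have four: "(\<Sum>i\<in>{1..n}. EE n (\<lambda>y. (D i F y) ^ 4) x) \<le> e / (1 - s\<^sup>2)"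
    proof -
      have "(\<Sum>i\<in>{1..n}. EE n (\<lambda>y. (D i F y) ^ 4) x) \<le> (\<Sum>i\<in>{1..n}. e * EE n (\<lambda>y. (?h i y)\<^sup>2) x)"
      proof (rule sum_mono)
        fix i assume "i \<in> {1..n}"
        then show "EE n (\<lambda>y. (D i F y) ^ 4) x \<le> e * EE n (\<lambda>y. (?h i y)\<^sup>2) x"
          unfolding DF using s0 s0_2 s0_4 s e DF_le[of i] inf
          by (intro fourth_moment_small[of s0 s j e n "?h i" x]) (auto simp: DF \<tau>_def)
      qed
      also have "\<dots> = e * (\<Sum>i\<in>{1..n}. EE n (\<lambda>y. (?h i y)\<^sup>2) x)" by (rule sum_distrib_left[symmetric])
      also have "\<dots> \<le> e * (1 / (1 - s\<^sup>2))"
        using fabs s e by (intro mult_left_mono sum_influence_le) auto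
      finally show ?thesis by simp
    qed
    define \<Phi> where "\<Phi> y = root k (F y + \<eta>)" for y
    have \<Phi>_pow: "\<Phi> y ^ k = F y + \<eta>" for y using k0 F[of y] \<eta> by (simp add: \<Phi>_def)
    have \<Phi>: "\<eta> \<le> \<Phi> y \<and> \<Phi> y \<le> 2" for y
    proof
      have pos: "0 \<le> \<Phi> y" using k0 F[of y] \<eta> by (simp add: \<Phi>_def real_root_ge_zero)
      have "\<eta> ^ k \<le> \<eta> ^ 1" using \<eta> k0 by (intro power_decreasing) auto
      then have "\<eta> ^ k \<le> \<Phi> y ^ k" using F[of y] unfolding \<Phi>_pow by simp
      then show "\<eta> \<le> \<Phi> y" using k0 pos by (simp add: power_mono_iff \<eta>(1) less_imp_le)
      have "(2::real) ^ 1 \<le> 2 ^ k" using k0 by (intro power_increasing) auto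
      then have "\<Phi> y ^ k \<le> 2 ^ k" using F[of y] \<eta> unfolding \<Phi>_pow by simp
      then show "\<Phi> y \<le> 2" using k0 pos by (simp add: power_mono_iff)
    qed
    have D\<Phi>: "EE n (\<lambda>y. (D i \<Phi> y) ^ 4) x \<le> 16 * (1 / \<eta>) ^ 4 * EE n (\<lambda>y. (D i F y) ^ 4) x" if i: "i \<in> {1..n}" for i
    proof -
      have "EE n (\<lambda>y. (D i \<Phi> y) ^ 4) x = EE n (\<lambda>y. av (\<lambda>b. (Dv (\<lambda>b. root k (F (y(i := b)) + \<eta>)) b) ^ 4)) x"
        by (subst EE_absorb_av[OF i, symmetric]) (simp add: coord_def \<Phi>_def)
      also have "\<dots> \<le> EE n (\<lambda>y. 16 * (1 / \<eta>) ^ 4 * av (\<lambda>b. (Dv (\<lambda>b. F (y(i := b))) b) ^ 4)) x"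
      proof (intro EE_mono av_Dv_fourth_Lipschitz)
        fix y a
        have "0 \<le> av (\<lambda>b. F (y(i := b)))" using F by (intro av_nonneg) auto
        then show "\<bar>root k (F (y(i := a)) + \<eta>) - root k (av (\<lambda>b. F (y(i := b))) + \<eta>)\<bar> \<le>
            1 / \<eta> * \<bar>F (y(i := a)) - av (\<lambda>b. F (y(i := b)))\<bar>"
          using root_Lipschitz[OF k0 \<eta>, of "F (y(i := a)) + \<eta>" "av (\<lambda>b. F (y(i := b))) + \<eta>"] F[of "y(i := a)"]
          by simp
      qed
      also have "\<dots> = 16 * (1 / \<eta>) ^ 4 * EE n (\<lambda>y. (D i F y) ^ 4) x"
        unfolding EE_scale by (subst (2) EE_absorb_av[OF i, symmetric]) (simp add: coord_def)
      finally show ?thesis .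
    qed
    let ?S = "\<Sum>i\<in>{1..n}. EE n (\<lambda>y. (D i \<Phi> y) ^ 4) x"
    have "?S \<le> 16 * (1 / \<eta>) ^ 4 * (\<Sum>i\<in>{1..n}. EE n (\<lambda>y. (D i F y) ^ 4) x)"
      by (intro sum_mult_le_mult_sum D\<Phi>)
    also have "\<dots> \<le> 16 * (1 / \<eta>) ^ 4 * (e / (1 - s\<^sup>2))"
      using \<eta> by (intro mult_left_mono four) auto
    also have "e / (1 - s\<^sup>2) = c0 * \<eta> ^ 4 / (256 * C)" using s2 by (simp add: e_def)
    also have "16 * (1 / \<eta>) ^ 4 * (c0 * \<eta> ^ 4 / (256 * C)) = c0 / (16 * C)"
      using \<eta> C by (simp add: field_simps)
    finally have S: "C * (?S + ?S) \<le> c0 / 8" using C by (simp add: field_simps)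
    have "\<mu> \<le> EE n F x" using mean by (simp add: F_def EE_RR)
    \<comment> \<open>Values in \<open>[0, 1]\<close> only grow under a root.\<close>
    also have "\<dots> \<le> EE n \<Phi> x"
    proof (intro EE_mono)
      fix y
      have "F y ^ k \<le> F y ^ 1" using F[of y] k0 by (intro power_decreasing) auto
      then have "F y ^ k \<le> \<Phi> y ^ k" using \<eta> unfolding \<Phi>_pow by simp
      then show "F y \<le> \<Phi> y" using k0 F[of y] \<Phi>[of y] \<eta> by (simp add: power_mono_iff)
    qed
    finally have "\<mu> ^ k \<le> (EE n \<Phi> x) ^ k" using \<mu> by (intro power_mono) auto
    then have "c0 \<le> (EE n \<Phi> x) ^ k * (EE n \<Phi> x) ^ k"
      unfolding c0_def using \<mu> by (intro mult_mono) (auto intro: order_trans[of 0 "\<mu> ^ k"])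
    then have "c0 - c0 / 8 \<le> (EE n \<Phi> x) ^ k * (EE n \<Phi> x) ^ k - C * (?S + ?S)" using S by linarith
    also have "\<dots> \<le> PP n (\<lambda>x y. \<Phi> x ^ k * \<Phi> y ^ k) x x"
      using C \<Phi> by (intro hybrid) auto
    also have "\<dots> = EE n (\<lambda>y. (F y + \<eta>) * (Kn n F y + \<eta>)) x"
      unfolding \<Phi>_pow PP_product Kn_const_add ..
    also have "\<dots> \<le> EE n (\<lambda>y. F y * Kn n F y + 3 * \<eta>) x"
    proof (intro EE_mono)
      fix y
      have "\<eta> * (F y + Kn n F y + \<eta>) \<le> \<eta> * 3" using F[of y] KF[of y] \<eta> by (intro mult_left_mono) auto
      then show "(F y + \<eta>) * (Kn n F y + \<eta>) \<le> F y * Kn n F y + 3 * \<eta>" by (simp add: algebra_simps)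
    qed
    also have "\<dots> = EE n (\<lambda>y. F y * Kn n F y) x + 3 * \<eta>" by (simp add: EE_add)
    finally have 1: "c0 - c0 / 8 \<le> EE n (\<lambda>y. F y * Kn n F y) x + 3 * \<eta>" .
    have "EE n (\<lambda>y. F y * Kn n F y) x - sqrt ((1 - (s\<^sup>2)\<^sup>2) / (1 - \<rho>\<^sup>2)) \<le> EE n (\<lambda>y. f y * Kn n f y) x"
      unfolding F_def using f s2 by (intro smoothing_error) auto
    moreover have "sqrt ((1 - (s\<^sup>2)\<^sup>2) / (1 - \<rho>\<^sup>2)) \<le> c0 / 8"
      using j r c0 unfolding s_def[symmetric] by (intro real_le_lsqrt) (auto simp: field_simps)
    ultimately show "c0 / 2 \<le> EE n (\<lambda>y. f y * Kn n f y) x"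
      using 1 c0 unfolding \<eta>_def by linarith
  qed
qed

section \<open>Fixing a coordinate\<close>

lemma restriction_tens:
  assumes "\<And>c. L (\<lambda>_. c) = (\<lambda>_. c)" "kernel_op L" "i \<in> {1..n}"
  shows "tens (\<lambda>_. L) n (\<lambda>y. f (y(i := a))) y = tens ((\<lambda>_. L)(i := (\<lambda>u. u))) n f (y(i := a))"
proof -
  let ?M = "(\<lambda>_. L)(i := (\<lambda>u. u))"
  have k: "kernel_op (?M j)" for j using assms by auto
  have "tens (\<lambda>_. L) n (coord i (\<lambda>u _. u a) f) = tens (?M(i := (\<lambda>u _. u a))) n f"
    by (subst tens_coord) (use assms in \<open>auto intro!: tens_cong simp: kernel_op_const\<close>)
  also have "\<dots> = coord i (\<lambda>u _. u a) (tens ?M n f)"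
    by (subst coord_tens) (use k assms in \<open>auto intro!: tens_cong simp: kernel_op_const\<close>)
  finally show ?thesis by (simp add: coord_const fun_eq_iff)
qed

lemma tens_remove:
  assumes "kernel_op L" "i \<in> {1..n}"
  shows "tens (\<lambda>_. L) n f = coord i L (tens ((\<lambda>_. L)(i := (\<lambda>u. u))) n f)"
  by (subst coord_tens) (use assms in \<open>auto intro!: tens_cong\<close>)

text \<open>Of all starts and steps in coordinate \<open>i\<close> only staying at \<open>a\<close>
  is kept: one factor \<open>p\<close> is for the start, the other for holding, and the discarded
  terms are nonnegative.\<close>

lemma restriction_le:
  assumes f: "\<And>y. 0 \<le> f y" and i: "i \<in> {1..n}" and a: "a \<in> V"
  shows "p\<^sup>2 * EE n (\<lambda>y. f (y(i := a)) * Kn n (\<lambda>y. f (y(i := a))) y) x \<le> EE n (\<lambda>y. f y * Kn n f y) x"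
proof -
  define w where "w = tens ((\<lambda>_. Kv)(i := (\<lambda>u. u))) n f"
  have w0: "0 \<le> w y" for y
  proof -
    have "0 \<le> tens M n f y" if "\<And>j u a. (\<And>b. 0 \<le> u b) \<Longrightarrow> 0 \<le> M j u a" for M
      using f
    proof (induction n arbitrary: f)
      case (Suc n)
      have "0 \<le> coord (Suc n) (M (Suc n)) f y" for y
        unfolding coord_def by (intro that Suc.prems)
      then show ?case using Suc.IH by simp
    qed simp
    then show ?thesis unfolding w_def by this (auto intro!: Kv_nonneg)
  qed
  have "p\<^sup>2 * EE n (\<lambda>y. f (y(i := a)) * Kn n (\<lambda>y. f (y(i := a))) y) x =
      EE n (\<lambda>y. p * (f (y(i := a)) * (p * w (y(i := a))))) x"
    unfolding EE_scale[symmetric] w_def using i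
    by (subst restriction_tens) (auto simp: power2_eq_square ac_simps)
  also have "\<dots> \<le> EE n (\<lambda>y. av (\<lambda>b. f (y(i := b)) * Kv (\<lambda>c. w (y(i := c))) b)) x"
  proof (intro EE_mono)
    fix y
    have "p * w (y(i := a)) \<le> K a a * w (y(i := a))" using K_diag[OF a] w0 by (intro mult_right_mono)
    also have "\<dots> \<le> Kv (\<lambda>c. w (y(i := c))) a"
      unfolding Kv_def using a finite_V w0 K_nonneg by (intro member_le_sum) auto
    finally have "p * (f (y(i := a)) * (p * w (y(i := a)))) \<le> p * (f (y(i := a)) * Kv (\<lambda>c. w (y(i := c))) a)"
      using p_pos f by (intro mult_left_mono) auto
    also have "\<dots> \<le> av (\<lambda>b. f (y(i := b)) * Kv (\<lambda>c. w (y(i := c))) b)"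
      using a f w0 by (intro av_ge_single mult_nonneg_nonneg Kv_nonneg) auto
    finally show "p * (f (y(i := a)) * (p * w (y(i := a)))) \<le> av (\<lambda>b. f (y(i := b)) * Kv (\<lambda>c. w (y(i := c))) b)" .
  qed
  also have "\<dots> = EE n (\<lambda>y. f y * coord i Kv w y) x"
    by (subst (2) EE_absorb_av[OF i, symmetric]) (simp add: coord_def)
  also have "coord i Kv w = Kn n f" unfolding w_def using i by (intro tens_remove[symmetric]) auto
  finally show ?thesis .
qed

text \<open>For \<open>g\<close>, smoothed in all coordinates except \<open>i\<close>, fixing
  \<open>i\<close> retains the full variance in that coordinate, while smoothing retains only the
  share \<open>s^2\<close>. The influence is that share, so the gain dominates
  \<open>1 - s^2\<close> times it.\<close>

lemma energy_increment:
  assumes i: "i \<in> {1..n}" and s: "0 \<le> s" "s \<le> 1"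
  shows "EE n (\<lambda>y. (RR s n f y)\<^sup>2) x + (1 - s\<^sup>2) * EE n (\<lambda>y. (D i (RR s n f) y)\<^sup>2) x \<le>
    av (\<lambda>a. EE n (\<lambda>y. (RR s n (\<lambda>y. f (y(i := a))) y)\<^sup>2) x)"
proof -
  define g where "g = tens ((\<lambda>_. Rv s)(i := (\<lambda>u. u))) n f"
  let ?m = "\<lambda>y. (av (\<lambda>b. g (y(i := b))))\<^sup>2" and ?v = "\<lambda>y. av (\<lambda>b. (Dv (\<lambda>b. g (y(i := b))) b)\<^sup>2)"
  have s2: "s\<^sup>2 \<le> 1" using s by (simp add: power_le_one)
  have Rg: "RR s n f = coord i (Rv s) g" unfolding g_def using i by (intro tens_remove) auto
  have const: "Rv s (\<lambda>_. c) = (\<lambda>_. c)" for c by (auto simp: Rv_def algebra_simps)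
  have "av (\<lambda>a. EE n (\<lambda>y. (RR s n (\<lambda>y. f (y(i := a))) y)\<^sup>2) x) = av (\<lambda>a. EE n (\<lambda>y. (g (y(i := a)))\<^sup>2) x)"
    unfolding g_def using i const by (subst restriction_tens) auto
  also have "\<dots> = EE n (\<lambda>y. av (\<lambda>a. (g (y(i := a)))\<^sup>2)) x"
    by (simp add: av_def EE_sum finite_V EE_scale)
  also have "\<dots> = EE n ?m x + EE n ?v x"
    by (subst av_power2) (rule EE_add)
  finally have 1: "av (\<lambda>a. EE n (\<lambda>y. (RR s n (\<lambda>y. f (y(i := a))) y)\<^sup>2) x) = EE n ?m x + EE n ?v x" .
  have 2: "EE n (\<lambda>y. (RR s n f y)\<^sup>2) x = EE n ?m x + s\<^sup>2 * EE n ?v x"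
  proof -
    have "EE n (\<lambda>y. (RR s n f y)\<^sup>2) x = EE n (\<lambda>y. av (\<lambda>b. (Rv s (\<lambda>b. g (y(i := b))) b)\<^sup>2)) x"
      unfolding Rg by (subst EE_absorb_av[OF i, symmetric]) (simp add: coord_def)
    then show ?thesis unfolding av_power2_Rv EE_add EE_scale .
  qed
  have 3: "EE n (\<lambda>y. (D i (RR s n f) y)\<^sup>2) x = s\<^sup>2 * EE n ?v x"
  proof -
    have "EE n (\<lambda>y. (D i (RR s n f) y)\<^sup>2) x = EE n (\<lambda>y. av (\<lambda>b. s\<^sup>2 * (Dv (\<lambda>b. g (y(i := b))) b)\<^sup>2)) x"
      unfolding Rg by (subst EE_absorb_av[OF i, symmetric]) (simp add: coord_at Dv_Rv, simp add: coord_def power_mult_distrib)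
    then show ?thesis unfolding av_scale EE_scale .
  qed
  have "0 \<le> EE n ?v x" by (intro EE_nonneg av_nonneg) auto
  then have "(1 - s\<^sup>2) * (s\<^sup>2 * EE n ?v x) \<le> (1 - s\<^sup>2) * (1 * EE n ?v x)"
    using s2 by (intro mult_left_mono mult_right_mono) auto
  then show ?thesis unfolding 1 2 3 by (simp add: algebra_simps)
qed

lemma exists_ge_av:
  obtains a where "a \<in> V" "av u \<le> u a"
proof -
  have "\<exists>a\<in>V. av u \<le> u a"
  proof (rule ccontr)
    assume "\<not> (\<exists>a\<in>V. av u \<le> u a)"
    then have less: "u a < av u" if "a \<in> V" for a using that by auto
    have "V \<noteq> {}" using sum_pi by auto
    then have "av u < (\<Sum>a\<in>V. \<pi> a * av u)"
      unfolding av_def[of u] using finite_V less pi_ge p_pos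
      by (intro sum_strict_mono mult_strict_left_mono) (auto simp: av_def intro: less_le_trans)
    also have "\<dots> = av u" by (simp add: sum_pi flip: sum_distrib_right)
    finally show False by simp
  qed
  then show thesis using that by blast
qed

theorem same_set_correlation_bound:
  assumes \<mu>: "0 < \<mu>" "\<mu> \<le> 1"
  shows "\<exists>c>0. \<forall>n f x. (\<forall>y. 0 \<le> f y \<and> f y \<le> 1) \<longrightarrow> \<mu> \<le> EE n f x \<longrightarrow>
      c \<le> EE n (\<lambda>y. f y * Kn n f y) x"
proof -
  have \<mu>2: "0 < \<mu> / 2" "\<mu> / 2 \<le> 1" using \<mu> by auto
  obtain s \<tau> c1 where s: "0 < s" "s < 1" and \<tau>: "\<tau> > 0" and c1: "c1 > 0"
    and low: "\<And>n f x. (\<And>y. 0 \<le> f y \<and> f y \<le> 1) \<Longrightarrow> \<mu> / 2 \<le> EE n f x \<Longrightarrow>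
      (\<And>i. i \<in> {1..n} \<Longrightarrow> EE n (\<lambda>y. (D i (RR s n f) y)\<^sup>2) x \<le> \<tau>) \<Longrightarrow>
      c1 \<le> EE n (\<lambda>y. f y * Kn n f y) x"
    using low_influence_bound[OF \<mu>2] by blast
  \<comment> \<open>Some value of the fixed coordinate raises this combination by
    \<open>\<delta>\<close>, though perhaps not the mean itself. As the energy is at most 1,
    \<open>\<Psi> \<ge> \<mu>\<close> still forces a mean of at least \<open>\<mu> / 2\<close>, and
    \<open>\<Psi> \<le> 1 + \<mu> / 2\<close> limits the number of restrictions.\<close>
  define \<Psi> where "\<Psi> n f x = EE n f x + \<mu> / 2 * EE n (\<lambda>y. (RR s n f y)\<^sup>2) x" for n f x
  define \<delta> where "\<delta> = \<mu> / 2 * ((1 - s\<^sup>2) * \<tau>)"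
  have s2: "s\<^sup>2 < 1" using s by (simp add: power_less_one_iff)
  have \<delta>: "\<delta> > 0" using \<mu> s2 \<tau> by (simp add: \<delta>_def)
  have p1: "p \<le> 1"
  proof -
    obtain a where "a \<in> V" using exists_ge_av by blast
    then have "p * 1 \<le> av (\<lambda>_. 1)" by (intro av_ge_single) auto
    then show ?thesis by simp
  qed
  have energy_le: "EE n (\<lambda>y. (RR s n f y)\<^sup>2) x \<le> 1" if "\<And>y. 0 \<le> f y \<and> f y \<le> 1" for n f x
  proof (intro EE_le_1)
    fix y
    have "0 \<le> RR s n f y \<and> RR s n f y \<le> 1" using that s by (intro tens_range Rv_range) auto
    then show "(RR s n f y)\<^sup>2 \<le> 1" by (simp add: power_le_one)
  qed
  \<comment> \<open>\<open>m\<close> counts the restrictions still possible: for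
    \<open>m = 0\<close> the last assumption contradicts the upper bound on
    \<open>\<Psi>\<close>.\<close>
  have main: "(p\<^sup>2) ^ m * c1 \<le> EE n (\<lambda>y. f y * Kn n f y) x"
    if "\<And>y. 0 \<le> f y \<and> f y \<le> 1" "\<mu> \<le> \<Psi> n f x" "1 + \<mu> / 2 < \<Psi> n f x + real m * \<delta>" for m n f x
    using that
  proof (induction m arbitrary: f)
    case 0
    have "\<mu> / 2 * EE n (\<lambda>y. (RR s n f y)\<^sup>2) x \<le> \<mu> / 2 * 1"
      using \<mu> 0 by (intro mult_left_mono energy_le) auto
    moreover have "EE n f x \<le> 1" using 0 by (intro EE_le_1) auto
    ultimately show ?case using 0 by (simp add: \<Psi>_def)
  next
    case (Suc m)
    show ?case
    proof (cases "\<forall>i\<in>{1..n}. EE n (\<lambda>y. (D i (RR s n f) y)\<^sup>2) x \<le> \<tau>")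
      case True
      have "\<mu> / 2 * EE n (\<lambda>y. (RR s n f y)\<^sup>2) x \<le> \<mu> / 2 * 1"
        using \<mu> Suc.prems by (intro mult_left_mono energy_le) auto
      then have "\<mu> / 2 \<le> EE n f x" using Suc.prems(2) by (simp add: \<Psi>_def)
      then have "c1 \<le> EE n (\<lambda>y. f y * Kn n f y) x" using Suc.prems(1) True by (intro low) auto
      moreover have "(p\<^sup>2) ^ Suc m * c1 \<le> 1 * c1"
        using c1 p1 p_pos by (intro mult_right_mono power_le_one) auto
      ultimately show ?thesis by simp
    next
      case False
      then obtain i where i: "i \<in> {1..n}" "\<tau> < EE n (\<lambda>y. (D i (RR s n f) y)\<^sup>2) x" by force
      let ?f = "\<lambda>a y. f (y(i := a))"
      have "(1 - s\<^sup>2) * \<tau> \<le> (1 - s\<^sup>2) * EE n (\<lambda>y. (D i (RR s n f) y)\<^sup>2) x"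
        using s2 i by (intro mult_left_mono) auto
      then have "EE n (\<lambda>y. (RR s n f y)\<^sup>2) x + (1 - s\<^sup>2) * \<tau> \<le> av (\<lambda>a. EE n (\<lambda>y. (RR s n (?f a) y)\<^sup>2) x)"
        using energy_increment[OF i(1), of s f x] s by linarith
      then have "\<mu> / 2 * (EE n (\<lambda>y. (RR s n f y)\<^sup>2) x + (1 - s\<^sup>2) * \<tau>) \<le>
          \<mu> / 2 * av (\<lambda>a. EE n (\<lambda>y. (RR s n (?f a) y)\<^sup>2) x)"
        using \<mu> by (intro mult_left_mono) auto
      moreover have "av (\<lambda>a. EE n (?f a) x) = EE n f x"
      proof -
        have "av (\<lambda>a. EE n (?f a) x) = EE n (\<lambda>y. av (\<lambda>a. f (y(i := a)))) x"
          by (simp add: av_def EE_sum finite_V EE_scale)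
        then show ?thesis by (simp add: EE_absorb_av[OF i(1)])
      qed
      ultimately have inc: "\<Psi> n f x + \<delta> \<le> av (\<lambda>a. \<Psi> n (?f a) x)"
        unfolding \<Psi>_def \<delta>_def av_add av_scale by (simp add: algebra_simps)
      obtain a where a: "a \<in> V" "av (\<lambda>a. \<Psi> n (?f a) x) \<le> \<Psi> n (?f a) x"
        by (rule exists_ge_av)
      have "(p\<^sup>2) ^ m * c1 \<le> EE n (\<lambda>y. ?f a y * Kn n (?f a) y) x"
      proof (rule Suc.IH)
        show "0 \<le> ?f a y \<and> ?f a y \<le> 1" for y by (rule Suc.prems)
        show "\<mu> \<le> \<Psi> n (?f a) x" using Suc.prems(2) a(2) inc \<delta> by linarith
        have "real (Suc m) * \<delta> = real m * \<delta> + \<delta>" by (simp add: algebra_simps)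
        then show "1 + \<mu> / 2 < \<Psi> n (?f a) x + real m * \<delta>" using Suc.prems(3) a(2) inc by linarith
      qed
      then have "p\<^sup>2 * ((p\<^sup>2) ^ m * c1) \<le> p\<^sup>2 * EE n (\<lambda>y. ?f a y * Kn n (?f a) y) x"
        by (intro mult_left_mono) auto
      also have "\<dots> \<le> EE n (\<lambda>y. f y * Kn n f y) x"
        using Suc.prems a i by (intro restriction_le) auto
      finally show ?thesis by simp
    qed
  qed
  obtain m where "(1 + \<mu> / 2) / \<delta> < real m" using reals_Archimedean2 by blast
  then have m: "1 + \<mu> / 2 < real m * \<delta>" using \<delta> by (simp add: field_simps)
  show ?thesis
  proof (intro exI[of _ "(p\<^sup>2) ^ m * c1"] conjI allI impI)
    show "(p\<^sup>2) ^ m * c1 > 0" using p_pos c1 by simp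
    fix n f x assume f: "\<forall>y. 0 \<le> f y \<and> f y \<le> 1" and mean: "\<mu> \<le> EE n f x"
    have "0 \<le> EE n (\<lambda>y. (RR s n f y)\<^sup>2) x" by (intro EE_nonneg) auto
    then have "\<mu> \<le> \<Psi> n f x" using mean \<mu> by (simp add: \<Psi>_def add_increasing2)
    then show "(p\<^sup>2) ^ m * c1 \<le> EE n (\<lambda>y. f y * Kn n f y) x"
      using m \<mu> f by (intro main) auto
  qed
qed

end

section \<open>Circulations and lazy cyclic shifts\<close>

lemma sum_cyclic_shift: "(\<Sum>k<N. g ((k + 1) mod N)) = (\<Sum>k<N. g k)"
  for g :: "nat \<Rightarrow> 'b::comm_monoid_add"
proof (cases N)
  case (Suc m)
  have "(\<Sum>k<Suc m. g ((k + 1) mod Suc m)) = (\<Sum>k<m. g (Suc k)) + g 0"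
    by simp
  also have "\<dots> = (\<Sum>k<Suc m. g k)"
    by (subst sum.lessThan_Suc_shift) (simp add: add.commute)
  finally show ?thesis using Suc by simp
qed simp

text \<open>The law of a uniformly chosen edge of the closed walk
  \<open>w 0, ..., w (N - 1), w 0\<close>, counted with multiplicity.\<close>

definition flow :: "nat \<Rightarrow> (nat \<Rightarrow> 'a) \<Rightarrow> 'a \<Rightarrow> 'a \<Rightarrow> real" where
  "flow N w x y = (\<Sum>k<N. of_bool (w k = x \<and> w ((k + 1) mod N) = y)) / N"

lemma flow_nonneg: "0 \<le> flow N w x y"
  by (simp add: flow_def sum_nonneg)

lemma sum_flow_right:
  assumes "finite \<Omega>" "\<And>k. w k \<in> \<Omega>"
  shows "(\<Sum>y\<in>\<Omega>. flow N w x y) = (\<Sum>k<N. of_bool (w k = x)) / N"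
proof -
  have "(\<Sum>y\<in>\<Omega>. of_bool (w k = x \<and> w ((k + 1) mod N) = y)) = (of_bool (w k = x) :: real)" for k
    using assms by (cases "w k = x") (simp_all add: of_bool_def)
  then show ?thesis
    unfolding flow_def sum_divide_distrib[symmetric] by (subst sum.swap) simp
qed

lemma sum_flow_left:
  assumes "finite \<Omega>" "\<And>k. w k \<in> \<Omega>"
  shows "(\<Sum>x\<in>\<Omega>. flow N w x y) = (\<Sum>k<N. of_bool (w k = y)) / N"
proof -
  have *: "(\<Sum>x\<in>\<Omega>. of_bool (w k = x \<and> w ((k + 1) mod N) = y)) = (of_bool (w ((k + 1) mod N) = y) :: real)" for k
    using assms by (cases "w ((k + 1) mod N) = y") (simp_all add: of_bool_def)
  show ?thesis
    unfolding flow_def sum_divide_distrib[symmetric] sum.swap[of _ _ \<Omega>] *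
    by (simp only: sum_cyclic_shift[of "\<lambda>k. of_bool (w k = y)" N])
qed

text \<open>By pigeonhole the orbit contains a cycle of some length \<open>d\<close> at most
  \<open>card S\<close>; as \<open>d\<close> divides \<open>N\<close>, running round it repeatedly
  closes after \<open>N\<close> steps. The common length \<open>N\<close> makes all walks images of
  one cyclic group.\<close>

lemma exists_closed_walk:
  assumes "finite S" "x \<in> S" "\<And>x. x \<in> S \<Longrightarrow> s x \<in> S"
    and N: "\<And>d. 1 \<le> d \<Longrightarrow> d \<le> card S \<Longrightarrow> d dvd N"
  obtains y where "y \<in> S" "(s ^^ N) y = y"
proof -
  have in_S: "(s ^^ k) x \<in> S" for k
    using assms by (induction k) auto
  have "\<not> inj_on (\<lambda>k. (s ^^ k) x) {..card S}"
  proof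
    assume "inj_on (\<lambda>k. (s ^^ k) x) {..card S}"
    then have "card {..card S} \<le> card S"
      using in_S assms(1) by (intro card_inj_on_le) auto
    then show False by simp
  qed
  then obtain i j where "i \<in> {..card S}" "j \<in> {..card S}" "(s ^^ i) x = (s ^^ j) x" "i \<noteq> j"
    unfolding inj_on_def by blast
  then obtain i j where ij: "i < j" "j \<le> card S" "(s ^^ i) x = (s ^^ j) x"
    by (cases "i < j") (metis atMost_iff, metis atMost_iff linorder_neqE_nat)
  define d y where "d = j - i" and "y = (s ^^ i) x"
  have "(s ^^ d) y = (s ^^ (d + i)) x" by (simp add: y_def funpow_add)
  also have "d + i = j" using ij by (simp add: d_def)
  finally have "(s ^^ d) y = y" using ij by (simp add: y_def)
  then have *: "(s ^^ (d * m)) y = y" for m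
    by (induction m) (auto simp: funpow_add)
  have "d dvd N" using ij by (intro N) (auto simp: d_def)
  then obtain m where "N = d * m" by (elim dvdE)
  then show thesis using that[of y] in_S * by (auto simp: y_def)
qed

text \<open>
  Following a positive edge out of each vertex leads to a closed walk; subtracting the largest
  possible multiple of its flow removes an edge from the support.
\<close>

lemma circulation_decomposition:
  fixes c :: "'a \<Rightarrow> 'a \<Rightarrow> real"
  assumes "finite \<Omega>" "N > 0" and N: "\<And>d. 1 \<le> d \<Longrightarrow> d \<le> card \<Omega> \<Longrightarrow> d dvd N"
    and "\<And>x y. x \<in> \<Omega> \<Longrightarrow> y \<in> \<Omega> \<Longrightarrow> 0 \<le> c x y"
    and "\<And>x. x \<in> \<Omega> \<Longrightarrow> (\<Sum>y\<in>\<Omega>. c x y) = (\<Sum>y\<in>\<Omega>. c y x)"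
  shows "\<exists>W \<zeta>. finite W \<and> (\<forall>w\<in>W. 0 \<le> \<zeta> w \<and> (\<forall>k. w k \<in> \<Omega>)) \<and>
    (\<forall>x\<in>\<Omega>. \<forall>y\<in>\<Omega>. c x y = (\<Sum>w\<in>W. \<zeta> w * flow N w x y))"
  using assms(4,5)
proof (induction "card {(x, y). x \<in> \<Omega> \<and> y \<in> \<Omega> \<and> c x y > 0}" arbitrary: c rule: less_induct)
  case less
  let ?supp = "\<lambda>c :: 'a \<Rightarrow> 'a \<Rightarrow> real. {(x, y). x \<in> \<Omega> \<and> y \<in> \<Omega> \<and> c x y > 0}"
  have fin: "finite (?supp c)" for c
    by (rule finite_subset[of _ "\<Omega> \<times> \<Omega>"]) (use assms in auto)
  show ?case
  proof (cases "?supp c = {}")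
    case True
    have "c x y = 0" if "x \<in> \<Omega>" "y \<in> \<Omega>" for x y
      using less.prems(1)[OF that] True that by (force simp: less_le)
    then show ?thesis by (intro exI[of _ "{}"]) simp
  next
    case False
    define S where "S = {x \<in> \<Omega>. \<exists>y\<in>\<Omega>. c x y > 0}"
    define s where "s x = (SOME y. y \<in> \<Omega> \<and> c x y > 0)" for x
    have s: "s x \<in> \<Omega>" "c x (s x) > 0" if "x \<in> S" for x
      using that someI_ex[of "\<lambda>y. y \<in> \<Omega> \<and> c x y > 0"] unfolding S_def s_def by blast+
    have s_S: "s x \<in> S" if "x \<in> S" for x
    proof -
      have x: "x \<in> \<Omega>" using that by (simp add: S_def)
      \<comment> \<open>The edge into \<open>s x\<close> makes its inflow positive, and inflow
        equals outflow.\<close>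
      have "c x (s x) \<le> (\<Sum>y\<in>\<Omega>. c y (s x))"
        using assms(1) x s[OF that] less.prems(1) by (intro member_le_sum[of x \<Omega> "\<lambda>y. c y (s x)"]) auto
      then have "(\<Sum>y\<in>\<Omega>. c (s x) y) > 0"
        using s[OF that] less.prems(2)[of "s x"] by linarith
      then have "\<exists>y\<in>\<Omega>. c (s x) y > 0"
        by (rule contrapos_pp) (auto simp: not_less intro: sum_nonpos)
      then show ?thesis using s[OF that] by (simp add: S_def)
    qed
    have S\<Omega>: "finite S" "S \<subseteq> \<Omega>" using assms(1) by (auto simp: S_def)
    then have "card S \<le> card \<Omega>" using assms(1) by (intro card_mono)
    obtain x0 where "x0 \<in> S" using False by (auto simp: S_def)
    then obtain y where y: "y \<in> S" "(s ^^ N) y = y"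
      using exists_closed_walk[of S x0 s N] S\<Omega> s_S N \<open>card S \<le> card \<Omega>\<close> by (metis le_trans)
    define w where "w k = (s ^^ k) y" for k
    have w_S: "w k \<in> S" for k using y s_S by (induction k) (auto simp: w_def)
    have w_\<Omega>: "w k \<in> \<Omega>" for k using w_S S\<Omega> by auto
    have w_next: "w ((k + 1) mod N) = s (w k)" if "k < N" for k
      using that y by (cases "k + 1 = N") (auto simp: w_def simp flip: funpow_swap1)
    have flow_pos: "flow N w (w k) (s (w k)) > 0" if "k < N" for k
    proof -
      have "0 < (\<Sum>i<N. of_bool (w i = w k \<and> w ((i + 1) mod N) = s (w k)) :: real)"
        using that w_next[OF that] by (intro sum_pos2[of _ k]) auto
      then show ?thesis using that by (simp add: flow_def)
    qed
    have flow_0: "flow N w x z = 0" if "\<And>k. k < N \<Longrightarrow> \<not> (x = w k \<and> z = s (w k))" for x z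
      unfolding flow_def using that w_next by (auto intro!: sum.neutral)
    define R where "R k = c (w k) (s (w k)) / flow N w (w k) (s (w k))" for k
    define t where "t = Min (R ` {..<N})"
    have t_le: "t \<le> R k" if "k < N" for k using that by (auto simp: t_def)
    obtain k0 where k0: "k0 < N" "t = R k0"
      using Min_in[of "R ` {..<N}"] \<open>N > 0\<close> by (fastforce simp: t_def)
    have t0: "t \<ge> 0"
      unfolding k0(2) R_def using s(2)[OF w_S[of k0]] flow_nonneg[of N w] by (intro divide_nonneg_nonneg) auto
    define c' where "c' x z = c x z - t * flow N w x z" for x z
    have c'_nonneg: "0 \<le> c' x z" if "x \<in> \<Omega>" "z \<in> \<Omega>" for x z
    proof (cases "\<exists>k<N. x = w k \<and> z = s (w k)")
      case True
      then obtain k where "k < N" "x = w k" "z = s (w k)" by blast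
      then show ?thesis using t_le[of k] flow_pos[of k] by (simp add: c'_def R_def field_simps)
    next
      case False
      then show ?thesis using less.prems(1)[OF that] flow_0[of x z] by (auto simp: c'_def)
    qed
    have c'_k0: "c' (w k0) (s (w k0)) = 0"
      using flow_pos[OF k0(1)] unfolding c'_def k0(2) R_def by simp
    have "?supp c' \<subset> ?supp c"
    proof
      show "?supp c' \<subseteq> ?supp c"
      proof -
        have "0 \<le> t * flow N w x z" for x z using t0 flow_nonneg by (intro mult_nonneg_nonneg)
        then have "c' x z > 0 \<Longrightarrow> c x z > 0" for x z using le_less_trans[of 0 "t * flow N w x z" "c x z"] by (simp add: c'_def)
        then show ?thesis by blast
      qed
      show "?supp c' \<noteq> ?supp c"
      proof -
        have "(w k0, s (w k0)) \<in> ?supp c" "(w k0, s (w k0)) \<notin> ?supp c'"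
          using c'_k0 s[OF w_S[of k0]] w_\<Omega>[of k0] by auto
        then show ?thesis by metis
      qed
    qed
    then have "card (?supp c') < card (?supp c)" by (intro psubset_card_mono fin)
    then have "\<exists>W \<zeta>. finite W \<and> (\<forall>w\<in>W. 0 \<le> \<zeta> w \<and> (\<forall>k. w k \<in> \<Omega>)) \<and>
        (\<forall>x\<in>\<Omega>. \<forall>y\<in>\<Omega>. c' x y = (\<Sum>w\<in>W. \<zeta> w * flow N w x y))"
    proof (rule less.hyps)
      show "(\<Sum>y\<in>\<Omega>. c' x y) = (\<Sum>y\<in>\<Omega>. c' y x)" if "x \<in> \<Omega>" for x
        using less.prems(2)[OF that] sum_flow_left[of \<Omega> w N x] sum_flow_right[of \<Omega> w N x] assms(1) w_\<Omega>
        by (simp add: c'_def sum_subtractf flip: sum_distrib_left)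
    qed (use c'_nonneg in auto)
    then obtain W \<zeta> where W': "finite W" "\<forall>w\<in>W. 0 \<le> \<zeta> w \<and> (\<forall>k. w k \<in> \<Omega>)"
      "\<forall>x\<in>\<Omega>. \<forall>y\<in>\<Omega>. c' x y = (\<Sum>w\<in>W. \<zeta> w * flow N w x y)"
      by (elim exE conjE)
    note W = W'(1) W'(2)[rule_format] W'(3)[rule_format]
    \<comment> \<open>The new walk may already occur in \<open>W\<close>, so its weight is added
      rather than assigned.\<close>
    define \<zeta>' where "\<zeta>' v = (if v \<in> W then \<zeta> v else 0) + (if v = w then t else 0)" for v
    have "c x z = (\<Sum>v\<in>insert w W. \<zeta>' v * flow N v x z)" if "x \<in> \<Omega>" "z \<in> \<Omega>" for x z
    proof -
      have "(\<Sum>v\<in>insert w W. \<zeta>' v * flow N v x z) =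
          (\<Sum>v\<in>insert w W. (if v \<in> W then \<zeta> v * flow N v x z else 0)) +
          (\<Sum>v\<in>insert w W. (if v = w then t * flow N w x z else 0))"
        unfolding \<zeta>'_def sum.distrib[symmetric] by (intro sum.cong) (auto simp: algebra_simps)
      also have "(\<Sum>v\<in>insert w W. (if v \<in> W then \<zeta> v * flow N v x z else 0)) = c' x z"
        unfolding W(3)[OF that] using W(1) by (intro sum.mono_neutral_cong_right) auto
      also have "(\<Sum>v\<in>insert w W. (if v = w then t * flow N w x z else 0)) = t * flow N w x z"
        using W(1) by simp
      finally show ?thesis by (simp add: c'_def)
    qed
    then show ?thesis
      using W t0 w_\<Omega> by (intro exI[of _ "insert w W"] exI[of _ \<zeta>']) (auto simp: \<zeta>'_def)
  qed
qed

text \<open>Every difference \<open>u a - u b\<close> is at most the total variation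
  \<open>T\<close> around the cycle; mean zero turns this into a bound on \<open>u a\<close> itself,
  and Cauchy-Schwarz compares \<open>T^2\<close> with the squared increments.\<close>

lemma cyclic_Poincare:
  fixes u :: "nat \<Rightarrow> real"
  assumes "(\<Sum>k<N. u k) = 0"
  shows "(\<Sum>k<N. (u k)\<^sup>2) \<le> (real N)\<^sup>2 * (\<Sum>k<N. (u k - u ((k + 1) mod N))\<^sup>2)"
proof -
  let ?d = "\<lambda>k. \<bar>u k - u ((k + 1) mod N)\<bar>"
  define T where "T = (\<Sum>k<N. ?d k)"
  have le: "\<bar>u a - u b\<bar> \<le> T" if "a \<le> b" "b < N" for a b
  proof -
    have "u a - u b = (\<Sum>k\<in>{a..<b}. u k - u (Suc k))"
      using sum_Suc_diff'[of a b "\<lambda>k. - u k"] that(1) by simp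
    also have "\<bar>\<dots>\<bar> \<le> (\<Sum>k\<in>{a..<b}. \<bar>u k - u (Suc k)\<bar>)" by (rule sum_abs)
    also have "\<dots> = (\<Sum>k\<in>{a..<b}. ?d k)" using that by (intro sum.cong) auto
    also have "\<dots> \<le> T" unfolding T_def using that by (intro sum_mono2) auto
    finally show ?thesis .
  qed
  then have le: "\<bar>u a - u b\<bar> \<le> T" if "a < N" "b < N" for a b
    using that le[of a b] le[of b a] by (cases "a \<le> b") (auto simp: abs_minus_commute)
  have u_le: "\<bar>u a\<bar> \<le> T" if "a < N" for a
  proof -
    have "real N * u a = (\<Sum>b<N. u a - u b)" using assms by (simp add: sum_subtractf)
    then have "real N * \<bar>u a\<bar> = \<bar>\<Sum>b<N. u a - u b\<bar>" by (simp add: abs_mult flip: \<open>real N * u a = _\<close>)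
    also have "\<dots> \<le> (\<Sum>b<N. \<bar>u a - u b\<bar>)" by (rule sum_abs)
    also have "\<dots> \<le> (\<Sum>b<N. T)" using le that by (intro sum_mono) auto
    finally show ?thesis using that by simp
  qed
  have "(\<Sum>k<N. (u k)\<^sup>2) \<le> (\<Sum>k<N. T\<^sup>2)"
  proof (intro sum_mono)
    fix k assume "k \<in> {..<N}"
    then have "\<bar>u k\<bar>\<^sup>2 \<le> T\<^sup>2" using u_le by (intro power_mono) auto
    then show "(u k)\<^sup>2 \<le> T\<^sup>2" by simp
  qed
  also have "\<dots> = N * T\<^sup>2" by simp
  also have "T\<^sup>2 \<le> (\<Sum>k<N. 1\<^sup>2) * (\<Sum>k<N. (?d k)\<^sup>2)"
    unfolding T_def using Cauchy_Schwarz_ineq_sum[of "\<lambda>_. 1" ?d "{..<N}"] by simp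
  finally show ?thesis by (simp add: power2_eq_square mult.assoc mult_left_mono)
qed

text \<open>The square of the weighted mean falls short of the mean of the squares by
  \<open>\<beta> * (1 - \<beta>)\<close> times the squared increment. The shift preserves the sum of
  squares, and the Poincare inequality bounds the increments from below.\<close>

lemma lazy_shift_contraction:
  fixes u :: "nat \<Rightarrow> real" and \<beta> :: real
  assumes "(\<Sum>k<N. u k) = 0" "0 \<le> \<beta>" "\<beta> \<le> 1"
  shows "(\<Sum>k<N. (\<beta> * u k + (1 - \<beta>) * u ((k + 1) mod N))\<^sup>2) \<le>
    (1 - \<beta> * (1 - \<beta>) / (real N)\<^sup>2) * (\<Sum>k<N. (u k)\<^sup>2)"
proof (cases "N = 0")
  case False
  let ?E = "\<Sum>k<N. (u k - u ((k + 1) mod N))\<^sup>2"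
  have "(\<Sum>k<N. (\<beta> * u k + (1 - \<beta>) * u ((k + 1) mod N))\<^sup>2) =
      (\<Sum>k<N. \<beta> * (u k)\<^sup>2 + (1 - \<beta>) * (u ((k + 1) mod N))\<^sup>2 - \<beta> * (1 - \<beta>) * (u k - u ((k + 1) mod N))\<^sup>2)"
    by (intro sum.cong refl) algebra
  also have "\<dots> = \<beta> * (\<Sum>k<N. (u k)\<^sup>2) + (1 - \<beta>) * (\<Sum>k<N. (u ((k + 1) mod N))\<^sup>2) - \<beta> * (1 - \<beta>) * ?E"
    by (simp only: sum.distrib sum_subtractf sum_distrib_left)
  also have "(\<Sum>k<N. (u ((k + 1) mod N))\<^sup>2) = (\<Sum>k<N. (u k)\<^sup>2)"
    by (rule sum_cyclic_shift)
  finally have eq: "(\<Sum>k<N. (\<beta> * u k + (1 - \<beta>) * u ((k + 1) mod N))\<^sup>2) = (\<Sum>k<N. (u k)\<^sup>2) - \<beta> * (1 - \<beta>) * ?E"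
    by (simp add: algebra_simps)
  have "(\<Sum>k<N. (u k)\<^sup>2) / (real N)\<^sup>2 \<le> ?E"
    using cyclic_Poincare[OF assms(1)] False by (simp add: field_simps)
  then have "\<beta> * (1 - \<beta>) * ((\<Sum>k<N. (u k)\<^sup>2) / (real N)\<^sup>2) \<le> \<beta> * (1 - \<beta>) * ?E"
    using assms by (intro mult_left_mono) auto
  then show ?thesis unfolding eq by (simp add: algebra_simps)
qed simp

section \<open>Correlated pairs as mixtures of lazy shifts\<close>

lemma finite_set_Pi_pmf:
  assumes "finite A" "\<And>x. x \<in> A \<Longrightarrow> finite (set_pmf (p x))"
  shows "finite (set_pmf (Pi_pmf A d p))"
  by (rule finite_subset[OF set_Pi_pmf_subset']) (use assms in auto)

lemma expectation_bind_finite: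
  fixes h :: "'b \<Rightarrow> real"
  assumes "finite (set_pmf p)" "\<And>x. x \<in> set_pmf p \<Longrightarrow> finite (set_pmf (f x))"
  shows "measure_pmf.expectation (p \<bind> f) h = measure_pmf.expectation p (\<lambda>x. measure_pmf.expectation (f x) h)"
proof -
  have "measure_pmf.expectation (p \<bind> f) h = (\<Sum>a\<in>set_pmf p. pmf p a *\<^sub>R measure_pmf.expectation (f a) h)"
    by (rule pmf_expectation_bind) (use assms in auto)
  also have "\<dots> = measure_pmf.expectation p (\<lambda>x. measure_pmf.expectation (f x) h)"
    by (rule integral_measure_pmf[symmetric]) (use assms in auto)
  finally show ?thesis .
qed

lemma expectation_mono_finite:
  fixes f g :: "'a \<Rightarrow> real"
  assumes "finite (set_pmf p)" "\<And>x. x \<in> set_pmf p \<Longrightarrow> f x \<le> g x"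
  shows "measure_pmf.expectation p f \<le> measure_pmf.expectation p g"
  by (intro integral_mono_AE integrable_measure_pmf_finite) (use assms in \<open>auto simp: AE_measure_pmf_iff\<close>)

context contractive_kernel
begin

text \<open>Inserting the last index into the product law matches one unfolding of
  \<open>PP\<close>. The defaults \<open>d1\<close> and \<open>d2\<close> fill the coordinates
  outside \<open>1..n\<close> and become the base points.\<close>

lemma expectation_pairs:
  fixes Q :: "('v \<times> 'v) pmf"
  assumes Q: "set_pmf Q \<subseteq> V \<times> V" "\<And>a b. a \<in> V \<Longrightarrow> b \<in> V \<Longrightarrow> pmf Q (a, b) = \<pi> a * K a b"
  shows "measure_pmf.expectation (Pi_pmf {1..n} (d1, d2) (\<lambda>_. Q)) (\<lambda>X. h (\<lambda>i. fst (X i)) (\<lambda>i. snd (X i))) =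
    PP n h (\<lambda>_. d1) (\<lambda>_. d2)"
proof (induction n arbitrary: h)
  case (Suc n)
  let ?P = "Pi_pmf {1..n} (d1, d2) (\<lambda>_. Q)"
  let ?h = "\<lambda>q x y. h (x(Suc n := fst q)) (y(Suc n := snd q))"
  have finQ: "finite (set_pmf Q)" by (rule finite_subset[OF Q(1)]) (simp add: finite_V)
  have finP: "finite (set_pmf ?P)" by (rule finite_set_Pi_pmf) (use finQ in auto)
  have upd: "(\<lambda>i. g (if i = Suc n then q else X i)) = (\<lambda>i. g (X i))(Suc n := g q)"
    for g :: "'v \<times> 'v \<Rightarrow> 'v" and X :: "nat \<Rightarrow> 'v \<times> 'v" and q by auto
  have "Pi_pmf {1..Suc n} (d1, d2) (\<lambda>_. Q) = Q \<bind> (\<lambda>q. map_pmf (\<lambda>X. X(Suc n := q)) ?P)"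
    by (simp add: atLeastAtMostSuc_conv Pi_pmf_insert' map_pmf_def)
  then have "measure_pmf.expectation (Pi_pmf {1..Suc n} (d1, d2) (\<lambda>_. Q)) (\<lambda>X. h (\<lambda>i. fst (X i)) (\<lambda>i. snd (X i))) =
      measure_pmf.expectation Q (\<lambda>q. measure_pmf.expectation ?P (\<lambda>X. ?h q (\<lambda>i. fst (X i)) (\<lambda>i. snd (X i))))"
    by (simp add: expectation_bind_finite finQ finP upd[of fst] upd[of snd] del: One_nat_def)
  also have "\<dots> = measure_pmf.expectation Q (\<lambda>q. PP n (?h q) (\<lambda>_. d1) (\<lambda>_. d2))"
    by (intro Bochner_Integration.integral_cong refl Suc.IH)
  also have "\<dots> = (\<Sum>q\<in>V \<times> V. pmf Q q * PP n (?h q) (\<lambda>_. d1) (\<lambda>_. d2))"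
    using Q finite_V by (subst integral_measure_pmf[of "V \<times> V"]) auto
  also have "\<dots> = (\<Sum>a\<in>V. \<pi> a * (\<Sum>b\<in>V. K a b * PP n (?h (a, b)) (\<lambda>_. d1) (\<lambda>_. d2)))"
    using Q by (simp add: sum.cartesian_product' sum_distrib_left mult.assoc)
  also have "\<dots> = PP (Suc n) h (\<lambda>_. d1) (\<lambda>_. d2)"
    by (simp add: av_def Kv_def PP_sum finite_V PP_scale)
  finally show ?case .
qed simp

lemma expectation_pairs_bound:
  fixes Q :: "('v \<times> 'v) pmf" and \<mu> :: real
  assumes Q: "set_pmf Q \<subseteq> V \<times> V" "\<And>a b. a \<in> V \<Longrightarrow> b \<in> V \<Longrightarrow> pmf Q (a, b) = \<pi> a * K a b"
    and \<mu>: "0 < \<mu>" "\<mu> \<le> 1"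
  shows "\<exists>c>0. \<forall>(n :: nat) f. (\<forall>y. 0 \<le> f y \<and> f y \<le> 1) \<longrightarrow>
    \<mu> \<le> measure_pmf.expectation (Pi_pmf {1..n} (d, d) (\<lambda>_. Q)) (\<lambda>X. f (\<lambda>i. fst (X i))) \<longrightarrow>
    c \<le> measure_pmf.expectation (Pi_pmf {1..n} (d, d) (\<lambda>_. Q)) (\<lambda>X. f (\<lambda>i. fst (X i)) * f (\<lambda>i. snd (X i)))"
proof -
  obtain c where c: "c > 0" "\<forall>n f x. (\<forall>y. 0 \<le> f y \<and> f y \<le> 1) \<longrightarrow> \<mu> \<le> EE n f x \<longrightarrow>
      c \<le> EE n (\<lambda>y. f y * Kn n f y) x"
    using same_set_correlation_bound[OF \<mu>] by (elim exE conjE)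
  have mean: "measure_pmf.expectation (Pi_pmf {1..n} (d, d) (\<lambda>_. Q)) (\<lambda>X. f (\<lambda>i. fst (X i))) = EE n f (\<lambda>_. d)"
    for n f
    using expectation_pairs[OF Q, of n d d "\<lambda>x y. f x"] by (simp only: PP_fst)
  have corr: "measure_pmf.expectation (Pi_pmf {1..n} (d, d) (\<lambda>_. Q)) (\<lambda>X. f (\<lambda>i. fst (X i)) * f (\<lambda>i. snd (X i))) =
      EE n (\<lambda>y. f y * Kn n f y) (\<lambda>_. d)" for n f
    using expectation_pairs[OF Q, of n d d "\<lambda>x y. f x * f y"] by (simp only: PP_product)
  show ?thesis
  proof (intro exI[of _ c] conjI allI impI)
    show "c > 0" by (rule c)
    fix n and f :: "(nat \<Rightarrow> 'v) \<Rightarrow> real"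
    assume "\<forall>y. 0 \<le> f y \<and> f y \<le> 1"
      "\<mu> \<le> measure_pmf.expectation (Pi_pmf {1..n} (d, d) (\<lambda>_. Q)) (\<lambda>X. f (\<lambda>i. fst (X i)))"
    then show "c \<le> measure_pmf.expectation (Pi_pmf {1..n} (d, d) (\<lambda>_. Q)) (\<lambda>X. f (\<lambda>i. fst (X i)) * f (\<lambda>i. snd (X i)))"
      unfolding mean[of n f] corr[of n f] by (intro c(2)[rule_format]) simp_all
  qed
qed

end

section \<open>The lazy cyclic shift as a law on pairs\<close>

definition lazy_shift_pmf :: "nat \<Rightarrow> real \<Rightarrow> (nat \<times> nat) pmf" where
  "lazy_shift_pmf N \<beta> = pmf_of_set {..<N} \<bind> (\<lambda>k. bernoulli_pmf \<beta> \<bind>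
    (\<lambda>stay. return_pmf (k, if stay then k else (k + 1) mod N)))"

lemma set_lazy_shift_pmf:
  assumes "N > 0"
  shows "set_pmf (lazy_shift_pmf N \<beta>) \<subseteq> {..<N} \<times> {..<N}"
proof -
  have "set_pmf (pmf_of_set {..<N}) = {..<N}"
    using assms by (intro set_pmf_of_set) auto
  then show ?thesis
    unfolding lazy_shift_pmf_def set_bind_pmf set_return_pmf by (simp add: assms UN_subset_iff)
qed

lemma pmf_map_lazy_shift:
  assumes "N > 0" "0 \<le> \<beta>" "\<beta> \<le> 1"
  shows "pmf (map_pmf (map_prod w w) (lazy_shift_pmf N \<beta>)) (x, y) =
    \<beta> * ((\<Sum>k<N. of_bool (w k = x \<and> w k = y)) / N) + (1 - \<beta>) * flow N w x y"
proof -
  have eq: "map_pmf (map_prod w w) (lazy_shift_pmf N \<beta>) = pmf_of_set {..<N} \<bind> (\<lambda>k. bernoulli_pmf \<beta> \<bind>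
    (\<lambda>stay. return_pmf (w k, w (if stay then k else (k + 1) mod N))))"
    by (simp add: lazy_shift_pmf_def map_bind_pmf)
  have step: "pmf (bernoulli_pmf \<beta> \<bind> (\<lambda>stay. return_pmf (w k, w (if stay then k else (k + 1) mod N)))) (x, y) =
      \<beta> * of_bool (w k = x \<and> w k = y) + (1 - \<beta>) * of_bool (w k = x \<and> w ((k + 1) mod N) = y)" for k
    using assms by (simp add: pmf_bind indicator_def of_bool_def)
  have ne: "{..<N} \<noteq> {}" using assms by auto
  have "pmf (map_pmf (map_prod w w) (lazy_shift_pmf N \<beta>)) (x, y) =
      (\<Sum>k<N. \<beta> * of_bool (w k = x \<and> w k = y) + (1 - \<beta>) * of_bool (w k = x \<and> w ((k + 1) mod N) = y)) / N"
    unfolding eq by (simp only: pmf_bind_pmf_of_set[OF ne finite_lessThan] step card_lessThan)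
  then show ?thesis
    by (simp only: flow_def sum.distrib sum_distrib_left[symmetric] add_divide_distrib times_divide_eq_right)
qed

text \<open>Writing \<open>a mod N\<close> for the holding state makes the rows sum to 1 also for
  \<open>a \<ge> N\<close>, as the locale asks at all points.\<close>

definition lazy_shift_kernel :: "nat \<Rightarrow> real \<Rightarrow> nat \<Rightarrow> nat \<Rightarrow> real" where
  "lazy_shift_kernel N \<beta> a b = \<beta> * of_bool (b = a mod N) + (1 - \<beta>) * of_bool (b = (a + 1) mod N)"

lemma pmf_lazy_shift:
  assumes "N > 0" "0 \<le> \<beta>" "\<beta> \<le> 1" "a < N"
  shows "pmf (lazy_shift_pmf N \<beta>) (a, b) = 1 / N * lazy_shift_kernel N \<beta> a b"
proof -
  have at_a: "(\<Sum>k<N. of_bool (k = a \<and> P k)) = (of_bool (P a) :: real)" for P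
  proof -
    have "(\<Sum>k<N. of_bool (k = a \<and> P k)) = (\<Sum>k<N. if k = a then of_bool (P a) else (0 :: real))"
      by (intro sum.cong) auto
    then show ?thesis using assms(4) by simp
  qed
  have "pmf (lazy_shift_pmf N \<beta>) (a, b) =
      \<beta> * ((\<Sum>k<N. of_bool (k = a \<and> k = b)) / N) + (1 - \<beta>) * flow N (\<lambda>k. k) a b"
    using pmf_map_lazy_shift[OF assms(1-3), of "\<lambda>k. k" a b] by (simp only: map_prod_ident pmf.map_ident)
  also have "\<dots> = \<beta> * (of_bool (a = b) / N) + (1 - \<beta>) * (of_bool ((a + 1) mod N = b) / N)"
    unfolding flow_def at_a ..
  also have "\<dots> = 1 / N * lazy_shift_kernel N \<beta> a b"
    using assms(4) by (auto simp: lazy_shift_kernel_def add_divide_distrib)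
  finally show ?thesis .
qed

lemma contractive_lazy_shift:
  assumes N: "N > 0" and \<beta>: "0 < \<beta>" "\<beta> < 1"
  shows "contractive_kernel {..<N} (\<lambda>_. 1 / N) (lazy_shift_kernel N \<beta>) (min \<beta> (1 / N))
    (sqrt (1 - \<beta> * (1 - \<beta>) / (real N)\<^sup>2))"
proof
  let ?e = "\<beta> * (1 - \<beta>) / (real N)\<^sup>2"
  have sum_K: "(\<Sum>b<N. lazy_shift_kernel N \<beta> a b * u b) = \<beta> * u (a mod N) + (1 - \<beta>) * u ((a + 1) mod N)"
    for a and u :: "nat \<Rightarrow> real"
    using N by (simp add: lazy_shift_kernel_def distrib_right sum.distrib mult.assoc flip: sum_distrib_left)
  have "\<beta> * (1 - \<beta>) < 1" using mult_strict_mono[of \<beta> 1 "1 - \<beta>" 1] \<beta> by simp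
  moreover have "1 \<le> (real N)\<^sup>2" using N by simp
  ultimately have "\<beta> * (1 - \<beta>) < (real N)\<^sup>2" by linarith
  then have e: "?e < 1" "0 < ?e" using N \<beta> by (auto simp: field_simps)
  show "0 < sqrt (1 - ?e)" "sqrt (1 - ?e) < 1" using e by auto
  show "(\<Sum>b<N. lazy_shift_kernel N \<beta> a b) = 1" for a using sum_K[of a "\<lambda>_. 1"] by simp
  show "(\<Sum>a<N. 1 / N * lazy_shift_kernel N \<beta> a b) = 1 / N" if "b \<in> {..<N}" for b
  proof -
    have "(\<Sum>a<N. lazy_shift_kernel N \<beta> a b) =
        \<beta> * (\<Sum>a<N. of_bool (b = a mod N)) + (1 - \<beta>) * (\<Sum>a<N. of_bool (b = (a + 1) mod N))"
      unfolding lazy_shift_kernel_def by (simp only: sum.distrib sum_distrib_left)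
    also have "(\<Sum>a<N. of_bool (b = a mod N)) = (\<Sum>a<N. of_bool (b = a) :: real)"
      by (intro sum.cong) auto
    also have "(\<Sum>a<N. of_bool (b = (a + 1) mod N)) = (\<Sum>a<N. of_bool (b = a) :: real)"
      by (rule sum_cyclic_shift)
    also have "(\<Sum>a<N. of_bool (b = a) :: real) = 1" using that by (simp add: of_bool_def)
    finally show ?thesis unfolding sum_distrib_left[symmetric] by simp
  qed
  show "(\<Sum>a<N. 1 / N * (\<Sum>b<N. lazy_shift_kernel N \<beta> a b * u b)\<^sup>2) \<le>
      (sqrt (1 - ?e))\<^sup>2 * (\<Sum>b<N. 1 / N * (u b)\<^sup>2)" if "(\<Sum>b<N. 1 / N * u b) = 0" for u
  proof -
    have "(\<Sum>b<N. u b) = 0" using that N by (simp flip: sum_divide_distrib)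
    then have "(\<Sum>k<N. (\<beta> * u k + (1 - \<beta>) * u ((k + 1) mod N))\<^sup>2) \<le> (1 - ?e) * (\<Sum>k<N. (u k)\<^sup>2)"
      using \<beta> by (intro lazy_shift_contraction) auto
    then have "(\<Sum>k<N. (\<beta> * u (k mod N) + (1 - \<beta>) * u ((k + 1) mod N))\<^sup>2) / N \<le> (1 - ?e) * (\<Sum>k<N. (u k)\<^sup>2) / N"
      by (intro divide_right_mono) auto
    then show ?thesis unfolding sum_K using e by (simp flip: sum_divide_distrib)
  qed
qed (use N \<beta> in \<open>auto simp: lazy_shift_kernel_def\<close>)

lemma lazy_shift_bound:
  fixes \<mu> :: real
  assumes "N > 0" "0 < \<beta>" "\<beta> < 1" "0 < \<mu>" "\<mu> \<le> 1"
  shows "\<exists>c>0. \<forall>(n :: nat) f. (\<forall>y. 0 \<le> f y \<and> f y \<le> 1) \<longrightarrow>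
    \<mu> \<le> measure_pmf.expectation (Pi_pmf {1..n} (0, 0) (\<lambda>_. lazy_shift_pmf N \<beta>)) (\<lambda>X. f (\<lambda>i. fst (X i))) \<longrightarrow>
    c \<le> measure_pmf.expectation (Pi_pmf {1..n} (0, 0) (\<lambda>_. lazy_shift_pmf N \<beta>))
      (\<lambda>X. f (\<lambda>i. fst (X i)) * f (\<lambda>i. snd (X i)))"
proof -
  interpret contractive_kernel "{..<N}" "\<lambda>_. 1 / N" "lazy_shift_kernel N \<beta>" "min \<beta> (1 / N)"
    "sqrt (1 - \<beta> * (1 - \<beta>) / (real N)\<^sup>2)"
    by (rule contractive_lazy_shift) (use assms in auto)
  show ?thesis
  proof (rule expectation_pairs_bound[OF set_lazy_shift_pmf])
    show "pmf (lazy_shift_pmf N \<beta>) (a, b) = 1 / N * lazy_shift_kernel N \<beta> a b" if "a \<in> {..<N}" for a b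
      using assms that by (intro pmf_lazy_shift) auto
  qed (use assms in auto)
qed

lemma pmf_map_fst_finite:
  assumes "set_pmf Q \<subseteq> \<Omega> \<times> \<Omega>" "finite \<Omega>"
  shows "pmf (map_pmf fst Q) x = (\<Sum>y\<in>\<Omega>. pmf Q (x, y))"
proof -
  have "(fst -` {x}) \<inter> set_pmf Q = (Pair x ` \<Omega>) \<inter> set_pmf Q" using assms by auto
  then have "measure (measure_pmf Q) (fst -` {x}) = measure (measure_pmf Q) (Pair x ` \<Omega>)"
    using measure_Int_set_pmf[of Q "(fst -` {x})"] measure_Int_set_pmf[of Q "(Pair x ` \<Omega>)"] by simp
  also have "\<dots> = (\<Sum>y\<in>\<Omega>. pmf Q (x, y))"
    using assms by (simp add: measure_measure_pmf_finite sum.reindex inj_on_def)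
  finally show ?thesis by (simp add: pmf_map)
qed

lemma pmf_map_snd_finite:
  assumes "set_pmf Q \<subseteq> \<Omega> \<times> \<Omega>" "finite \<Omega>"
  shows "pmf (map_pmf snd Q) y = (\<Sum>x\<in>\<Omega>. pmf Q (x, y))"
proof -
  have "(snd -` {y}) \<inter> set_pmf Q = ((\<lambda>x. (x, y)) ` \<Omega>) \<inter> set_pmf Q" using assms by auto
  then have "measure (measure_pmf Q) (snd -` {y}) = measure (measure_pmf Q) ((\<lambda>x. (x, y)) ` \<Omega>)"
    using measure_Int_set_pmf[of Q "(snd -` {y})"] measure_Int_set_pmf[of Q "((\<lambda>x. (x, y)) ` \<Omega>)"] by simp
  also have "\<dots> = (\<Sum>x\<in>\<Omega>. pmf Q (x, y))"
    using assms by (simp add: measure_measure_pmf_finite sum.reindex inj_on_def)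
  finally show ?thesis by (simp add: pmf_map)
qed

text \<open>
  Removing from \<open>Q\<close> a \<open>\<beta>\<close> share of its marginal placed on the diagonal leaves a circulation;
  its flow decomposition, with the laziness put back, is the mixture.
\<close>

lemma lazy_pair_mixture:
  fixes Q :: "('a \<times> 'a) pmf"
  assumes fin: "finite \<Omega>" and Q: "set_pmf Q \<subseteq> \<Omega> \<times> \<Omega>" "map_pmf fst Q = map_pmf snd Q"
    and \<beta>: "0 < \<beta>" "\<beta> < 1" "\<And>x. x \<in> \<Omega> \<Longrightarrow> \<beta> \<le> pmf Q (x, x)"
    and N: "N > 0" "\<And>d. 1 \<le> d \<Longrightarrow> d \<le> card \<Omega> \<Longrightarrow> d dvd N"
  obtains Z where "finite (set_pmf Z)" "\<And>w k. w \<in> set_pmf Z \<Longrightarrow> w k \<in> \<Omega>"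
    "Q = Z \<bind> (\<lambda>w. map_pmf (map_prod w w) (lazy_shift_pmf N \<beta>))"
proof -
  define m where "m x = pmf (map_pmf fst Q) x" for x
  have m1: "m x = (\<Sum>y\<in>\<Omega>. pmf Q (x, y))" and m2: "m x = (\<Sum>y\<in>\<Omega>. pmf Q (y, x))" for x
    unfolding m_def using pmf_map_fst_finite[OF Q(1) fin] pmf_map_snd_finite[OF Q(1) fin] Q(2) by simp_all
  have sum_m: "(\<Sum>x\<in>\<Omega>. m x) = 1"
    unfolding m_def using fin Q(1) by (intro sum_pmf_eq_1) auto
  \<comment> \<open>Dividing by \<open>1 - \<beta>\<close> restores the marginal \<open>m\<close>.
    On the diagonal \<open>c\<close> is nonnegative because \<open>m x \<le> 1\<close>.\<close>
  define c where "c x y = (pmf Q (x, y) - \<beta> * (of_bool (x = y) * m x)) / (1 - \<beta>)" for x y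
  have delta1: "(\<Sum>y\<in>\<Omega>. of_bool (x = y) * m x) = m x" and delta2: "(\<Sum>y\<in>\<Omega>. of_bool (y = x) * m y) = m x"
    if "x \<in> \<Omega>" for x using that fin by (simp_all add: of_bool_def if_distrib[of "\<lambda>t. t * _"] cong: if_cong)
  have row: "(\<Sum>y\<in>\<Omega>. c x y) = m x" and col: "(\<Sum>y\<in>\<Omega>. c y x) = m x" if "x \<in> \<Omega>" for x
    unfolding c_def sum_divide_distrib[symmetric] sum_subtractf sum_distrib_left[symmetric]
      delta1[OF that] delta2[OF that] using m1[of x] m2[of x] \<beta> by (simp_all add: field_simps)
  have c0: "0 \<le> c x y" if "x \<in> \<Omega>" "y \<in> \<Omega>" for x y
  proof -
    have "\<beta> * m x \<le> \<beta> * 1" unfolding m_def using \<beta> pmf_le_1 by (intro mult_left_mono) auto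
    then have "\<beta> * m x \<le> pmf Q (x, x)" using \<beta>(3)[OF that(1)] by simp
    then show ?thesis using \<beta> by (auto simp: c_def)
  qed
  have "\<exists>W \<zeta>. finite W \<and> (\<forall>w\<in>W. 0 \<le> \<zeta> w \<and> (\<forall>k. w k \<in> \<Omega>)) \<and>
      (\<forall>x\<in>\<Omega>. \<forall>y\<in>\<Omega>. c x y = (\<Sum>w\<in>W. \<zeta> w * flow N w x y))"
    using row col by (intro circulation_decomposition fin N c0) auto
  then obtain W \<zeta> where W': "finite W" "\<forall>w\<in>W. 0 \<le> \<zeta> w \<and> (\<forall>k. w k \<in> \<Omega>)"
    "\<forall>x\<in>\<Omega>. \<forall>y\<in>\<Omega>. c x y = (\<Sum>w\<in>W. \<zeta> w * flow N w x y)"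
    by (elim exE conjE)
  note W = W'(1) W'(2)[rule_format] W'(3)[rule_format]
  have visits: "(\<Sum>x\<in>\<Omega>. \<Sum>y\<in>\<Omega>. flow N w x y) = 1" if "w \<in> W" for w
  proof -
    have "(\<Sum>x\<in>\<Omega>. of_bool (w k = x)) = (1 :: real)" for k
      using W(2)[OF that] fin by (simp add: of_bool_def)
    then have "(\<Sum>x\<in>\<Omega>. \<Sum>k<N. of_bool (w k = x)) = real N" by (subst sum.swap) simp
    then show ?thesis
      using W(2)[OF that] fin N(1) by (simp only: sum_flow_right) (simp flip: sum_divide_distrib)
  qed
  have "1 = (\<Sum>x\<in>\<Omega>. \<Sum>y\<in>\<Omega>. c x y)" using row sum_m by simp
  also have "\<dots> = (\<Sum>x\<in>\<Omega>. \<Sum>y\<in>\<Omega>. \<Sum>w\<in>W. \<zeta> w * flow N w x y)" using W(3) by simp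
  also have "\<dots> = (\<Sum>w\<in>W. \<zeta> w * (\<Sum>x\<in>\<Omega>. \<Sum>y\<in>\<Omega>. flow N w x y))"
    by (simp add: sum_distrib_left sum.swap[of _ W])
  also have "\<dots> = (\<Sum>w\<in>W. \<zeta> w)" using visits by simp
  finally have sum_\<zeta>: "(\<Sum>w\<in>W. \<zeta> w) = 1" by simp
  define \<zeta>' where "\<zeta>' w = (if w \<in> W then \<zeta> w else 0)" for w
  have \<zeta>'0: "0 \<le> \<zeta>' w" for w using W(2) by (simp add: \<zeta>'_def)
  have "(\<integral>\<^sup>+w. ennreal (\<zeta>' w) \<partial>count_space UNIV) = (\<Sum>w\<in>W. ennreal (\<zeta>' w))"
    using W(1) by (intro nn_integral_count_space') (auto simp: \<zeta>'_def)
  also have "\<dots> = ennreal (\<Sum>w\<in>W. \<zeta>' w)" using \<zeta>'0 by (intro sum_ennreal) auto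
  also have "(\<Sum>w\<in>W. \<zeta>' w) = 1" using sum_\<zeta> by (simp add: \<zeta>'_def)
  finally have total: "(\<integral>\<^sup>+w. ennreal (\<zeta>' w) \<partial>count_space UNIV) = 1" by simp
  define Z where "Z = embed_pmf \<zeta>'"
  have pmf_Z: "pmf Z w = \<zeta>' w" for w unfolding Z_def using \<zeta>'0 total by (rule pmf_embed_pmf)
  have set_Z: "set_pmf Z \<subseteq> W" by (auto simp: set_pmf_eq pmf_Z \<zeta>'_def split: if_splits)
  let ?R = "\<lambda>w. map_pmf (map_prod w w) (lazy_shift_pmf N \<beta>)"
  \<comment> \<open>A walk leaves \<open>x\<close> as often as it visits \<open>x\<close>, so the
    lazy part is expressed by the outgoing flow and reassembles \<open>m\<close> after
    mixing.\<close>
  have R: "pmf (?R w) (x, y) = \<beta> * (of_bool (x = y) * (\<Sum>z\<in>\<Omega>. flow N w x z)) + (1 - \<beta>) * flow N w x y"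
    if "w \<in> W" for w x y
  proof -
    have "(\<Sum>k<N. of_bool (w k = x \<and> w k = y)) / N = of_bool (x = y) * ((\<Sum>k<N. of_bool (w k = x)) / real N)"
      by (cases "x = y") auto
    then show ?thesis
      using W(2)[OF that] fin N(1) \<beta> by (simp only: pmf_map_lazy_shift sum_flow_right less_imp_le)
  qed
  have pmf_mix: "pmf (Z \<bind> ?R) (x, y) = pmf Q (x, y)" for x y
  proof -
    have "pmf (Z \<bind> ?R) (x, y) = (\<Sum>w\<in>W. \<zeta>' w * pmf (?R w) (x, y))"
      unfolding pmf_bind using set_Z W(1) by (subst integral_measure_pmf[of W]) (auto simp: pmf_Z)
    also have "\<dots> = (\<Sum>w\<in>W. \<beta> * (of_bool (x = y) * (\<Sum>z\<in>\<Omega>. \<zeta> w * flow N w x z)) + (1 - \<beta>) * (\<zeta> w * flow N w x y))"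
      by (intro sum.cong refl) (simp add: R \<zeta>'_def sum_distrib_left[symmetric] algebra_simps)
    also have "\<dots> = \<beta> * (of_bool (x = y) * (\<Sum>z\<in>\<Omega>. \<Sum>w\<in>W. \<zeta> w * flow N w x z)) +
        (1 - \<beta>) * (\<Sum>w\<in>W. \<zeta> w * flow N w x y)"
      by (simp only: sum.swap[of "\<lambda>z w. \<zeta> w * flow N w x z" W \<Omega>] sum.distrib sum_distrib_left[symmetric])
    finally have eq: "pmf (Z \<bind> ?R) (x, y) = \<dots>" .
    show ?thesis
    proof (cases "x \<in> \<Omega> \<and> y \<in> \<Omega>")
      case True
      then have "(\<Sum>z\<in>\<Omega>. \<Sum>w\<in>W. \<zeta> w * flow N w x z) = m x" using W(3) row[of x] by simp
      then show ?thesis using True \<beta> unfolding eq by (simp add: W(3)[symmetric] c_def)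
    next
      case False
      have "pmf (?R w) (x, y) = 0" if "w \<in> W" for w
      proof -
        have z: "(w k = x \<and> w k' = y) = False" for k k' using W(2)[OF that] False by auto
        show ?thesis using N(1) \<beta> by (simp add: pmf_map_lazy_shift flow_def z)
      qed
      then have "pmf (Z \<bind> ?R) (x, y) = 0"
        unfolding pmf_bind using set_Z W(1) by (subst integral_measure_pmf[of W]) auto
      moreover have "pmf Q (x, y) = 0" using False Q(1) by (auto simp: pmf_eq_0_set_pmf)
      ultimately show ?thesis by simp
    qed
  qed
  show thesis
  proof (rule that[of Z])
    show "finite (set_pmf Z)" using set_Z W(1) by (rule finite_subset)
    show "w k \<in> \<Omega>" if "w \<in> set_pmf Z" for w k using that set_Z W(2) by auto
    show "Q = Z \<bind> ?R" by (rule pmf_eqI) (simp add: pmf_mix[symmetric] split_paired_all)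
  qed
qed

section \<open>Markov chains\<close>

text \<open>Independent walks, one per coordinate, are drawn before the shifts; given them,
  \<open>f\<close> becomes a function \<open>g z\<close> on a power of the cyclic group.
  \<open>N\<close> and \<open>\<beta>\<close> depend on \<open>\<alpha>\<close> only, which makes
  the constant uniform in \<open>\<Omega>\<close>.\<close>

lemma two_step_bound:
  fixes \<alpha> \<mu> :: real
  assumes "0 < \<alpha>" "0 < \<mu>"
  shows "\<exists>c>0. \<forall>(\<Omega> :: 'a set) Q d (n :: nat) f. finite \<Omega> \<longrightarrow> set_pmf Q \<subseteq> \<Omega> \<times> \<Omega> \<longrightarrow>
    map_pmf fst Q = map_pmf snd Q \<longrightarrow> (\<forall>x\<in>\<Omega>. \<alpha> \<le> pmf Q (x, x)) \<longrightarrow>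
    f \<in> ({1..n} \<rightarrow>\<^sub>E \<Omega>) \<rightarrow> {0..1} \<longrightarrow>
    \<mu> \<le> measure_pmf.expectation (Pi_pmf {1..n} d (\<lambda>_. Q)) (\<lambda>X. f (\<lambda>i\<in>{1..n}. fst (X i))) \<longrightarrow>
    c \<le> measure_pmf.expectation (Pi_pmf {1..n} d (\<lambda>_. Q))
      (\<lambda>X. f (\<lambda>i\<in>{1..n}. fst (X i)) * f (\<lambda>i\<in>{1..n}. snd (X i)))"
proof -
  \<comment> \<open>The shift requires \<open>\<beta> < 1\<close>, whereas
    \<open>\<alpha> = 1\<close> is possible for a single state.\<close>
  define \<beta> where "\<beta> = min \<alpha> (1 / 2)"
  have \<beta>: "0 < \<beta>" "\<beta> < 1" "\<beta> \<le> \<alpha>" using assms by (auto simp: \<beta>_def)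
  \<comment> \<open>The diagonal masses sum to at most 1, so there are at most
    \<open>1 / \<beta>\<close> states, and the factorial is divisible by every possible cycle
    length.\<close>
  define N :: nat where "N = fact (nat \<lfloor>1 / \<beta>\<rfloor>)"
  have N: "N > 0" by (simp add: N_def)
  \<comment> \<open>Half of the mean is reserved for walks with small conditional mean; the minimum
    ensures \<open>\<mu>' \<le> 1\<close>.\<close>
  define \<mu>' where "\<mu>' = min \<mu> 1 / 2"
  have \<mu>': "0 < \<mu>'" "\<mu>' \<le> 1" "2 * \<mu>' \<le> \<mu>" using assms by (auto simp: \<mu>'_def)
  let ?U = "\<lambda>n. Pi_pmf {1..n} (0, 0) (\<lambda>_. lazy_shift_pmf N \<beta>)"
  obtain c where c: "c > 0" "\<forall>(n :: nat) f. (\<forall>y. 0 \<le> f y \<and> f y \<le> 1) \<longrightarrow>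
    \<mu>' \<le> measure_pmf.expectation (?U n) (\<lambda>X. f (\<lambda>i. fst (X i))) \<longrightarrow>
    c \<le> measure_pmf.expectation (?U n) (\<lambda>X. f (\<lambda>i. fst (X i)) * f (\<lambda>i. snd (X i)))"
    using lazy_shift_bound[OF N \<beta>(1,2) \<mu>'(1,2)] by (elim exE conjE)
  show ?thesis
  proof (intro exI[of _ "c * \<mu>'"] conjI allI impI)
    show "c * \<mu>' > 0" using c \<mu>' by simp
    fix \<Omega> :: "'a set" and Q d and n :: nat and f
    assume fin: "finite \<Omega>" and Q: "set_pmf Q \<subseteq> \<Omega> \<times> \<Omega>" "map_pmf fst Q = map_pmf snd Q"
      and diag: "\<forall>x\<in>\<Omega>. \<alpha> \<le> pmf Q (x, x)" and f: "f \<in> ({1..n} \<rightarrow>\<^sub>E \<Omega>) \<rightarrow> {0..1}"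
      and mean: "\<mu> \<le> measure_pmf.expectation (Pi_pmf {1..n} d (\<lambda>_. Q)) (\<lambda>X. f (\<lambda>i\<in>{1..n}. fst (X i)))"
    have diag: "\<beta> \<le> pmf Q (x, x)" if "x \<in> \<Omega>" for x using diag that \<beta> by force
    have "real (card \<Omega>) * \<beta> = (\<Sum>x\<in>\<Omega>. \<beta>)" by simp
    also have "\<dots> \<le> (\<Sum>x\<in>\<Omega>. pmf Q (x, x))" by (intro sum_mono diag)
    also have "\<dots> = measure (measure_pmf Q) ((\<lambda>x. (x, x)) ` \<Omega>)"
      using fin by (simp add: measure_measure_pmf_finite sum.reindex inj_on_def)
    also have "\<dots> \<le> 1" by simp
    finally have "real (card \<Omega>) \<le> 1 / \<beta>" using \<beta> by (simp add: field_simps)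
    then have "int (card \<Omega>) \<le> \<lfloor>1 / \<beta>\<rfloor>" by (simp add: le_floor_iff)
    then have dvd: "d dvd N" if "1 \<le> d" "d \<le> card \<Omega>" for d
      using that unfolding N_def by (intro dvd_fact) auto
    obtain Z where Z: "finite (set_pmf Z)" "\<And>w k. w \<in> set_pmf Z \<Longrightarrow> w k \<in> \<Omega>"
      "Q = Z \<bind> (\<lambda>w. map_pmf (map_prod w w) (lazy_shift_pmf N \<beta>))"
    proof (rule lazy_pair_mixture[OF fin Q \<beta>(1,2) _ N])
      show "\<beta> \<le> pmf Q (x, x)" if "x \<in> \<Omega>" for x by (rule diag[OF that])
      show "d dvd N" if "1 \<le> d" "d \<le> card \<Omega>" for d by (rule dvd[OF that])
    qed blast
    let ?Z = "Pi_pmf {1..n} undefined (\<lambda>_. Z)"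
    define lift where "lift z u i = (if i \<in> {1..n} then map_prod (z i) (z i) (u i) else d)"
      for z :: "nat \<Rightarrow> nat \<Rightarrow> 'a" and u i
    have lift: "Pi_pmf {1..n} d (\<lambda>i. map_pmf (map_prod (z i) (z i)) (lazy_shift_pmf N \<beta>)) = map_pmf (lift z) (?U n)"
      for z :: "nat \<Rightarrow> nat \<Rightarrow> 'a"
      unfolding map_pmf_def
      by (subst Pi_pmf_bind[where d' = "(0, 0)"]) (auto simp: lift_def[abs_def])
    have mix: "Pi_pmf {1..n} d (\<lambda>_. Q) = ?Z \<bind> (\<lambda>z. map_pmf (lift z) (?U n))"
      unfolding Z(3) lift[symmetric] by (rule Pi_pmf_bind) simp
    have finU: "finite (set_pmf (?U n))"
      using finite_subset[OF set_lazy_shift_pmf[OF N, of \<beta>]] by (intro finite_set_Pi_pmf) auto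
    have finZ: "finite (set_pmf ?Z)" by (intro finite_set_Pi_pmf Z) auto
    define g where "g z y = f (\<lambda>i\<in>{1..n}. z i (y i))" for z :: "nat \<Rightarrow> nat \<Rightarrow> 'a" and y
    have g: "0 \<le> g z y \<and> g z y \<le> 1" if "z \<in> set_pmf ?Z" for z y
    proof -
      have "z i \<in> set_pmf Z" if "i \<in> {1..n}" for i
        using \<open>z \<in> set_pmf ?Z\<close> that by (auto simp: set_Pi_pmf PiE_dflt_def)
      then have "(\<lambda>i\<in>{1..n}. z i (y i)) \<in> {1..n} \<rightarrow>\<^sub>E \<Omega>" using Z(2) by auto
      then show ?thesis using f by (auto simp: g_def Pi_iff)
    qed
    have "(\<lambda>i\<in>{1..n}. fst (lift z u i)) = (\<lambda>i\<in>{1..n}. z i (fst (u i)))"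
      "(\<lambda>i\<in>{1..n}. snd (lift z u i)) = (\<lambda>i\<in>{1..n}. z i (snd (u i)))" for z u
      by (intro restrict_ext; simp add: lift_def)+
    then have fst_lift: "f (\<lambda>i\<in>{1..n}. fst (lift z u i)) = g z (\<lambda>i. fst (u i))"
      and snd_lift: "f (\<lambda>i\<in>{1..n}. snd (lift z u i)) = g z (\<lambda>i. snd (u i))" for z u
      by (simp_all only: g_def)
    define m where "m z = measure_pmf.expectation (?U n) (\<lambda>u. g z (\<lambda>i. fst (u i)))" for z
    define B where "B z = measure_pmf.expectation (?U n) (\<lambda>u. g z (\<lambda>i. fst (u i)) * g z (\<lambda>i. snd (u i)))" for z
    have m1: "m z \<le> 1" if "z \<in> set_pmf ?Z" for z
      using expectation_mono_finite[OF finU, of "\<lambda>u. g z (\<lambda>i. fst (u i))" "\<lambda>_. 1"] g[OF that] by (simp add: m_def)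
    have B0: "0 \<le> B z" if "z \<in> set_pmf ?Z" for z
      unfolding B_def using g[OF that] by (intro integral_nonneg_AE) (auto simp: AE_measure_pmf_iff)
    \<comment> \<open>A linear bound valid for every \<open>z\<close> can be averaged directly,
      without estimating how likely good walks are: it follows from the bound \<open>c\<close> where
      the mean is large, and its left side is negative elsewhere.\<close>
    have pointwise: "c * (m z - \<mu>') \<le> B z" if "z \<in> set_pmf ?Z" for z
    proof (cases "\<mu>' \<le> m z")
      case True
      then have "c \<le> B z"
        unfolding m_def B_def by (rule c(2)[rule_format, OF g[OF that]])
      moreover have "c * (m z - \<mu>') \<le> c * 1" using c m1[OF that] \<mu>' by (intro mult_left_mono) auto
      ultimately show ?thesis by simp
    next
      case False
      then have "c * (m z - \<mu>') \<le> 0" using c by (intro mult_nonneg_nonpos) auto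
      then show ?thesis using B0[OF that] by simp
    qed
    have "\<mu> \<le> measure_pmf.expectation ?Z m"
      using mean unfolding mix by (simp add: expectation_bind_finite finZ finU fst_lift m_def[abs_def] del: One_nat_def)
    then have "\<mu>' \<le> measure_pmf.expectation ?Z m - \<mu>'" using \<mu>' by simp
    then have "c * \<mu>' \<le> c * (measure_pmf.expectation ?Z m - \<mu>')" using c by (intro mult_left_mono) auto
    also have "\<dots> = measure_pmf.expectation ?Z (\<lambda>z. c * (m z - \<mu>'))"
      by (simp add: integrable_measure_pmf_finite[OF finZ] del: One_nat_def)
    also have "\<dots> \<le> measure_pmf.expectation ?Z B"
      by (intro expectation_mono_finite finZ pointwise)
    also have "\<dots> = measure_pmf.expectation (Pi_pmf {1..n} d (\<lambda>_. Q))
      (\<lambda>X. f (\<lambda>i\<in>{1..n}. fst (X i)) * f (\<lambda>i\<in>{1..n}. snd (X i)))"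
      unfolding mix by (simp add: expectation_bind_finite finZ finU fst_lift snd_lift B_def[abs_def] del: One_nat_def)
    finally show "c * \<mu>' \<le> \<dots>" .
  qed
qed

text \<open>The law of \<open>X (Suc m)\<close> given \<open>X m = x\<close>; it is junk outside the support of \<open>X m\<close>.\<close>

definition transition :: "(nat \<Rightarrow> 'a) pmf \<Rightarrow> nat \<Rightarrow> 'a \<Rightarrow> 'a pmf" where
  "transition P m x = (if x \<in> (\<lambda>X. X m) ` set_pmf P
    then map_pmf (\<lambda>X. X (Suc m)) (cond_pmf P {X. X m = x}) else return_pmf x)"

lemma pmf_transition:
  assumes "X \<in> set_pmf P"
  shows "pmf (transition P m (X m)) y =
    measure (measure_pmf P) {Y. Y m = X m \<and> Y (Suc m) = y} / measure (measure_pmf P) {Y. Y m = X m}"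
proof -
  have ne: "set_pmf P \<inter> {Y. Y m = X m} \<noteq> {}" using assms by auto
  have "pmf (transition P m (X m)) y = measure (cond_pmf P {Y. Y m = X m}) ((\<lambda>Y. Y (Suc m)) -` {y})"
    using assms by (simp add: transition_def pmf_map)
  also have "\<dots> = measure (measure_pmf P) ({Y. Y m = X m} \<inter> ((\<lambda>Y. Y (Suc m)) -` {y})) /
      measure (measure_pmf P) {Y. Y m = X m}"
    by (simp add: cond_pmf.rep_eq[OF ne] measure_uniform_measure emeasure_measure_pmf_not_zero[OF ne])
  also have "{Y. Y m = X m} \<inter> ((\<lambda>Y. Y (Suc m)) -` {y}) = {Y. Y m = X m \<and> Y (Suc m) = y}" by auto
  finally show ?thesis .
qed

text \<open>For a history of positive probability this is the Markov property in product form. Null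
  histories and values outside \<open>\<Omega>\<close>, on which that property is silent, give 0 on
  both sides.\<close>

lemma Markov_decomposition:
  assumes M: "generated_by_Markov_chains \<Omega> l P" and supp: "set_pmf P \<subseteq> {1..l} \<rightarrow>\<^sub>E \<Omega>" and m: "1 \<le> m" "m < l"
  shows "map_pmf (\<lambda>X. (restrict X {1..m}, X (Suc m))) P =
    map_pmf (\<lambda>X. restrict X {1..m}) P \<bind> (\<lambda>H. map_pmf (Pair H) (transition P m (H m)))"
proof (rule pmf_eqI)
  fix q :: "(nat \<Rightarrow> 'a) \<times> 'a"
  obtain H y where q: "q = (H, y)" by force
  let ?P = "measure (measure_pmf P)"
  have lhs: "pmf (map_pmf (\<lambda>X. (restrict X {1..m}, X (Suc m))) P) q = ?P {X. restrict X {1..m} = H \<and> X (Suc m) = y}"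
    unfolding q pmf_map by (rule arg_cong[where f = ?P]) auto
  have eq: "pmf (map_pmf (Pair H') (transition P m (H' m))) (H, y) = of_bool (H' = H) * pmf (transition P m (H m)) y" for H'
  proof (cases "H' = H")
    case True
    then show ?thesis using pmf_map_inj'[of "Pair H" "transition P m (H m)" y] by (simp add: inj_on_def)
  next
    case False
    then show ?thesis by (auto simp: pmf_eq_0_set_pmf)
  qed
  have rhs: "pmf (map_pmf (\<lambda>X. restrict X {1..m}) P \<bind> (\<lambda>H. map_pmf (Pair H) (transition P m (H m)))) q =
      ?P {X. restrict X {1..m} = H} * pmf (transition P m (H m)) y"
  proof -
    have "(\<lambda>X. of_bool (restrict X {1..m} = H) :: real) = indicator {X. restrict X {1..m} = H}"
      by (auto simp: indicator_def)
    then show ?thesis by (simp add: q pmf_bind eq)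
  qed
  show "pmf (map_pmf (\<lambda>X. (restrict X {1..m}, X (Suc m))) P) q =
    pmf (map_pmf (\<lambda>X. restrict X {1..m}) P \<bind> (\<lambda>H. map_pmf (Pair H) (transition P m (H m)))) q"
  proof (cases "\<exists>X\<in>set_pmf P. restrict X {1..m} = H")
    case False
    then have "?P {X. restrict X {1..m} = H} = 0" by (auto simp: measure_pmf_zero_iff)
    moreover have "?P {X. restrict X {1..m} = H \<and> X (Suc m) = y} = 0" using False by (auto simp: measure_pmf_zero_iff)
    ultimately show ?thesis unfolding lhs rhs by simp
  next
    case True
    then obtain X where X: "X \<in> set_pmf P" "restrict X {1..m} = H" by blast
    have Hm: "H m = X m" using X m by auto
    have pos: "?P {X. restrict X {1..m} = H} > 0" using X by (intro measure_pmf_posI[of X]) auto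
    show ?thesis
    proof (cases "y \<in> \<Omega>")
      case y: True
      \<comment> \<open>The Markov property at \<open>j = Suc m\<close> takes history and next value
        as one function; its history range \<open>{1..<Suc m}\<close> is
        \<open>{1..m}\<close>.\<close>
      define x where "x = H(Suc m := y)"
      have x: "x \<in> {1..Suc m} \<rightarrow>\<^sub>E \<Omega>"
      proof (rule PiE_I)
        have X_in: "X i \<in> \<Omega>" if "i \<in> {1..l}" for i
          using PiE_mem[OF subsetD[OF supp X(1)] that] .
        show "x i \<in> \<Omega>" if "i \<in> {1..Suc m}" for i
          using that y m X_in[of i] by (cases "i = Suc m") (simp_all add: x_def X(2)[symmetric])
        show "x i = undefined" if "i \<notin> {1..Suc m}" for i
          using that by (auto simp: x_def X(2)[symmetric])
      qed
      have hist: "(\<forall>i\<in>{1..<Suc m}. Y i = x i) \<longleftrightarrow> restrict Y {1..m} = H" for Y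
        unfolding x_def X(2)[symmetric] by (auto simp: restrict_def fun_eq_iff)
      have "\<forall>x\<in>{1..Suc m} \<rightarrow>\<^sub>E \<Omega>. \<P>(X in measure_pmf P. \<forall>i\<in>{1..<Suc m}. X i = x i) > 0 \<longrightarrow>
          \<P>(X in measure_pmf P. X (Suc m) = x (Suc m) \<bar> \<forall>i\<in>{1..<Suc m}. X i = x i) =
          \<P>(X in measure_pmf P. X (Suc m) = x (Suc m) \<bar> X (Suc m - 1) = x (Suc m - 1))"
        using M unfolding generated_by_Markov_chains_def by (rule bspec) (use m in auto)
      from bspec[OF this x]
      have "\<P>(X in measure_pmf P. X (Suc m) = x (Suc m) \<bar> \<forall>i\<in>{1..<Suc m}. X i = x i) =
          \<P>(X in measure_pmf P. X (Suc m) = x (Suc m) \<bar> X (Suc m - 1) = x (Suc m - 1))"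
        using pos unfolding hist by simp
      then have "?P {Y. Y (Suc m) = y \<and> restrict Y {1..m} = H} / ?P {X. restrict X {1..m} = H} =
          ?P {Y. Y (Suc m) = y \<and> Y m = X m} / ?P {Y. Y m = X m}"
        unfolding cond_prob_def hist using m Hm by (simp add: x_def)
      also have "\<dots> = pmf (transition P m (H m)) y"
        unfolding Hm pmf_transition[OF X(1)] by (simp add: conj_commute)
      finally show ?thesis unfolding lhs rhs using pos by (simp add: field_simps conj_commute)
    next
      case False
      then have "Y (Suc m) \<noteq> y" if "Y \<in> set_pmf P" for Y using that supp m by (fastforce simp: PiE_iff)
      then have 0: "?P {Y. C Y \<and> Y (Suc m) = y} = 0" for C by (auto simp: measure_pmf_zero_iff)
      show ?thesis unfolding lhs rhs Hm pmf_transition[OF X(1)] 0 by simp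
    qed
  qed
qed

definition transition_exp :: "nat \<Rightarrow> (nat \<Rightarrow> 'a) pmf \<Rightarrow> nat \<Rightarrow> ((nat \<Rightarrow> 'a) \<Rightarrow> real) \<Rightarrow> (nat \<Rightarrow> 'a) \<Rightarrow> real" where
  "transition_exp n P m f x =
    measure_pmf.expectation (Pi_pmf {1..n} undefined (\<lambda>i. transition P m (x i))) (\<lambda>y. f (\<lambda>i\<in>{1..n}. y i))"

lemma finite_support_tuples:
  fixes P :: "(nat \<Rightarrow> 'a) pmf"
  assumes "finite \<Omega>" "set_pmf P \<subseteq> {1..l} \<rightarrow>\<^sub>E \<Omega>"
  shows "finite (set_pmf P)"
  by (rule finite_subset[OF assms(2)]) (simp add: finite_PiE assms(1))

lemma set_transition_finite: "finite (set_pmf P) \<Longrightarrow> finite (set_pmf (transition P m x))"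
proof -
  assume fin: "finite (set_pmf P)"
  have "set_pmf P \<inter> {X. X m = x} \<noteq> {}" if "x \<in> (\<lambda>X. X m) ` set_pmf P" using that by auto
  then show ?thesis using fin by (auto simp: transition_def)
qed

lemma set_transition:
  assumes "set_pmf P \<subseteq> {1..l} \<rightarrow>\<^sub>E \<Omega>" "Suc m \<le> l" "x \<in> \<Omega>"
  shows "set_pmf (transition P m x) \<subseteq> \<Omega>"
proof (cases "x \<in> (\<lambda>X. X m) ` set_pmf P")
  case True
  then have "set_pmf P \<inter> {X. X m = x} \<noteq> {}" by auto
  moreover have "X (Suc m) \<in> \<Omega>" if "X \<in> set_pmf P" for X
    using assms that by (auto simp: PiE_iff)
  ultimately show ?thesis using True by (auto simp: transition_def)
next
  case False
  then show ?thesis using assms by (simp add: transition_def)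
qed

lemma set_iid_tuples: "X \<in> set_pmf (iid_tuples n P) \<Longrightarrow> i \<in> {1..n} \<Longrightarrow> X i \<in> set_pmf P"
  by (auto simp: iid_tuples_def set_Pi_pmf PiE_dflt_def)

lemma finite_iid_tuples: "finite (set_pmf P) \<Longrightarrow> finite (set_pmf (iid_tuples n P))"
  unfolding iid_tuples_def by (intro finite_set_Pi_pmf) auto

lemma step_vec_cong: "(\<And>i. i \<in> {1..n} \<Longrightarrow> X i j = Y i j) \<Longrightarrow> step_vec n X j = step_vec n Y j"
  by (auto simp: step_vec_def)

lemma step_vec_in:
  assumes "set_pmf P \<subseteq> {1..l} \<rightarrow>\<^sub>E \<Omega>" "X \<in> set_pmf (iid_tuples n P)" "j \<in> {1..l}"
  shows "step_vec n X j \<in> {1..n} \<rightarrow>\<^sub>E \<Omega>"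
proof -
  have "X i j \<in> \<Omega>" if "i \<in> {1..n}" for i
    using PiE_mem[OF subsetD[OF assms(1) set_iid_tuples[OF assms(2) that]] assms(3)] .
  then show ?thesis by (auto simp: step_vec_def)
qed

text \<open>The decomposition of one tuple passes to the product law: given all histories, the next
  values are independent with laws depending on the present only. \<open>H\<close> may use the whole
  past up to time \<open>m\<close>.\<close>

lemma iid_Markov_step:
  assumes fin: "finite \<Omega>" and M: "generated_by_Markov_chains \<Omega> l P"
    and supp: "set_pmf P \<subseteq> {1..l} \<rightarrow>\<^sub>E \<Omega>" and m: "1 \<le> m" "m < l"
    and H: "\<And>X Y. (\<And>i j. i \<in> {1..n} \<Longrightarrow> j \<in> {1..m} \<Longrightarrow> X i j = Y i j) \<Longrightarrow> H X = H Y"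
  shows "measure_pmf.expectation (iid_tuples n P) (\<lambda>X. H X * f (step_vec n X (Suc m))) =
    measure_pmf.expectation (iid_tuples n P) (\<lambda>X. H X * transition_exp n P m f (step_vec n X m))"
proof -
  let ?A = "{1..n}"
  let ?r = "\<lambda>X :: nat \<Rightarrow> 'a. restrict X {1..m}"
  let ?g = "\<lambda>X :: nat \<Rightarrow> 'a. (?r X, X (Suc m))"
  let ?T = "\<lambda>h :: nat \<Rightarrow> nat \<Rightarrow> 'a. Pi_pmf ?A undefined (\<lambda>i. transition P m (h i m))"
  let ?F = "\<lambda>q :: nat \<Rightarrow> (nat \<Rightarrow> 'a) \<times> 'a. H (\<lambda>i. fst (q i)) * f (\<lambda>i\<in>?A. snd (q i))"
  have finP: "finite (set_pmf P)" by (rule finite_support_tuples[OF fin supp])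
  have finT: "finite (set_pmf (?T h))" for h
    by (intro finite_set_Pi_pmf set_transition_finite finP) auto
  have Hr: "H (\<lambda>i. ?r (X i)) = H X" for X by (rule H) auto
  have comb: "Pi_pmf ?A (?g undefined) (\<lambda>i. map_pmf (Pair (h i)) (transition P m (h i m))) =
      map_pmf (\<lambda>y i. if i \<in> ?A then (h i, y i) else ?g undefined) (?T h)" for h
    unfolding map_pmf_def by (subst Pi_pmf_bind[where d' = undefined]) (simp_all del: One_nat_def)
  \<comment> \<open>Mapping a product law coordinatewise maps its default as well, hence
    \<open>?g undefined\<close>; \<open>H\<close> and \<open>f\<close> see only indices in
    \<open>?A\<close>.\<close>
  have "map_pmf (\<lambda>X. ?g \<circ> X) (iid_tuples n P) = Pi_pmf ?A (?g undefined) (\<lambda>_. map_pmf ?g P)"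
    unfolding iid_tuples_def by (rule Pi_pmf_map[symmetric]) auto
  also have "\<dots> = Pi_pmf ?A (?r undefined) (\<lambda>_. map_pmf ?r P) \<bind>
      (\<lambda>h. Pi_pmf ?A (?g undefined) (\<lambda>i. map_pmf (Pair (h i)) (transition P m (h i m))))"
    unfolding Markov_decomposition[OF M supp m] by (rule Pi_pmf_bind) simp
  also have "Pi_pmf ?A (?r undefined) (\<lambda>_. map_pmf ?r P) = map_pmf (\<lambda>X. ?r \<circ> X) (iid_tuples n P)"
    unfolding iid_tuples_def by (rule Pi_pmf_map) auto
  finally have law: "map_pmf (\<lambda>X. ?g \<circ> X) (iid_tuples n P) = iid_tuples n P \<bind>
      (\<lambda>X. map_pmf (\<lambda>y i. if i \<in> ?A then (?r (X i), y i) else ?g undefined) (?T (\<lambda>i. ?r (X i))))"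
    unfolding comb by (simp only: bind_map_pmf o_def)
  have "measure_pmf.expectation (iid_tuples n P) (\<lambda>X. H X * f (step_vec n X (Suc m))) =
      measure_pmf.expectation (map_pmf (\<lambda>X. ?g \<circ> X) (iid_tuples n P)) ?F"
    by (simp add: Hr step_vec_def del: One_nat_def)
  also have "\<dots> = measure_pmf.expectation (iid_tuples n P) (\<lambda>X.
      measure_pmf.expectation (?T (\<lambda>i. ?r (X i))) (\<lambda>y. ?F (\<lambda>i. if i \<in> ?A then (?r (X i), y i) else ?g undefined)))"
    unfolding law by (subst expectation_bind_finite) (simp_all only: set_map_pmf integral_map_pmf finite_iid_tuples finP
        finite_imageI[OF finT[of "\<lambda>i. ?r (X i)" for X]])
  also have "\<dots> = measure_pmf.expectation (iid_tuples n P) (\<lambda>X. H X * transition_exp n P m f (step_vec n X m))"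
  proof (rule Bochner_Integration.integral_cong[OF refl])
    fix X
    have "?F (\<lambda>i. if i \<in> ?A then (?r (X i), y i) else ?g undefined) = H X * f (\<lambda>i\<in>?A. y i)" for y
    proof -
      have "H (\<lambda>i. fst (if i \<in> ?A then (?r (X i), y i) else ?g undefined)) = H X" by (rule H) auto
      moreover have "(\<lambda>i\<in>?A. snd (if i \<in> ?A then (?r (X i), y i) else ?g undefined)) = (\<lambda>i\<in>?A. y i)" by auto
      ultimately show ?thesis by (simp only:)
    qed
    moreover have "?T (\<lambda>i. ?r (X i)) = Pi_pmf ?A undefined (\<lambda>i. transition P m (step_vec n X m i))"
      using m by (intro Pi_pmf_cong) (auto simp: step_vec_def)
    ultimately show "measure_pmf.expectation (?T (\<lambda>i. ?r (X i)))
        (\<lambda>y. ?F (\<lambda>i. if i \<in> ?A then (?r (X i), y i) else ?g undefined)) =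
      H X * transition_exp n P m f (step_vec n X m)"
      by (simp add: transition_exp_def)
  qed
  finally show ?thesis .
qed

lemma transition_exp_range:
  assumes fin: "finite \<Omega>" and supp: "set_pmf P \<subseteq> {1..l} \<rightarrow>\<^sub>E \<Omega>" and m: "Suc m \<le> l"
    and f: "f \<in> ({1..n} \<rightarrow>\<^sub>E \<Omega>) \<rightarrow> {0..1}" and x: "x \<in> {1..n} \<rightarrow>\<^sub>E \<Omega>"
  shows "0 \<le> transition_exp n P m f x \<and> transition_exp n P m f x \<le> 1"
proof -
  let ?p = "Pi_pmf {1..n} undefined (\<lambda>i. transition P m (x i))"
  have "finite (set_pmf ?p)"
    by (intro finite_set_Pi_pmf set_transition_finite finite_support_tuples[OF fin supp]) auto
  moreover have "0 \<le> f (\<lambda>i\<in>{1..n}. y i) \<and> f (\<lambda>i\<in>{1..n}. y i) \<le> 1" if "y \<in> set_pmf ?p" for y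
  proof -
    have "y i \<in> set_pmf (transition P m (x i))" if "i \<in> {1..n}" for i
      using \<open>y \<in> set_pmf ?p\<close> that by (auto simp: set_Pi_pmf PiE_dflt_def)
    then have "y i \<in> \<Omega>" if "i \<in> {1..n}" for i
      using subsetD[OF set_transition[OF supp m PiE_mem[OF x that]]] that by blast
    then have "(\<lambda>i\<in>{1..n}. y i) \<in> {1..n} \<rightarrow>\<^sub>E \<Omega>" by auto
    then show ?thesis using f by (auto simp: Pi_iff)
  qed
  ultimately show ?thesis
    using expectation_mono_finite[of ?p "\<lambda>_. 0" "\<lambda>y. f (\<lambda>i\<in>{1..n}. y i)"]
      expectation_mono_finite[of ?p "\<lambda>y. f (\<lambda>i\<in>{1..n}. y i)" "\<lambda>_. 1"]
    by (simp add: transition_exp_def)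
qed

lemma expectation_step_vec:
  fixes f :: "(nat \<Rightarrow> 'a) \<Rightarrow> real"
  assumes "map_pmf (\<lambda>X. X j) P = \<pi>"
  shows "measure_pmf.expectation (iid_tuples n P) (\<lambda>X. f (step_vec n X j)) =
    measure_pmf.expectation (Pi_pmf {1..n} (undefined j) (\<lambda>_. \<pi>)) (\<lambda>x. f (\<lambda>i\<in>{1..n}. x i))"
proof -
  have "Pi_pmf {1..n} (undefined j) (\<lambda>_. \<pi>) = map_pmf (\<lambda>X. (\<lambda>X. X j) \<circ> X) (iid_tuples n P)"
    unfolding iid_tuples_def assms[symmetric] by (rule Pi_pmf_map) auto
  then show ?thesis by (simp add: step_vec_def o_def)
qed

text \<open>Restriction to \<open>1..n\<close> discards the default. This reconciles the defaults
  \<open>undefined j\<close> that arise at different times \<open>j\<close>.\<close>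

lemma expectation_default_irrelevant:
  fixes n :: nat
  shows "measure_pmf.expectation (Pi_pmf {1..n} d (\<lambda>_. \<pi>)) (\<lambda>x. f (\<lambda>i\<in>{1..n}. x i) :: real) =
    measure_pmf.expectation (Pi_pmf {1..n} d' (\<lambda>_. \<pi>)) (\<lambda>x. f (\<lambda>i\<in>{1..n}. x i))"
proof -
  have "Pi_pmf {1..n} d (\<lambda>_. \<pi>) = map_pmf (\<lambda>x i. if i \<in> {1..n} then x i else d) (Pi_pmf {1..n} d' (\<lambda>_. \<pi>))"
    by (rule Pi_pmf_default_swap[symmetric]) simp
  moreover have "(\<lambda>i\<in>{1..n}. if i \<in> {1..n} then x i else d) = (\<lambda>i\<in>{1..n}. x i)" for x by auto
  ultimately show ?thesis by (simp del: One_nat_def)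
qed

theorem theorem8p2:
  shows "\<exists>c :: real \<Rightarrow> nat \<Rightarrow> real \<Rightarrow> real.
    (\<forall>\<alpha> l \<mu>. \<alpha> > 0 \<and> \<mu> > 0 \<longrightarrow> c \<alpha> l \<mu> > 0) \<and>
    (\<forall>(\<Omega> :: 'a set) (l :: nat) (P :: (nat \<Rightarrow> 'a) pmf) (\<pi> :: 'a pmf).
       finite \<Omega> \<and> l \<ge> 2 \<and> set_pmf P \<subseteq> ({1..l} \<rightarrow>\<^sub>E \<Omega>) \<and>
       equal_marginals l P \<pi> \<and> set_pmf \<pi> = \<Omega> \<and> generated_by_Markov_chains \<Omega> l P \<longrightarrow>
       (\<forall>(n :: nat) (f :: (nat \<Rightarrow> 'a) \<Rightarrow> real) (\<mu> :: real).
          f \<in> ({1..n} \<rightarrow>\<^sub>E \<Omega>) \<rightarrow> {0..1} \<and>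
          measure_pmf.expectation (iid_tuples n P) (\<lambda>X. f (step_vec n X 1)) = \<mu> \<and> \<mu> > 0 \<longrightarrow>
          measure_pmf.expectation (iid_tuples n P) (\<lambda>X. \<Prod>j\<in>{1..l}. f (step_vec n X j))
            \<ge> c (diag_min \<Omega> l P) l \<mu>))"
proof -
  define two_step where "two_step \<alpha> \<mu> c \<longleftrightarrow> c > 0 \<and> (\<forall>(\<Omega> :: 'a set) Q d (n :: nat) f. finite \<Omega> \<longrightarrow>
    set_pmf Q \<subseteq> \<Omega> \<times> \<Omega> \<longrightarrow> map_pmf fst Q = map_pmf snd Q \<longrightarrow> (\<forall>x\<in>\<Omega>. \<alpha> \<le> pmf Q (x, x)) \<longrightarrow>
    f \<in> ({1..n} \<rightarrow>\<^sub>E \<Omega>) \<rightarrow> {0..1} \<longrightarrow>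
    \<mu> \<le> measure_pmf.expectation (Pi_pmf {1..n} d (\<lambda>_. Q)) (\<lambda>X. f (\<lambda>i\<in>{1..n}. fst (X i))) \<longrightarrow>
    c \<le> measure_pmf.expectation (Pi_pmf {1..n} d (\<lambda>_. Q))
      (\<lambda>X. f (\<lambda>i\<in>{1..n}. fst (X i)) * f (\<lambda>i\<in>{1..n}. snd (X i))))" for \<alpha> \<mu> c :: real
  \<comment> \<open>The constant can be chosen as a function of \<open>\<alpha>\<close> and
    \<open>\<mu>\<close> because it precedes the quantifiers over \<open>\<Omega>\<close>,
    \<open>n\<close> and \<open>f\<close>.\<close>
  have "\<forall>\<alpha> \<mu>. \<exists>c. 0 < \<alpha> \<longrightarrow> 0 < \<mu> \<longrightarrow> two_step \<alpha> \<mu> c"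
  proof (intro allI)
    fix \<alpha> \<mu> :: real
    show "\<exists>c. 0 < \<alpha> \<longrightarrow> 0 < \<mu> \<longrightarrow> two_step \<alpha> \<mu> c"
      using two_step_bound[of \<alpha> \<mu>, where ?'a = 'a] unfolding two_step_def by (cases "0 < \<alpha> \<and> 0 < \<mu>") auto
  qed
  then obtain c2 where c2: "\<And>\<alpha> \<mu>. 0 < \<alpha> \<Longrightarrow> 0 < \<mu> \<Longrightarrow> two_step \<alpha> \<mu> (c2 \<alpha> \<mu>)"
    by metis
  \<comment> \<open>Each further step of the chain replaces the bound on the mean by its image under
    \<open>c2 \<alpha>\<close>, so \<open>l\<close> factors take \<open>l - 1\<close>
    iterations.\<close>
  define c where "c \<alpha> l \<mu> = (if \<alpha> > 0 then (c2 \<alpha> ^^ (l - 1)) \<mu> else 0)" for \<alpha> \<mu> :: real and l :: nat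
  have c2_pos: "0 < (c2 \<alpha> ^^ m) \<mu>" if "0 < \<alpha>" "0 < \<mu>" for \<alpha> \<mu> m
    using that c2 by (induction m) (auto simp: two_step_def)
  show ?thesis
  proof (intro exI[of _ c] conjI allI impI)
    show "c \<alpha> l \<mu> > 0" if "\<alpha> > 0 \<and> \<mu> > 0" for \<alpha> l \<mu>
      using that c2_pos by (simp add: c_def)
  next
    fix \<Omega> :: "'a set" and l :: nat and P :: "(nat \<Rightarrow> 'a) pmf" and \<pi> :: "'a pmf"
      and n :: nat and f :: "(nat \<Rightarrow> 'a) \<Rightarrow> real" and \<mu> :: real
    assume A: "finite \<Omega> \<and> l \<ge> 2 \<and> set_pmf P \<subseteq> ({1..l} \<rightarrow>\<^sub>E \<Omega>) \<and>
       equal_marginals l P \<pi> \<and> set_pmf \<pi> = \<Omega> \<and> generated_by_Markov_chains \<Omega> l P"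
      and B: "f \<in> ({1..n} \<rightarrow>\<^sub>E \<Omega>) \<rightarrow> {0..1} \<and>
          measure_pmf.expectation (iid_tuples n P) (\<lambda>X. f (step_vec n X 1)) = \<mu> \<and> \<mu> > 0"
    define \<alpha> where "\<alpha> = diag_min \<Omega> l P"
    let ?E = "measure_pmf.expectation (iid_tuples n P)"
    have fin: "finite \<Omega>" and supp: "set_pmf P \<subseteq> {1..l} \<rightarrow>\<^sub>E \<Omega>" and l: "2 \<le> l"
      and M: "generated_by_Markov_chains \<Omega> l P" using A by auto
    have marg: "map_pmf (\<lambda>X. X j) P = \<pi>" if "j \<in> {1..l}" for j
      using A that by (simp add: equal_marginals_def)
    have finP: "finite (set_pmf (iid_tuples n P))"
      by (intro finite_iid_tuples finite_support_tuples[OF fin supp])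
    have same_mean: "?E (\<lambda>X. g (step_vec n X j)) = ?E (\<lambda>X. g (step_vec n X k))"
      if "j \<in> {1..l}" "k \<in> {1..l}" for g :: "(nat \<Rightarrow> 'a) \<Rightarrow> real" and j k
      unfolding expectation_step_vec[OF marg[OF that(1)]] expectation_step_vec[OF marg[OF that(2)]]
      by (rule expectation_default_irrelevant)
    have range: "0 \<le> g (step_vec n X j) \<and> g (step_vec n X j) \<le> 1"
      if "g \<in> ({1..n} \<rightarrow>\<^sub>E \<Omega>) \<rightarrow> {0..1}" "X \<in> set_pmf (iid_tuples n P)" "j \<in> {1..l}" for g :: "(nat \<Rightarrow> 'a) \<Rightarrow> real" and X j
      using that step_vec_in[OF supp that(2,3)] by (auto simp: Pi_iff)
    have pair: "c2 \<alpha> \<nu> \<le> ?E (\<lambda>X. g (step_vec n X m) * g (step_vec n X (Suc m)))"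
      if \<alpha>: "\<alpha> > 0" and \<nu>: "0 < \<nu>" and m: "1 \<le> m" "m < l" and g: "g \<in> ({1..n} \<rightarrow>\<^sub>E \<Omega>) \<rightarrow> {0..1}"
        and mean: "\<nu> \<le> ?E (\<lambda>X. g (step_vec n X m))" for g \<nu> m
    proof -
      let ?g = "\<lambda>X. (X m, X (Suc m))"
      let ?Q = "map_pmf ?g P"
      have law: "Pi_pmf {1..n} (?g undefined) (\<lambda>_. ?Q) = map_pmf (\<lambda>X. ?g \<circ> X) (iid_tuples n P)"
        unfolding iid_tuples_def by (rule Pi_pmf_map) auto
      have Q1: "set_pmf ?Q \<subseteq> \<Omega> \<times> \<Omega>" using supp m by (auto simp: PiE_iff)
      have Q2: "map_pmf fst ?Q = map_pmf snd ?Q"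
        using marg[of m] marg[of "Suc m"] m by (simp add: pmf.map_comp o_def)
      \<comment> \<open>The constant tuple at \<open>x\<close> projects to the pair
        \<open>(x, x)\<close>.\<close>
      have Q3: "\<alpha> \<le> pmf ?Q (x, x)" if "x \<in> \<Omega>" for x
      proof -
        have "\<alpha> \<le> pmf P (\<lambda>j\<in>{1..l}. x)" unfolding \<alpha>_def diag_min_def using fin that by (intro Min_le) auto
        also have "\<dots> = measure (measure_pmf P) {\<lambda>j\<in>{1..l}. x}" by (simp add: measure_pmf_single)
        also have "\<dots> \<le> measure (measure_pmf P) (?g -` {(x, x)})"
          using m by (intro measure_pmf.finite_measure_mono) auto
        finally show ?thesis by (simp add: pmf_map)
      qed
      have Q4: "\<nu> \<le> measure_pmf.expectation (Pi_pmf {1..n} (?g undefined) (\<lambda>_. ?Q)) (\<lambda>X. g (\<lambda>i\<in>{1..n}. fst (X i)))"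
        using mean unfolding law by (simp add: step_vec_def)
      have "c2 \<alpha> \<nu> \<le> measure_pmf.expectation (Pi_pmf {1..n} (?g undefined) (\<lambda>_. ?Q))
          (\<lambda>X. g (\<lambda>i\<in>{1..n}. fst (X i)) * g (\<lambda>i\<in>{1..n}. snd (X i)))"
        by (rule conjunct2[OF c2[OF \<alpha> \<nu>, unfolded two_step_def], rule_format, OF fin Q1 Q2 Q3 g[rule_format] Q4])
      then show ?thesis unfolding law by (simp add: step_vec_def)
    qed
    \<comment> \<open>\<open>g\<close> and \<open>\<nu>\<close> vary in the induction, as the
      shorter chain is used for \<open>h\<close>, whose mean is only known to be at least
      \<open>c2 \<alpha> \<nu>\<close>.\<close>
    have chain: "(c2 \<alpha> ^^ m) \<nu> \<le> ?E (\<lambda>X. \<Prod>j\<in>{1..Suc m}. g (step_vec n X j))"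
      if \<alpha>: "\<alpha> > 0" and "0 < \<nu>" "Suc m \<le> l" "g \<in> ({1..n} \<rightarrow>\<^sub>E \<Omega>) \<rightarrow> {0..1}"
        "\<nu> \<le> ?E (\<lambda>X. g (step_vec n X 1))" for m g \<nu>
      using that(2-)
    proof (induction m arbitrary: g \<nu>)
      case 0
      then show ?case by simp
    next
      case (Suc m)
      let ?m = "Suc m"
      have m: "1 \<le> ?m" "?m < l" "?m \<in> {1..l}" "1 \<in> {1..l}" using Suc.prems l by auto
      define T where "T = transition_exp n P ?m g"
      define h where "h x = g x * T x" for x
      have T: "0 \<le> T x \<and> T x \<le> 1" if "x \<in> {1..n} \<rightarrow>\<^sub>E \<Omega>" for x
        unfolding T_def using m(2) Suc.prems(3) that by (intro transition_exp_range[OF fin supp]) auto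
      have g: "0 \<le> g x \<and> g x \<le> 1" if "x \<in> {1..n} \<rightarrow>\<^sub>E \<Omega>" for x
        using Suc.prems(3) that by (auto simp: Pi_iff)
      have h_le: "h x \<le> g x" if "x \<in> {1..n} \<rightarrow>\<^sub>E \<Omega>" for x
        using mult_left_mono[of "T x" 1 "g x"] T[OF that] g[OF that] by (simp add: h_def)
      have h: "h \<in> ({1..n} \<rightarrow>\<^sub>E \<Omega>) \<rightarrow> {0..1}"
        using g T by (auto simp: h_def intro!: mult_nonneg_nonneg mult_le_one)
      \<comment> \<open>Equal marginals carry the mean of \<open>g\<close> from time 1 to time
        \<open>?m\<close>, and then that of \<open>h\<close> back.\<close>
      have "c2 \<alpha> \<nu> \<le> ?E (\<lambda>X. g (step_vec n X ?m) * g (step_vec n X (Suc ?m)))"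
        using Suc.prems m same_mean[OF m(3,4), of g] by (intro pair \<alpha>) auto
      also have "\<dots> = ?E (\<lambda>X. g (step_vec n X ?m) * T (step_vec n X ?m))"
        unfolding T_def by (rule iid_Markov_step[OF fin M supp m(1,2)]) (intro arg_cong[where f = g] step_vec_cong, use m in auto)
      also have "\<dots> = ?E (\<lambda>X. h (step_vec n X 1))"
        unfolding h_def[symmetric] by (rule same_mean[OF m(3,4)])
      finally have "(c2 \<alpha> ^^ m) (c2 \<alpha> \<nu>) \<le> ?E (\<lambda>X. \<Prod>j\<in>{1..Suc m}. h (step_vec n X j))"
        using Suc.prems h c2[OF \<alpha> Suc.prems(1)] by (intro Suc.IH) (auto simp: two_step_def)
      \<comment> \<open>Only the last \<open>T\<close> is kept; at earlier times \<open>h\<close> is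
        replaced by the larger \<open>g\<close>.\<close>
      also have "\<dots> \<le> ?E (\<lambda>X. (\<Prod>j\<in>{1..Suc m}. g (step_vec n X j)) * T (step_vec n X ?m))"
      proof (rule expectation_mono_finite[OF finP])
        fix X assume X: "X \<in> set_pmf (iid_tuples n P)"
        have X_in: "step_vec n X j \<in> {1..n} \<rightarrow>\<^sub>E \<Omega>" if "j \<in> {1..Suc m}" for j
          using that m by (intro step_vec_in[OF supp X]) auto
        have "(\<Prod>j\<in>{1..m}. h (step_vec n X j)) * h (step_vec n X ?m) \<le>
            (\<Prod>j\<in>{1..m}. g (step_vec n X j)) * h (step_vec n X ?m)"
          using X_in h h_le by (intro mult_right_mono prod_mono) (auto simp: Pi_iff)
        then show "(\<Prod>j\<in>{1..Suc m}. h (step_vec n X j)) \<le>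
            (\<Prod>j\<in>{1..Suc m}. g (step_vec n X j)) * T (step_vec n X ?m)"
          by (simp add: h_def mult.assoc)
      qed
      also have "\<dots> = ?E (\<lambda>X. (\<Prod>j\<in>{1..Suc m}. g (step_vec n X j)) * g (step_vec n X (Suc ?m)))"
        unfolding T_def
        by (rule iid_Markov_step[OF fin M supp m(1,2), symmetric])
          (intro prod.cong refl arg_cong[where f = g] step_vec_cong, auto)
      also have "\<dots> = ?E (\<lambda>X. \<Prod>j\<in>{1..Suc (Suc m)}. g (step_vec n X j))" by simp
      finally show ?case by (simp only: funpow_Suc_right o_apply)
    qed
    show "?E (\<lambda>X. \<Prod>j\<in>{1..l}. f (step_vec n X j)) \<ge> c (diag_min \<Omega> l P) l \<mu>"
    proof (cases "\<alpha> > 0")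
      case True
      have "Suc (l - 1) = l" using l by simp
      then show ?thesis
        using chain[OF True, of \<mu> "l - 1" f] True B unfolding \<alpha>_def[symmetric] c_def by simp
    next
      case False
      have "0 \<le> ?E (\<lambda>X. \<Prod>j\<in>{1..l}. f (step_vec n X j))"
        using B range by (intro integral_nonneg_AE) (auto simp: AE_measure_pmf_iff intro!: prod_nonneg)
      then show ?thesis using False unfolding \<alpha>_def[symmetric] c_def by simp
    qed
  qed
qed

end
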